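(* Let $n\geq 3$. Then \[ \mathrm{ex}_{\mathcal{P}}(n,C_3\text{-}C_3)=\begin{cases} 3n-6 & \text{if } n\leq 5,\\ 3n-7 & \text{if } n=6,\\ \lceil 5n/2\rceil-5 & \text{if } n\geq 7.\end{cases} \]
   Context: All graphs are simple. For a graph $H$, $\mathrm{ex}_{\mathcal{P}}(n,H)$ denotes the maximum number of edges in an $n$-vertex planar graph that contains no subgraph isomorphic to $H$. $C_k$ denotes the cycle on $k$ vertices. $C_k\text{-}C_\ell$ denotes the graph consisting of two vertex-disjoint cycles $C_k$ and $C_\ell$ together with one edge joining a vertex of the first cycle to a vertex of the second cycle. *)

theory Defs
  imports "HOL-Analysis.Analysis"
begin

record 'a graph =
  verts :: "'a set"
  edges :: "'a set set"

definition simple_graph :: "'a graph \<Rightarrow> bool" where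
  "simple_graph G \<longleftrightarrow> (\<forall>e\<in>edges G. e \<subseteq> verts G \<and> card e = 2)"

definition subgraph :: "'a graph \<Rightarrow> 'a graph \<Rightarrow> bool" where
  "subgraph H G \<longleftrightarrow> simple_graph H \<and> verts H \<subseteq> verts G \<and> edges H \<subseteq> edges G"

definition graph_iso :: "'a graph \<Rightarrow> 'b graph \<Rightarrow> bool" where
  "graph_iso G H \<longleftrightarrow>
     (\<exists>f. bij_betw f (verts G) (verts H) \<and>
          (\<forall>u\<in>verts G. \<forall>v\<in>verts G. {u, v} \<in> edges G \<longleftrightarrow> {f u, f v} \<in> edges H))"

definition contains_copy :: "'a graph \<Rightarrow> 'b graph \<Rightarrow> bool" where
  "contains_copy G H \<longleftrightarrow> (\<exists>G'. subgraph G' G \<and> graph_iso G' H)"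

text \<open>
  A drawing in the plane: \<open>p\<close> places the vertices at distinct points, and \<open>\<gamma> e\<close> is an arc between
  the two ends of \<open>e\<close>, whose interior \<open>\<gamma> e ` {0<..<1}\<close> contains no vertex and no point of another
  edge. The plane is modelled by the type of complex numbers, as in the library's treatment of the
  Jordan curve theorem.
\<close>

definition plane_drawing ::
    "'a graph \<Rightarrow> ('a \<Rightarrow> complex) \<Rightarrow> ('a set \<Rightarrow> real \<Rightarrow> complex) \<Rightarrow> bool" where
  "plane_drawing G p \<gamma> \<longleftrightarrow>
     inj_on p (verts G) \<and>
     (\<forall>e\<in>edges G. arc (\<gamma> e) \<and> {pathstart (\<gamma> e), pathfinish (\<gamma> e)} = p ` e) \<and>
     (\<forall>e\<in>edges G. \<gamma> e ` {0<..<1} \<inter> p ` verts G = {}) \<and>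
     (\<forall>e\<in>edges G. \<forall>e'\<in>edges G. e \<noteq> e' \<longrightarrow> \<gamma> e ` {0<..<1} \<inter> path_image (\<gamma> e') = {})"

definition planar :: "'a graph \<Rightarrow> bool" where
  "planar G \<longleftrightarrow> (\<exists>p \<gamma>. plane_drawing G p \<gamma>)"

text \<open>
  Up to isomorphism every \<open>n\<close>-vertex graph has its vertices in \<open>nat\<close>. The set below is
  finite, and it is nonempty whenever \<open>H\<close> has an edge.
\<close>

definition ex_planar :: "nat \<Rightarrow> 'b graph \<Rightarrow> nat" where
  "ex_planar n H =
     Max {card (edges G) | G :: nat graph.
            simple_graph G \<and> finite (verts G) \<and> card (verts G) = n \<and>
            planar G \<and> \<not> contains_copy G H}"

definition cycle_graph :: "nat \<Rightarrow> nat graph" where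
  "cycle_graph k = \<lparr>verts = {..<k}, edges = {{i, (i + 1) mod k} | i. i < k}\<rparr>"

text \<open>
  The choice of the two joined vertices is immaterial up to isomorphism, by rotational symmetry of
  the cycles.
\<close>

definition cycle_cycle :: "nat \<Rightarrow> nat \<Rightarrow> (nat + nat) graph" where
  "cycle_cycle k l =
     \<lparr>verts = Inl ` verts (cycle_graph k) \<union> Inr ` verts (cycle_graph l),
      edges = (`) Inl ` edges (cycle_graph k) \<union> (`) Inr ` edges (cycle_graph l)
              \<union> {{Inl 0, Inr 0}}\<rparr>"

end

theory Submission
  imports Defs
begin

text \<open>
  Upper bound. The number of faces of a drawing obeys Euler's inequality, because by Janiszewski's
  theorem and the Jordan curve theorem drawing an arc between two connected points splits exactly
  one face in two. Counting edge-face incidences gives \<open>2 e + 8 \<le> 4 n + f\<^sub>3\<close>, where \<open>f\<^sub>3\<close> is the number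
  of triangular faces, so it suffices to show \<open>f\<^sub>3 \<le> n - 1\<close>. If there is no \<open>C\<^sub>3\<close>-\<open>C\<^sub>3\<close>, then
  intersecting is an equivalence relation on triangles: two disjoint triangles meeting a third one
  are joined by an edge of it. A class of facial triangles with a common vertex \<open>x\<close> is smaller than
  the set of vertices it covers, since each edge at \<open>x\<close> lies on two faces. A class without common
  vertex is covered by two vertices and has at most 7 members, which only uses that 5 vertices span
  at most 9 edges and 6 vertices at most 12; for \<open>n = 7\<close> the bound \<open>f\<^sub>3 \<le> 7\<close> is enough by parity.

  Lower bound. For \<open>n \<ge> 7\<close> take the cone over a ladder: the ladder is triangle-free, so all triangles
  share the apex.
\<close>

section \<open>Faces of a system of arcs in the plane\<close>

text \<open>With \<open>f3 <= n - 1\<close> the incidence count reads \<open>2 e <= 5 n - 9\<close>,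
  whose integer part is the claimed value. The count avoids facial walks: an edge borders a face
  when its open arc touches the closure of the face, and a face with at most three border edges is
  triangular because the complement of a forest is connected. Euler's formula appears as an
  inequality that covers disconnected graphs as well.

  The obstacle is that a class of triangles without common vertex is bounded only by the number of
  vertices it covers, so that several classes add up to \<open>n\<close> and not to
  \<open>n - 1\<close>. The missing unit comes from connectivity: if several classes covered all
  vertices, an edge leaving one class would join two disjoint triangles. Disconnected graphs are
  split off by induction. A second danger is a small class that is a closed triangulated sphere,
  such as the bipyramid with 6 faces on 5 vertices. The facial triangles of such a sphere leave no
  face in which a further edge could lie, so the sphere would be the whole graph, which has too many
  edges for that.\<close>

lemma subsingleton_card:
  assumes "\<And>x y. \<lbrakk>x \<in> A; y \<in> A\<rbrakk> \<Longrightarrow> x = y"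
  shows "finite A" "card A \<le> 1"
proof -
  have "A \<subseteq> {SOME x. x \<in> A}" using assms someI[of "\<lambda>x. x \<in> A"] by blast
  then show "finite A" "card A \<le> 1"
    using finite_subset card_mono[of "{SOME x. x \<in> A}" A] by auto
qed

lemma card_image_less: "\<lbrakk>finite A; \<not> inj_on f A\<rbrakk> \<Longrightarrow> card (f ` A) < card A"
  using card_image_le[of A f] eq_card_imp_inj_on[of A f] by fastforce

section \<open>Adding one arc to a compact plane set\<close>

lemma interior_arc_image_empty:
  fixes g :: "real \<Rightarrow> complex"
  assumes "arc g"
  shows "interior (path_image g) = {}"
proof (rule ccontr)
  assume ne: "interior (path_image g) \<noteq> {}"
  obtain h k where hk: "homeomorphism (path_image g) {0..1::real} h k"
    using homeomorphic_arc_image_interval[OF assms, of 0 1] unfolding homeomorphic_def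
    by (metis zero_less_one)
  have sub: "interior (path_image g) \<subseteq> path_image g" by (rule interior_subset)
  have "continuous_on (interior (path_image g)) h"
    using homeomorphism_cont1[OF hk] sub by (rule continuous_on_subset)
  moreover have "inj_on h (interior (path_image g))"
    using homeomorphism_apply1[OF hk] sub by (intro inj_on_inverseI[of _ k]) auto
  ultimately have "DIM(complex) \<le> DIM(real)"
    by (rule invariance_of_dimension[OF _ open_interior _ ne])
  then show False by simp
qed

lemma path_image_eq_open_arc_Un_ends:
  "path_image g = g ` {0<..<1} \<union> {pathstart g, pathfinish g}"
proof -
  have "{0..1::real} = {0<..<1} \<union> {0,1}" by auto
  then show ?thesis unfolding path_image_def pathstart_def pathfinish_def by auto
qed

text \<open>Janiszewski's theorem twice: \<open>K\<close> meets the arc in one point, hence in a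
  connected set, and then \<open>K\<close> with the arc meets \<open>L\<close> in one point. This is
  the situation of an edge that joins two components of a drawing and creates no new face.\<close>

lemma arc_join_two_closed_not_separating:
  fixes g :: "real \<Rightarrow> complex"
  assumes "compact K" "compact L" "arc g" "K \<inter> path_image g = {a}" "L \<inter> path_image g = {b}"
    and "K \<inter> L = {}"
    and xy: "connected_component (- (K \<union> L)) x y" "x \<notin> path_image g" "y \<notin> path_image g"
  shows "connected_component (- (K \<union> L \<union> path_image g)) x y"
proof -
  have g: "connected_component (- path_image g) x y"
    using connected_arc_complement[OF \<open>arc g\<close>] xy(2,3) by (simp add: connected_iff_connected_component)
  have K: "connected_component (- K) x y" and L: "connected_component (- L) x y"
    using xy(1) connected_component_of_subset by blast+
  have 1: "connected_component (- (K \<union> path_image g)) x y"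
    using Janiszewski[OF \<open>compact K\<close> _ _ K g] assms(4) \<open>arc g\<close>
    by (simp add: closed_arc_image)
  have "(K \<union> path_image g) \<inter> L = {b}" using assms(5,6) by blast
  then have "connected_component (- ((K \<union> path_image g) \<union> L)) x y"
    using Janiszewski[of "K \<union> path_image g" L, OF _ _ _ 1 L] assms(1,2) \<open>arc g\<close>
    by (simp add: compact_Un compact_arc_image compact_imp_closed)
  then show ?thesis by (simp add: Un_ac)
qed

text \<open>The ends of \<open>g\<close> are joined inside \<open>X\<close> by an arc
  \<open>q\<close>, so \<open>g\<close> and \<open>q\<close> form a Jordan curve with sides
  \<open>I\<close> and \<open>J\<close>. The curve meets \<open>X\<close> exactly in
  \<open>q\<close>, a connected set; by Janiszewski's theorem two points separated neither by the
  curve nor by \<open>X\<close> are not separated by their union.\<close>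

lemma arc_between_connected_points_splits:
  fixes g :: "real \<Rightarrow> complex"
  assumes "compact X" "arc g" "g ` {0<..<1} \<inter> X = {}"
    and pc: "path_component X (pathstart g) (pathfinish g)"
  obtains I J where "open I" "open J" "I \<inter> J = {}" "- (X \<union> path_image g) \<subseteq> I \<union> J"
    "(I \<union> J) \<inter> path_image g = {}"
    "path_image g \<subseteq> closure I" "path_image g \<subseteq> closure J"
    "\<And>x y. \<lbrakk>x \<in> I \<and> y \<in> I \<or> x \<in> J \<and> y \<in> J; connected_component (- X) x y\<rbrakk>
      \<Longrightarrow> connected_component (- (X \<union> path_image g)) x y"
    "\<And>x y. \<lbrakk>x \<in> I; y \<in> J\<rbrakk> \<Longrightarrow> \<not> connected_component (- (X \<union> path_image g)) x y"
proof -
  have ne: "pathstart g \<noteq> pathfinish g" using arc_distinct_ends[OF \<open>arc g\<close>] by metis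
  let ?S = "path_component_set X (pathstart g)"
  have "path_connected ?S" by simp
  moreover have "pathstart g \<in> ?S" "pathfinish g \<in> ?S"
    using pc path_component_mem(1)[OF pc] by (simp_all add: path_component_refl)
  ultimately obtain q where q: "arc q" "path_image q \<subseteq> ?S" "pathstart q = pathfinish g"
      "pathfinish q = pathstart g"
    using ne unfolding path_connected_arcwise by metis
  have qX: "path_image q \<subseteq> X" using q(2) path_component_subset by blast
  have gi: "path_image g = g ` {0<..<1} \<union> {pathstart g, pathfinish g}"
    by (rule path_image_eq_open_arc_Un_ends)
  have ends: "pathstart g \<in> path_image q" "pathfinish g \<in> path_image q"
    using q by (metis pathfinish_in_path_image pathstart_in_path_image)+
  have "path_image g \<inter> path_image q \<subseteq> {pathstart g, pathstart q}"
    using gi qX assms(3) q(3) by auto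
  then have sp: "simple_path (g +++ q)"
    using simple_path_join_loop assms(2) q by metis
  have loop: "pathfinish (g +++ q) = pathstart (g +++ q)" using q by simp
  let ?C = "path_image g \<union> path_image q"
  have pC: "path_image (g +++ q) = ?C" using q by (simp add: path_image_join)
  obtain I J where IJ: "open I" "connected I" "open J" "connected J" "I \<inter> J = {}"
      "I \<union> J = - ?C" "frontier I = ?C" "frontier J = ?C"
    using Jordan_curve[OF sp loop] unfolding pC by metis
  have CX: "?C \<inter> X = path_image q" using gi qX assms(3) ends by auto
  have CX': "?C \<union> X = X \<union> path_image g" using qX by auto
  have cC: "compact ?C" using assms(2) q by (simp add: compact_Un compact_arc_image)
  show ?thesis
  proof (rule that[OF IJ(1,3,5)])
    show "- (X \<union> path_image g) \<subseteq> I \<union> J" using IJ(6) qX by auto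
    show "(I \<union> J) \<inter> path_image g = {}" using IJ(6) by auto
    show "path_image g \<subseteq> closure I" "path_image g \<subseteq> closure J"
      using IJ(7,8) by (auto simp: frontier_def)
    show "connected_component (- (X \<union> path_image g)) x y"
      if "x \<in> I \<and> y \<in> I \<or> x \<in> J \<and> y \<in> J" "connected_component (- X) x y" for x y
    proof -
      have "connected_component (- ?C) x y"
        using that(1) IJ(2,4,6) unfolding connected_component_def by blast
      from Janiszewski[OF cC _ _ this that(2)] show ?thesis
        using assms(1) q(1) CX CX' by (simp add: compact_imp_closed connected_arc_image)
    qed
    show "\<not> connected_component (- (X \<union> path_image g)) x y" if "x \<in> I" "y \<in> J" for x y
    proof
      assume "connected_component (- (X \<union> path_image g)) x y"
      then obtain S where S: "connected S" "S \<subseteq> - (X \<union> path_image g)" "x \<in> S" "y \<in> S"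
        unfolding connected_component_def by blast
      then have "S \<subseteq> I \<union> J" using IJ(6) qX by auto
      then show False using connectedD[OF S(1) IJ(1,3)] S that IJ(5) by auto
    qed
  qed
qed

section \<open>Faces and their borders\<close>

locale arc_system =
  fixes W :: "complex set" and E :: "'e set" and \<gamma> :: "'e \<Rightarrow> real \<Rightarrow> complex"
  assumes finW: "finite W" and finE: "finite E"
    and arcs: "e \<in> E \<Longrightarrow> arc (\<gamma> e)"
    and ends: "e \<in> E \<Longrightarrow> pathstart (\<gamma> e) \<in> W \<and> pathfinish (\<gamma> e) \<in> W"
    and avoid_points: "e \<in> E \<Longrightarrow> \<gamma> e ` {0<..<1} \<inter> W = {}"
    and avoid_arcs: "\<lbrakk>e \<in> E; e' \<in> E; e \<noteq> e'\<rbrakk> \<Longrightarrow> \<gamma> e ` {0<..<1} \<inter> path_image (\<gamma> e') = {}"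
begin

text \<open>Every subset \<open>B\<close> of the edges is drawn with all of \<open>W\<close>,
  isolated points included. Edges can thus be added and deleted one at a time while the vertex count
  stays fixed.\<close>

definition skel :: "'e set \<Rightarrow> complex set" where
  "skel B = W \<union> (\<Union>e\<in>B. path_image (\<gamma> e))"

definition faces :: "'e set \<Rightarrow> complex set set" where
  "faces B = components (- skel B)"

text \<open>Touching the closure in an interior point of the arc replaces membership in a facial
  walk. A bridge counts once for its face.\<close>

definition border :: "'e set \<Rightarrow> complex set \<Rightarrow> 'e set" where
  "border B \<Phi> = {e \<in> B. \<gamma> e ` {0<..<1} \<inter> closure \<Phi> \<noteq> {}}"

lemma skel_insert: "skel (insert e B) = skel B \<union> path_image (\<gamma> e)"
  by (auto simp: skel_def)

lemma skel_mono: "B \<subseteq> B' \<Longrightarrow> skel B \<subseteq> skel B'"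
  by (auto simp: skel_def)

lemma compact_skel: "B \<subseteq> E \<Longrightarrow> compact (skel B)"
  unfolding skel_def using finW finE arcs
  by (intro compact_Un compact_UN) (auto intro: compact_arc_image finite_subset finite_imp_compact)

lemma open_Compl_skel: "B \<subseteq> E \<Longrightarrow> open (- skel B)"
  using compact_skel compact_imp_closed open_Compl by blast

lemma open_arc_disjoint_skel:
  "\<lbrakk>B \<subseteq> E; e \<in> E; e \<notin> B\<rbrakk> \<Longrightarrow> \<gamma> e ` {0<..<1} \<inter> skel B = {}"
  unfolding skel_def using avoid_points avoid_arcs by fastforce

lemma open_face: "\<lbrakk>B \<subseteq> E; \<Phi> \<in> faces B\<rbrakk> \<Longrightarrow> open \<Phi>"
  unfolding faces_def using open_components open_Compl_skel by blast

lemma face_eq_component: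
  assumes "\<Phi> \<in> faces B" "x \<in> \<Phi>"
  shows "\<Phi> = connected_component_set (- skel B) x"
proof -
  obtain z where z: "\<Phi> = connected_component_set (- skel B) z"
    using assms(1) unfolding faces_def components_iff by blast
  with assms(2) have "x \<in> connected_component_set (- skel B) z" by simp
  from connected_component_eq[OF this] z show ?thesis by simp
qed

lemma face_eqI:
  assumes "\<Phi> \<in> faces B" "\<Psi> \<in> faces B" "x \<in> \<Phi>" "y \<in> \<Psi>" "connected_component (- skel B) x y"
  shows "\<Phi> = \<Psi>"
proof -
  have "y \<in> \<Phi>" using face_eq_component[OF assms(1,3)] assms(5) by simp
  then show ?thesis using face_eq_component[OF assms(1)] face_eq_component[OF assms(2,4)] by simp
qed

lemma face_at: "x \<notin> skel B \<Longrightarrow> \<exists>\<Phi>\<in>faces B. x \<in> \<Phi>"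
  unfolding faces_def using Union_components[of "- skel B"] by blast

lemma face_connected_component:
  "\<lbrakk>\<Phi> \<in> faces B; x \<in> \<Phi>; y \<in> \<Phi>\<rbrakk> \<Longrightarrow> connected_component (- skel B) x y"
  using face_eq_component[of \<Phi> B x] by auto

lemma face_subset: "\<Phi> \<in> faces B \<Longrightarrow> \<Phi> \<subseteq> - skel B"
  unfolding faces_def by (rule in_components_subset)

lemma face_connected: "\<Phi> \<in> faces B \<Longrightarrow> connected \<Phi>"
  unfolding faces_def by (rule in_components_connected)

lemma face_nonempty: "\<Phi> \<in> faces B \<Longrightarrow> \<Phi> \<noteq> {}"
  unfolding faces_def by (rule in_components_nonempty)

lemma path_component_subset_or_disjoint:
  assumes "path_connected S" "S \<subseteq> X"
  shows "S \<subseteq> path_component_set X x \<or> S \<inter> path_component_set X x = {}"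
proof (rule ccontr)
  assume *: "\<not> ?thesis"
  then obtain y where y: "y \<in> S" "path_component X x y" by auto
  have "S \<subseteq> path_component_set X y" using assms y(1) by (simp add: path_component_maximal)
  then show False using * y path_component_eq by (metis mem_Collect_eq)
qed

text \<open>A common form for both kinds of new edge. An edge that closes a cycle has the two sides
  of a Jordan curve; an edge that joins two components has the single side
  \<open>UNIV\<close>.\<close>

lemma arc_two_sides:
  assumes B: "B \<subseteq> E" and e: "e \<in> E" "e \<notin> B"
  obtains I J where "- skel (insert e B) \<subseteq> I \<union> J"
    "\<And>x y. \<lbrakk>x \<in> I \<and> y \<in> I \<or> x \<in> J \<and> y \<in> J; connected_component (- skel B) x y;
        x \<notin> path_image (\<gamma> e); y \<notin> path_image (\<gamma> e)\<rbrakk>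
      \<Longrightarrow> connected_component (- skel (insert e B)) x y"
proof (cases "path_component (skel B) (pathstart (\<gamma> e)) (pathfinish (\<gamma> e))")
  case True
  from arc_between_connected_points_splits[OF compact_skel[OF B] arcs[OF e(1)]
      open_arc_disjoint_skel[OF B e] True]
  obtain I J where IJ: "- (skel B \<union> path_image (\<gamma> e)) \<subseteq> I \<union> J"
    "\<And>x y. \<lbrakk>x \<in> I \<and> y \<in> I \<or> x \<in> J \<and> y \<in> J; connected_component (- skel B) x y\<rbrakk>
      \<Longrightarrow> connected_component (- (skel B \<union> path_image (\<gamma> e))) x y" by metis
  show ?thesis by (rule that[of I J]) (use IJ in \<open>simp_all add: skel_insert\<close>)
next
  case False
  let ?X = "skel B" and ?g = "\<gamma> e"
  define K where "K = path_component_set ?X (pathstart ?g)"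
  \<comment> \<open>The skeleton is a finite union of compact path-connected pieces, namely points
    and arcs. A path component is a union of pieces, and so is the rest, which makes both compact as
    Janiszewski's theorem requires.\<close>
  define P where "P = (\<lambda>w. {w}) ` W \<union> (\<lambda>e. path_image (\<gamma> e)) ` B"
  have P: "finite P" "\<Union>P = ?X" "\<And>S. S \<in> P \<Longrightarrow> compact S \<and> path_connected S"
    using finW finE B arcs
    by (auto simp: P_def skel_def finite_subset compact_arc_image arc_imp_path path_connected_path_image)
  have or: "S \<subseteq> K \<or> S \<inter> K = {}" if "S \<in> P" for S
    unfolding K_def using path_component_subset_or_disjoint[of S ?X] P that by blast
  have KX: "K \<subseteq> ?X" unfolding K_def by (rule path_component_subset)
  have "K = \<Union>{S \<in> P. S \<subseteq> K}" using or P(2) KX by blast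
  moreover have "compact (\<Union>{S \<in> P. S \<subseteq> K})" using P by (intro compact_Union) auto
  ultimately have cK: "compact K" by simp
  have "?X - K = \<Union>{S \<in> P. S \<inter> K = {}}"
  proof (intro set_eqI iffI)
    fix x assume x: "x \<in> ?X - K"
    then obtain S where "S \<in> P" "x \<in> S" using P(2) by blast
    moreover from this have "S \<inter> K = {}" using or[of S] x by blast
    ultimately show "x \<in> \<Union>{S \<in> P. S \<inter> K = {}}" by blast
  next
    fix x assume "x \<in> \<Union>{S \<in> P. S \<inter> K = {}}"
    then obtain S where S: "S \<in> P" "S \<inter> K = {}" "x \<in> S" by blast
    then have "x \<in> ?X" using P(2) by blast
    with S show "x \<in> ?X - K" by blast
  qed
  moreover have "compact (\<Union>{S \<in> P. S \<inter> K = {}})" using P by (intro compact_Union) auto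
  ultimately have cL: "compact (?X - K)" by simp
  have se: "pathstart ?g \<in> ?X" "pathfinish ?g \<in> ?X" using ends[OF e(1)] by (auto simp: skel_def)
  have inK: "pathstart ?g \<in> K" "pathfinish ?g \<notin> K"
    using False se unfolding K_def by (auto simp: path_component_refl)
  have gi: "path_image ?g = ?g ` {0<..<1} \<union> {pathstart ?g, pathfinish ?g}"
    by (rule path_image_eq_open_arc_Un_ends)
  note dis = open_arc_disjoint_skel[OF B e]
  have 1: "K \<inter> path_image ?g = {pathstart ?g}" using gi dis KX inK by auto
  have 2: "(?X - K) \<inter> path_image ?g = {pathfinish ?g}" using gi dis KX inK se by auto
  have X: "K \<union> (?X - K) = ?X" using KX by auto
  show ?thesis
  proof (rule that[of UNIV "{}"])
    show "connected_component (- skel (insert e B)) x y"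
      if "connected_component (- skel B) x y" "x \<notin> path_image (\<gamma> e)" "y \<notin> path_image (\<gamma> e)" for x y
      using arc_join_two_closed_not_separating[OF cK cL arcs[OF e(1)] 1 2 _ _ that(2,3)] that(1)
      unfolding X skel_insert by auto
  qed auto
qed

lemma face_subset_face:
  assumes "B \<subseteq> B'" "\<Phi> \<in> faces B'"
  shows "\<exists>\<Psi>\<in>faces B. \<Phi> \<subseteq> \<Psi>"
proof -
  have "\<Phi> \<subseteq> - skel B" using face_subset[OF assms(2)] skel_mono[OF assms(1)] by blast
  then show ?thesis
    using exists_component_superset[of \<Phi> "- skel B"] face_connected[OF assms(2)]
      face_nonempty[OF assms(2)] unfolding faces_def by blast
qed

text \<open>Induction on the edges from the connected complement of a finite set. Inside one old
  face, two new faces that meet the same side of the new arc coincide, so each old face yields at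
  most two.\<close>

lemma finite_faces: "B \<subseteq> E \<Longrightarrow> finite (faces B)"
proof -
  assume B: "B \<subseteq> E"
  then have "finite B" using finE finite_subset by blast
  then show "finite (faces B)" using B
  proof (induction B rule: finite_induct[consumes 1, case_names empty insert])
    case empty
    have "connected (- W)"
      using finW by (intro path_connected_imp_connected path_connected_complement_countable)
        (auto simp: countable_finite)
    then have "components (- W) \<subseteq> {- W}" by (simp add: connected_eq_components_subset_sing)
    then show ?case by (simp add: faces_def skel_def finite_subset)
  next
    case (insert e B)
    then have B: "B \<subseteq> E" "e \<in> E" "e \<notin> B" by auto
    obtain I J where IJ: "- skel (insert e B) \<subseteq> I \<union> J"
      "\<And>x y. \<lbrakk>x \<in> I \<and> y \<in> I \<or> x \<in> J \<and> y \<in> J; connected_component (- skel B) x y;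
          x \<notin> path_image (\<gamma> e); y \<notin> path_image (\<gamma> e)\<rbrakk>
        \<Longrightarrow> connected_component (- skel (insert e B)) x y"
      using arc_two_sides[OF B] by blast
    have sub: "\<Phi> \<subseteq> - skel (insert e B)" if "\<Phi> \<in> faces (insert e B)" for \<Phi>
      by (rule face_subset[OF that])
    let ?S = "\<lambda>Z \<Psi>. {\<Phi> \<in> faces (insert e B). \<Phi> \<subseteq> \<Psi> \<and> \<Phi> \<inter> Z \<noteq> {}}"
    have "finite (?S Z \<Psi>)" if Z: "Z = I \<or> Z = J" and \<Psi>: "\<Psi> \<in> faces B" for Z \<Psi>
    proof -
      have "\<Phi> = \<Phi>'" if "\<Phi> \<in> ?S Z \<Psi>" "\<Phi>' \<in> ?S Z \<Psi>" for \<Phi> \<Phi>'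
      proof -
        obtain x y where xy: "x \<in> \<Phi>" "x \<in> Z" "y \<in> \<Phi>'" "y \<in> Z" using \<open>\<Phi> \<in> ?S Z \<Psi>\<close> \<open>\<Phi>' \<in> ?S Z \<Psi>\<close> by auto
        then have "connected_component (- skel B) x y"
          using that by (intro face_connected_component[OF \<Psi>]) auto
        moreover have "x \<notin> path_image (\<gamma> e)" "y \<notin> path_image (\<gamma> e)"
          using sub that xy unfolding skel_insert by blast+
        ultimately have cc: "connected_component (- skel (insert e B)) x y" using IJ(2) xy Z by blast
        have "\<Phi> \<in> faces (insert e B)" "\<Phi>' \<in> faces (insert e B)" using that by auto
        then show ?thesis by (rule face_eqI) (fact xy cc)+
      qed
      then show ?thesis by (rule subsingleton_card)
    qed
    then have "finite (\<Union>\<Psi>\<in>faces B. ?S I \<Psi> \<union> ?S J \<Psi>)" using insert B by auto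
    moreover have "faces (insert e B) \<subseteq> (\<Union>\<Psi>\<in>faces B. ?S I \<Psi> \<union> ?S J \<Psi>)"
    proof
      fix \<Phi> assume \<Phi>: "\<Phi> \<in> faces (insert e B)"
      then have "\<Phi> \<noteq> {}" by (rule face_nonempty)
      then have "\<Phi> \<inter> I \<noteq> {} \<or> \<Phi> \<inter> J \<noteq> {}" using sub[OF \<Phi>] IJ(1) by blast
      moreover obtain \<Psi> where "\<Psi> \<in> faces B" "\<Phi> \<subseteq> \<Psi>" using face_subset_face[OF _ \<Phi>, of B] by blast
      ultimately show "\<Phi> \<in> (\<Union>\<Psi>\<in>faces B. ?S I \<Psi> \<union> ?S J \<Psi>)" using \<Phi> by blast
    qed
    ultimately show ?case by (rule finite_subset[rotated])
  qed
qed

text \<open>Delete \<open>e\<close>. Every face with \<open>e\<close> in its border is linked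
  through the arc to the midpoint \<open>?w\<close>, so all of them lie in one face of
  \<open>B - {e}\<close>. Two that meet the same side of \<open>e\<close> then coincide.\<close>

lemma card_faces_bordering_edge:
  assumes B: "B \<subseteq> E" and e: "e \<in> B"
  shows "card {\<Phi> \<in> faces B. e \<in> border B \<Phi>} \<le> 2"
proof -
  let ?B = "B - {e}" and ?A = "\<gamma> e ` {0<..<1}"
  have B': "?B \<subseteq> E" "e \<in> E" "e \<notin> ?B" "insert e ?B = B" using B e by auto
  obtain I J where IJ: "- skel B \<subseteq> I \<union> J"
      "\<And>x y. \<lbrakk>x \<in> I \<and> y \<in> I \<or> x \<in> J \<and> y \<in> J; connected_component (- skel ?B) x y;
          x \<notin> path_image (\<gamma> e); y \<notin> path_image (\<gamma> e)\<rbrakk>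
        \<Longrightarrow> connected_component (- skel B) x y"
    by (rule arc_two_sides[OF B'(1-3), unfolded B'(4)]) (rule that)
  note dis = open_arc_disjoint_skel[OF B'(1-3)]
  have "continuous_on {0..1} (\<gamma> e)" using arc_imp_path[OF arcs[OF B'(2)]] by (simp add: path_def)
  then have "continuous_on {0<..<1} (\<gamma> e)" by (rule continuous_on_subset) auto
  then have "connected ?A" by (rule connected_continuous_image) simp
  let ?w = "\<gamma> e (1/2)"
  have w: "?w \<in> ?A" by auto
  have sub: "\<Phi> \<subseteq> - skel B" if "\<Phi> \<in> faces B" for \<Phi>
    by (rule face_subset[OF that])
  have toW: "connected_component (- skel ?B) x ?w" if t: "\<Phi> \<in> faces B" "e \<in> border B \<Phi>" "x \<in> \<Phi>" for x \<Phi>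
  proof -
    obtain z where z: "z \<in> ?A" "z \<in> closure \<Phi>" using t(2) by (auto simp: border_def)
    have "connected \<Phi>" by (rule face_connected[OF t(1)])
    then have "connected (insert z \<Phi>)"
      by (rule connected_intermediate_closure) (use z closure_subset in auto)
    then have "connected (insert z \<Phi> \<union> ?A)" using \<open>connected ?A\<close> z by (intro connected_Un) auto
    moreover have "insert z \<Phi> \<union> ?A \<subseteq> - skel ?B"
      using z dis sub[OF t(1)] skel_mono[of ?B B] by blast
    ultimately show ?thesis unfolding connected_component_def using t(3) w by blast
  qed
  let ?S = "\<lambda>Z. {\<Phi> \<in> faces B. e \<in> border B \<Phi> \<and> \<Phi> \<inter> Z \<noteq> {}}"
  have 1: "card (?S Z) \<le> 1" if Z: "Z = I \<or> Z = J" for Z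
  proof -
    have "\<Phi> = \<Phi>'" if t: "\<Phi> \<in> ?S Z" "\<Phi>' \<in> ?S Z" for \<Phi> \<Phi>'
    proof -
      obtain x y where xy: "x \<in> \<Phi>" "x \<in> Z" "y \<in> \<Phi>'" "y \<in> Z" using t by auto
      have "connected_component (- skel ?B) x y"
        using toW[of \<Phi> x] toW[of \<Phi>' y] that xy connected_component_sym connected_component_trans by blast
      moreover have "x \<notin> path_image (\<gamma> e)" "y \<notin> path_image (\<gamma> e)"
        using sub[of \<Phi>] sub[of \<Phi>'] that xy e unfolding skel_def by blast+
      ultimately have cc: "connected_component (- skel B) x y" using IJ(2) xy Z by blast
      have "\<Phi> \<in> faces B" "\<Phi>' \<in> faces B" using that by auto
      then show ?thesis by (rule face_eqI) (fact xy cc)+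
    qed
    then show ?thesis by (rule subsingleton_card)
  qed
  have "{\<Phi> \<in> faces B. e \<in> border B \<Phi>} \<subseteq> ?S I \<union> ?S J"
  proof
    fix \<Phi> assume \<Phi>: "\<Phi> \<in> {\<Phi> \<in> faces B. e \<in> border B \<Phi>}"
    then obtain x where "x \<in> \<Phi>" using face_nonempty by blast
    moreover have "\<Phi> \<subseteq> I \<union> J" using sub[of \<Phi>] \<Phi> IJ(1) by blast
    ultimately have "\<Phi> \<inter> I \<noteq> {} \<or> \<Phi> \<inter> J \<noteq> {}" by blast
    with \<Phi> show "\<Phi> \<in> ?S I \<union> ?S J" by blast
  qed
  then have "card {\<Phi> \<in> faces B. e \<in> border B \<Phi>} \<le> card (?S I \<union> ?S J)"
    using finite_faces[OF B] by (intro card_mono) auto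
  also have "\<dots> \<le> 2" using card_Un_le[of "?S I" "?S J"] 1[of I] 1[of J] by simp
  finally show ?thesis .
qed

section \<open>Growth of the number of faces and Euler's inequality\<close>

lemma face_minus_arc_nonempty:
  assumes "B \<subseteq> E" "e \<in> E" "\<Phi> \<in> faces B"
  shows "\<exists>x\<in>\<Phi>. x \<notin> path_image (\<gamma> e)"
proof (rule ccontr)
  assume "\<not> ?thesis"
  then have "\<Phi> \<subseteq> interior (path_image (\<gamma> e))"
    using open_face[OF assms(1,3)] by (intro interior_maximal) auto
  then show False using interior_arc_image_empty[OF arcs[OF assms(2)]] face_nonempty[OF assms(3)] by simp
qed

definition parent_face :: "'e set \<Rightarrow> complex set \<Rightarrow> complex set" where
  "parent_face B \<Phi> = (SOME \<Psi>. \<Psi> \<in> faces B \<and> \<Phi> \<subseteq> \<Psi>)"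

lemma parent_face:
  assumes "\<Phi> \<in> faces (insert e B)"
  shows "parent_face B \<Phi> \<in> faces B" "\<Phi> \<subseteq> parent_face B \<Phi>"
proof -
  have "\<exists>\<Psi>. \<Psi> \<in> faces B \<and> \<Phi> \<subseteq> \<Psi>" using face_subset_face[OF _ assms, of B] by blast
  from someI_ex[OF this] show "parent_face B \<Phi> \<in> faces B" "\<Phi> \<subseteq> parent_face B \<Phi>"
    unfolding parent_face_def by auto
qed

lemma parent_face_eq:
  assumes "\<Phi> \<in> faces (insert e B)" "\<Psi> \<in> faces B" "x \<in> \<Phi>" "x \<in> \<Psi>"
  shows "parent_face B \<Phi> = \<Psi>"
proof (rule face_eqI[OF parent_face(1)[OF assms(1)] assms(2)])
  show "x \<in> parent_face B \<Phi>" using parent_face(2)[OF assms(1)] assms(3) by blast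
  show "connected_component (- skel B) x x" using face_subset[OF assms(2)] assms(4)
    by (auto intro: connected_component_refl)
qed fact

text \<open>An open face is not contained in an arc, so each old face keeps a point off the new arc
  and is the parent of some new face.\<close>

lemma faces_subset_image:
  assumes "B \<subseteq> E" "e \<in> E"
  shows "faces B \<subseteq> parent_face B ` faces (insert e B)"
proof
  fix \<Psi> assume \<Psi>: "\<Psi> \<in> faces B"
  obtain x where x: "x \<in> \<Psi>" "x \<notin> path_image (\<gamma> e)" using face_minus_arc_nonempty[OF assms \<Psi>] by blast
  then have "x \<notin> skel (insert e B)" using face_subset[OF \<Psi>] by (auto simp: skel_insert)
  then obtain \<Phi> where \<Phi>: "\<Phi> \<in> faces (insert e B)" "x \<in> \<Phi>" using face_at by blast
  then have "parent_face B \<Phi> = \<Psi>" using parent_face_eq \<Psi> x by blast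
  with \<Phi> show "\<Psi> \<in> parent_face B ` faces (insert e B)" by blast
qed

lemma card_faces_mono:
  assumes "B \<subseteq> E" "e \<in> E"
  shows "card (faces B) \<le> card (faces (insert e B))"
  using surj_card_le[OF finite_faces faces_subset_image[OF assms]] assms by simp

text \<open>The old face around the midpoint of \<open>e\<close> is open, and the arc lies in the
  closure of both sides, so this face has points on both sides. They lie in different new faces with
  the same parent, and \<open>parent_face B\<close> is not injective.\<close>

lemma card_faces_strict_mono:
  assumes B: "B \<subseteq> E" and e: "e \<in> E" "e \<notin> B"
    and pc: "path_component (skel B) (pathstart (\<gamma> e)) (pathfinish (\<gamma> e))"
  shows "card (faces B) < card (faces (insert e B))"
proof -
  note dis = open_arc_disjoint_skel[OF B e]
  obtain I J where IJ: "open I" "open J" "(I \<union> J) \<inter> path_image (\<gamma> e) = {}"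
     "path_image (\<gamma> e) \<subseteq> closure I" "path_image (\<gamma> e) \<subseteq> closure J"
     "\<And>x y. \<lbrakk>x \<in> I; y \<in> J\<rbrakk> \<Longrightarrow> \<not> connected_component (- (skel B \<union> path_image (\<gamma> e))) x y"
    using arc_between_connected_points_splits[OF compact_skel[OF B] arcs[OF e(1)] dis pc] by metis
  let ?w = "\<gamma> e (1/2)"
  have "?w \<in> \<gamma> e ` {0<..<1}" by simp
  then have w: "?w \<in> path_image (\<gamma> e)" "?w \<notin> skel B"
    using dis path_image_eq_open_arc_Un_ends[of "\<gamma> e"] by blast+
  obtain \<Psi> where \<Psi>: "\<Psi> \<in> faces B" "?w \<in> \<Psi>" using face_at w by blast
  note op = open_face[OF B \<Psi>(1)]
  obtain x where x: "x \<in> I" "x \<in> \<Psi>"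
    using op \<Psi>(2) IJ(4) w(1) open_Int_closure_eq_empty[of \<Psi> I] by blast
  obtain y where y: "y \<in> J" "y \<in> \<Psi>"
    using op \<Psi>(2) IJ(5) w(1) open_Int_closure_eq_empty[of \<Psi> J] by blast
  have xy: "x \<notin> skel (insert e B)" "y \<notin> skel (insert e B)"
    using x y face_subset[OF \<Psi>(1)] IJ(3) by (auto simp: skel_insert)
  obtain \<Phi> where \<Phi>: "\<Phi> \<in> faces (insert e B)" "x \<in> \<Phi>" using face_at xy by blast
  obtain \<Phi>' where \<Phi>': "\<Phi>' \<in> faces (insert e B)" "y \<in> \<Phi>'" using face_at xy by blast
  have "\<Phi> \<noteq> \<Phi>'"
    using IJ(6)[OF x(1) y(1)] face_connected_component[OF \<Phi>(1,2), of y] \<Phi>' by (auto simp: skel_insert)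
  moreover have "parent_face B \<Phi> = parent_face B \<Phi>'" using parent_face_eq \<Psi>(1) \<Phi> \<Phi>' x y by blast
  ultimately have "\<not> inj_on (parent_face B) (faces (insert e B))"
    using \<Phi>(1) \<Phi>'(1) by (auto simp: inj_on_def)
  moreover have fin: "finite (faces (insert e B))" using finite_faces B e by simp
  ultimately have "card (parent_face B ` faces (insert e B)) < card (faces (insert e B))"
    by (intro card_image_less)
  moreover have "card (faces B) \<le> card (parent_face B ` faces (insert e B))"
    using fin by (intro card_mono faces_subset_image B e) auto
  ultimately show ?thesis by linarith
qed

lemma faces_nonempty: "B \<subseteq> E \<Longrightarrow> faces B \<noteq> {}"
  using not_bounded_UNIV[where 'a=complex] compact_imp_bounded[OF compact_skel[of B]]
  unfolding faces_def components_eq_empty by (metis Compl_empty_eq double_compl)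

text \<open>The image counts the connected components of the graph.\<close>

lemma card_faces_ge_components:
  assumes "B \<subseteq> E"
  shows "card B + 1 + card (path_component_set (skel B) ` W) \<le> card (faces B) + card W"
proof -
  have "finite B" using assms finE finite_subset by blast
  then show ?thesis using assms
  proof (induction B rule: finite_induct)
    case empty
    have "card (faces {}) \<noteq> 0" using faces_nonempty[of "{}"] finite_faces[of "{}"] by simp
    moreover have "card (path_component_set (skel {}) ` W) \<le> card W" using finW card_image_le by blast
    ultimately show ?case by simp
  next
    case (insert e B)
    then have B: "B \<subseteq> E" "e \<in> E" "e \<notin> B" by auto
    let ?c = "path_component_set (skel B)" and ?c' = "path_component_set (skel (insert e B))"
    let ?u = "pathstart (\<gamma> e)" and ?v = "pathfinish (\<gamma> e)"
    \<comment> \<open>\<open>?h\<close> sends an old component, through a chosen vertex of it, to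
      the new component around it. The choice is harmless, since an old component lies in a single
      new one.\<close>
    let ?h = "\<lambda>S. ?c' (SOME w. w \<in> W \<and> S = ?c w)"
    have W: "w \<in> skel B" if "w \<in> W" for w using that by (auto simp: skel_def)
    have h: "?h (?c w) = ?c' w" if "w \<in> W" for w
    proof -
      define z where "z = (SOME z. z \<in> W \<and> ?c w = ?c z)"
      have "z \<in> W \<and> ?c w = ?c z" unfolding z_def by (rule someI[of _ w]) (use that in simp)
      then have "z \<in> W" "path_component (skel B) w z"
        using W path_component_refl[of z "skel B"] by auto
      then have "path_component (skel (insert e B)) w z"
        using path_component_of_subset[OF skel_mono[of B "insert e B"]] by blast
      then have "?c' w = ?c' z" using path_component_eq[of z "skel (insert e B)" w] by simp
      then show ?thesis unfolding z_def[symmetric] by simp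
    qed
    then have im: "?c' ` W = ?h ` (?c ` W)" unfolding image_image by (intro image_cong) auto
    have IH: "card B + 1 + card (?c ` W) \<le> card (faces B) + card W" using insert B by blast
    have uv: "?u \<in> W" "?v \<in> W" using ends B by auto
    \<comment> \<open>An edge whose ends are already connected adds a face; any other edge merges
      two components. Either change pays for the new edge.\<close>
    show ?case
    proof (cases "path_component (skel B) ?u ?v")
      case True
      have "card (?c' ` W) \<le> card (?c ` W)" unfolding im using finW by (intro card_image_le) auto
      then show ?thesis using card_faces_strict_mono[OF B True] IH insert by simp
    next
      case False
      have "path_component (skel (insert e B)) ?u ?v"
        unfolding path_component_def using arc_imp_path[OF arcs[OF B(2)]]
        by (intro exI[of _ "\<gamma> e"]) (auto simp: skel_insert)
      then have "?c' ?u = ?c' ?v" using path_component_eq[of ?v "skel (insert e B)" ?u] by simp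
      then have "?h (?c ?u) = ?h (?c ?v)" using h uv by simp
      moreover have "?c ?u \<noteq> ?c ?v" using False W[OF uv(2)] path_component_refl by blast
      ultimately have "\<not> inj_on ?h (?c ` W)" using uv unfolding inj_on_def by blast
      then have "card (?h ` (?c ` W)) < card (?c ` W)"
        using finW by (intro card_image_less) auto
      then show ?thesis using card_faces_mono[OF B(1,2)] IH insert unfolding im by simp
    qed
  qed
qed

corollary Euler_inequality:
  assumes "B \<subseteq> E" "W \<noteq> {}"
  shows "card B + 2 \<le> card (faces B) + card W"
proof -
  have "card (path_component_set (skel B) ` W) \<noteq> 0" using finW assms(2) by simp
  then show ?thesis using card_faces_ge_components[OF assms(1)] by linarith
qed

section \<open>The border of a face as a separating subgraph\<close>

text \<open>A connected set larger than \<open>\<Phi>\<close> meets the frontier of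
  \<open>\<Phi>\<close>, which lies in \<open>skel B\<close>. If that set avoids
  \<open>skel B'\<close>, the meeting point is interior to a deleted edge, and this edge would
  belong to the border.\<close>

lemma face_of_own_border:
  assumes "B \<subseteq> E" "\<Phi> \<in> faces B" "border B \<Phi> \<subseteq> B'" "B' \<subseteq> B"
  shows "\<Phi> \<in> faces B'"
  unfolding faces_def in_components_maximal
proof (intro conjI allI impI)
  show "\<Phi> \<noteq> {}" "connected \<Phi>" using assms face_nonempty face_connected by auto
  show "\<Phi> \<subseteq> - skel B'" using face_subset[OF assms(2)] skel_mono[OF assms(4)] by blast
  fix D assume D: "D \<noteq> {} \<and> \<Phi> \<subseteq> D \<and> D \<subseteq> - skel B' \<and> connected D"
  show "D = \<Phi>"
  proof (rule ccontr)
    assume "D \<noteq> \<Phi>"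
    then have "D \<inter> frontier \<Phi> \<noteq> {}" using D face_nonempty[OF assms(2)]
      by (intro connected_Int_frontier) auto
    then obtain z where z: "z \<in> D" "z \<in> frontier \<Phi>" by blast
    have "frontier \<Phi> \<subseteq> skel B"
      using frontier_of_components_closed_complement[of "skel B" \<Phi>] assms(1,2) compact_skel
        compact_imp_closed unfolding faces_def by blast
    moreover have "z \<notin> skel B'" using z D by blast
    ultimately obtain e where e: "e \<in> B" "e \<notin> B'" "z \<in> path_image (\<gamma> e)" "z \<notin> W"
      using z unfolding skel_def by blast
    then have "z \<in> \<gamma> e ` {0<..<1}"
      using path_image_eq_open_arc_Un_ends[of "\<gamma> e"] ends[of e] assms(1) by auto
    then have "e \<in> border B \<Phi>" using e z unfolding border_def frontier_def by blast
    then show False using e assms(3) by blast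
  qed
qed

text \<open>The point \<open>v\<close> is isolated in \<open>skel B\<close>, so the skeleton is a
  compact set together with \<open>{v}\<close>, and \<open>e\<close> meets each of these two
  disjoint pieces in one point.\<close>

lemma connected_Compl_skel_insert_pendant:
  assumes B: "B \<subseteq> E" and e: "e \<in> E" "e \<notin> B" and con: "connected (- skel B)"
    and v: "v = pathstart (\<gamma> e) \<or> v = pathfinish (\<gamma> e)" "\<And>d. d \<in> B \<Longrightarrow> v \<notin> path_image (\<gamma> d)"
  shows "connected (- skel (insert e B))"
proof -
  let ?g = "\<gamma> e"
  define u where "u = (if v = pathstart ?g then pathfinish ?g else pathstart ?g)"
  have ne: "pathstart ?g \<noteq> pathfinish ?g" using arc_distinct_ends[OF arcs[OF e(1)]] by metis
  have gi: "path_image ?g = ?g ` {0<..<1} \<union> {u, v}"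
    using path_image_eq_open_arc_Un_ends[of ?g] v(1) unfolding u_def by auto
  have uv: "u \<in> W" "v \<in> W" "u \<noteq> v" using ends[OF e(1)] v(1) ne unfolding u_def by auto
  have K: "skel B - {v} = (W - {v}) \<union> (\<Union>d\<in>B. path_image (\<gamma> d))" using v(2) unfolding skel_def by auto
  have cK: "compact (skel B - {v})"
    unfolding K using finW finE arcs B
    by (intro compact_Un compact_UN) (auto intro: compact_arc_image finite_subset finite_imp_compact)
  note dis = open_arc_disjoint_skel[OF B e]
  have "u \<in> skel B" "v \<in> skel B" using uv by (auto simp: skel_def)
  then have 1: "(skel B - {v}) \<inter> path_image ?g = {u}" "{v} \<inter> path_image ?g = {v}" "skel B - {v} \<union> {v} = skel B"
    using gi dis uv(3) by auto
  show ?thesis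
    unfolding connected_iff_connected_component skel_insert
  proof (intro ballI)
    fix x y assume "x \<in> - (skel B \<union> path_image ?g)" "y \<in> - (skel B \<union> path_image ?g)"
    then have "x \<notin> path_image ?g" "y \<notin> path_image ?g" "x \<in> - skel B" "y \<in> - skel B" by auto
    moreover from this have "connected_component (- skel B) x y"
      using con unfolding connected_iff_connected_component by blast
    ultimately show "connected_component (- (skel B \<union> path_image ?g)) x y"
      using arc_join_two_closed_not_separating[OF cK _ arcs[OF e(1)] 1(1,2), of x y] unfolding 1(3) by simp
  qed
qed

lemma connected_Compl_skel_empty: "connected (- skel {})"
  using finW path_connected_complement_countable[of W]
  by (simp add: skel_def path_connected_imp_connected countable_finite)

text \<open>A face is still a face after deletion of all edges outside its border. If the border did
  not separate the plane, that face would be the whole complement and would meet every other face of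
  \<open>B\<close>.\<close>

lemma border_separates:
  assumes B: "B \<subseteq> E" and \<Phi>: "\<Phi> \<in> faces B" and "card (faces B) \<ge> 2"
  shows "\<not> connected (- skel (border B \<Phi>))"
proof
  let ?B = "border B \<Phi>"
  assume con: "connected (- skel ?B)"
  have sub: "?B \<subseteq> B" by (auto simp: border_def)
  have "\<Phi> \<in> components (- skel ?B)" using face_of_own_border[OF B \<Phi> _ sub] by (simp add: faces_def)
  then have eq: "\<Phi> = - skel ?B" using con connected_eq_components_subset_sing[of "- skel ?B"] by auto
  have "\<Psi> = \<Phi>" if \<Psi>: "\<Psi> \<in> faces B" for \<Psi>
  proof -
    obtain x where x: "x \<in> \<Psi>" using face_nonempty[OF \<Psi>] by blast
    then have "x \<notin> skel B" using face_subset[OF \<Psi>] by blast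
    then have "x \<in> \<Phi>" using eq skel_mono[OF sub] by blast
    then show ?thesis using face_eq_component[OF \<Psi> x] face_eq_component[OF \<Phi>] by simp
  qed
  then have "card (faces B) \<le> 1" by (intro subsingleton_card) metis
  then show False using assms(3) by simp
qed

lemma sum_card_border_le:
  assumes B: "B \<subseteq> E"
  shows "(\<Sum>\<Phi>\<in>faces B. card (border B \<Phi>)) \<le> 2 * card B"
proof -
  have fB: "finite B" using finite_subset[OF B finE] .
  have "(\<Sum>\<Phi>\<in>faces B. card (border B \<Phi>)) = (\<Sum>\<Phi>\<in>faces B. \<Sum>e\<in>B. if e \<in> border B \<Phi> then 1 else 0)"
  proof (rule sum.cong[OF refl])
    fix \<Phi>
    have "border B \<Phi> = {e \<in> B. e \<in> border B \<Phi>}" by (auto simp: border_def)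
    then show "card (border B \<Phi>) = (\<Sum>e\<in>B. if e \<in> border B \<Phi> then 1 else 0)"
      using fB by (simp add: sum.If_cases Int_def)
  qed
  also have "\<dots> = (\<Sum>e\<in>B. \<Sum>\<Phi>\<in>faces B. if e \<in> border B \<Phi> then 1 else 0)" by (rule sum.swap)
  also have "\<dots> = (\<Sum>e\<in>B. card {\<Phi> \<in> faces B. e \<in> border B \<Phi>})"
    using finite_faces[OF B] by (simp add: sum.If_cases Int_def)
  also have "\<dots> \<le> (\<Sum>e\<in>B. 2)" by (intro sum_mono card_faces_bordering_edge[OF B])
  finally show ?thesis by simp
qed

text \<open>Each edge of a closed family already borders two faces of the family, so no other face of the
  subgraph is left over in which a further edge could be drawn.\<close>

lemma closed_face_family_exhausts:
  assumes B: "B \<subseteq> E" and F: "F \<subseteq> faces B" "F \<noteq> {}"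
    and two: "\<And>\<Phi> e. \<lbrakk>\<Phi> \<in> F; e \<in> border B \<Phi>\<rbrakk> \<Longrightarrow> \<exists>\<Psi>\<in>F. \<Psi> \<noteq> \<Phi> \<and> e \<in> border B \<Psi>"
  shows "B = (\<Union>\<Phi>\<in>F. border B \<Phi>)"
proof (rule ccontr)
  define B' where "B' = (\<Union>\<Phi>\<in>F. border B \<Phi>)"
  have B'B: "B' \<subseteq> B" unfolding B'_def border_def by blast
  assume "B \<noteq> (\<Union>\<Phi>\<in>F. border B \<Phi>)"
  then obtain g where g: "g \<in> B" "g \<notin> B'" using B'B unfolding B'_def by blast
  have FB': "F \<subseteq> faces B'"
  proof
    fix \<Phi> assume "\<Phi> \<in> F"
    then show "\<Phi> \<in> faces B'" using face_of_own_border[OF B _ _ B'B, of \<Phi>] F unfolding B'_def by blast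
  qed
  \<comment> \<open>The midpoint of an edge that the family misses is off \<open>skel B'\<close> but
    on \<open>skel B\<close>, so the face of \<open>B'\<close> around it cannot belong to
    \<open>F\<close>. It shares a border edge with two members of \<open>F\<close>, one face too
    many.\<close>
  let ?w = "\<gamma> g (1/2)"
  have "?w \<in> \<gamma> g ` {0<..<1}" by simp
  then have "?w \<notin> skel B'" using open_arc_disjoint_skel[of B' g] g B B'B by blast
  then obtain \<Psi> where \<Psi>: "\<Psi> \<in> faces B'" "?w \<in> \<Psi>" using face_at by blast
  have "?w \<in> skel B"
    using g \<open>?w \<in> \<gamma> g ` {0<..<1}\<close> path_image_eq_open_arc_Un_ends[of "\<gamma> g"]
    unfolding skel_def by blast
  then have "\<Psi> \<notin> F" using F face_subset \<Psi>(2) by blast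
  obtain \<Phi>0 where "\<Phi>0 \<in> F" using F by blast
  have fin: "finite (faces B')" using finite_faces B B'B by blast
  have "card {\<Psi>, \<Phi>0} \<le> card (faces B')"
    using \<Psi> \<open>\<Phi>0 \<in> F\<close> FB' fin by (intro card_mono) auto
  moreover have "\<Psi> \<noteq> \<Phi>0" using \<open>\<Psi> \<notin> F\<close> \<open>\<Phi>0 \<in> F\<close> by blast
  ultimately have "card (faces B') \<ge> 2" by simp
  then have "border B' \<Psi> \<noteq> {}"
    using border_separates[of B' \<Psi>] \<Psi>(1) order_trans[OF B'B B] connected_Compl_skel_empty by auto
  then obtain e where e: "e \<in> border B' \<Psi>" by blast
  then have "e \<in> B'" by (simp add: border_def)
  then obtain \<Phi> where \<Phi>: "\<Phi> \<in> F" "e \<in> border B \<Phi>" unfolding B'_def by blast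
  obtain \<Phi>' where \<Phi>': "\<Phi>' \<in> F" "\<Phi>' \<noteq> \<Phi>" "e \<in> border B \<Phi>'" using two[OF \<Phi>] by blast
  have "{\<Psi>, \<Phi>, \<Phi>'} \<subseteq> {\<Phi> \<in> faces B'. e \<in> border B' \<Phi>}"
    using e \<Phi> \<Phi>' \<Psi> FB' \<open>e \<in> B'\<close> by (auto simp: border_def)
  then have "card {\<Psi>, \<Phi>, \<Phi>'} \<le> card {\<Phi> \<in> faces B'. e \<in> border B' \<Phi>}"
    using fin by (intro card_mono) auto
  also have "\<dots> \<le> 2" using card_faces_bordering_edge[of B' e] B B'B \<open>e \<in> B'\<close> by blast
  finally show False using \<Phi> \<Phi>' \<open>\<Psi> \<notin> F\<close> by (auto simp: card_insert_if split: if_splits)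
qed

end

section \<open>Facial triangles of a planar graph\<close>

definition pairs :: "'a set \<Rightarrow> 'a set set" where
  "pairs T = {e. e \<subseteq> T \<and> card e = 2}"

text \<open>The combinatorial trace of a closed surface: no edge of a member is a boundary edge. For
  facial triangles this supplies the hypothesis of
  \<open>closed_face_family_exhausts\<close>.\<close>

definition closed_triples :: "'a set set \<Rightarrow> bool" where
  "closed_triples F \<longleftrightarrow> (\<forall>T\<in>F. \<forall>e\<in>pairs T. \<exists>T'\<in>F. T' \<noteq> T \<and> e \<subseteq> T')"

lemma finite_pairs: "finite T \<Longrightarrow> finite (pairs T)"
  unfolding pairs_def by simp

lemma card_pairs: "finite T \<Longrightarrow> card (pairs T) = card T choose 2"
  unfolding pairs_def by (rule n_subsets)

lemma Union_pairs:
  assumes "card T = 3"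
  shows "\<Union>(pairs T) = T"
proof -
  obtain x y z where "T = {x, y, z}" "x \<noteq> y" "y \<noteq> z" "x \<noteq> z" using assms by (auto simp: card_3_iff)
  moreover from this have "{x,y} \<in> pairs T" "{x,z} \<in> pairs T" by (auto simp: pairs_def)
  moreover have "\<Union>(pairs T) \<subseteq> T" by (auto simp: pairs_def)
  ultimately show ?thesis by blast
qed

lemma pairs_3:
  "\<lbrakk>x \<noteq> y; y \<noteq> z; x \<noteq> z\<rbrakk> \<Longrightarrow> pairs {x, y, z} = {{x, y}, {x, z}, {y, z}}"
  unfolding pairs_def by (auto simp: card_2_iff)

lemma card_pairs_3: "card T = 3 \<Longrightarrow> card (pairs T) = 3"
  using card_pairs[of T] by (cases "finite T") (auto simp: numeral_3_eq_3 numeral_2_eq_2)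

text \<open>If each end of each edge has a second edge, then an edge \<open>e\<close> and the
  further edges at its two ends are already three, and the outer ends of the latter must
  coincide.\<close>

lemma few_edges_pendant:
  fixes B :: "'a set set"
  assumes fin: "finite B" "B \<noteq> {}" "card B \<le> 3" and two: "\<And>e. e \<in> B \<Longrightarrow> card e = 2"
    and ntri: "\<nexists>T. card T = 3 \<and> B = pairs T"
  shows "\<exists>e\<in>B. \<exists>v\<in>e. \<forall>d\<in>B - {e}. v \<notin> d"
proof (rule ccontr)
  assume "\<not> ?thesis"
  then have *: "\<exists>d\<in>B. d \<noteq> e \<and> v \<in> d" if "e \<in> B" "v \<in> e" for e v using that by blast
  obtain e where e: "e \<in> B" using fin by blast
  obtain u v where uv: "e = {u, v}" "u \<noteq> v" using two[OF e] by (auto simp: card_2_iff)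
  obtain d1 where d1: "d1 \<in> B" "d1 \<noteq> e" "u \<in> d1" using *[OF e, of u] uv by auto
  obtain d2 where d2: "d2 \<in> B" "d2 \<noteq> e" "v \<in> d2" using *[OF e, of v] uv by auto
  obtain w where w: "d1 = {u, w}" "w \<noteq> u" using two[OF d1(1)] d1(3) by (auto simp: card_2_iff)
  have "w \<noteq> v" using w d1(2) uv by auto
  then have ne: "d1 \<noteq> d2" using d2(3) w uv by auto
  have "B = {e, d1, d2}"
    using card_seteq[of B "{e, d1, d2}"] fin e d1 d2 ne by auto
  moreover obtain d where "d \<in> B" "d \<noteq> d1" "w \<in> d" using *[OF d1(1), of w] w by auto
  ultimately have "w \<in> d2" using uv w \<open>w \<noteq> v\<close> by auto
  then have "d2 = {v, w}" using two[OF d2(1)] d2(3) \<open>w \<noteq> v\<close> by (auto simp: card_2_iff)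
  then have "B = pairs {u, v, w}" using \<open>B = {e, d1, d2}\<close> uv w \<open>w \<noteq> v\<close> by (subst pairs_3) auto
  moreover have "card {u, v, w} = 3" using uv w \<open>w \<noteq> v\<close> by simp
  ultimately show False using ntri by blast
qed

lemma plane_drawing_arc_system:
  assumes "plane_drawing G p \<gamma>" "simple_graph G" "finite (verts G)"
  shows "arc_system (p ` verts G) (edges G) \<gamma>"
proof
  have "edges G \<subseteq> Pow (verts G)" using assms(2) by (auto simp: simple_graph_def)
  then show "finite (edges G)" using assms(3) finite_subset by blast
  fix e assume e: "e \<in> edges G"
  then have "{pathstart (\<gamma> e), pathfinish (\<gamma> e)} = p ` e" "e \<subseteq> verts G"
    using assms by (auto simp: plane_drawing_def simple_graph_def)
  then show "pathstart (\<gamma> e) \<in> p ` verts G \<and> pathfinish (\<gamma> e) \<in> p ` verts G" by blast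
qed (use assms in \<open>auto simp: plane_drawing_def\<close>)

lemma finite_edges: "\<lbrakk>simple_graph G; finite (verts G)\<rbrakk> \<Longrightarrow> finite (edges G)"
  by (rule finite_subset[of _ "Pow (verts G)"]) (auto simp: simple_graph_def)

text \<open>The passage from topology to set systems; the upper bounds below use planarity only
  through this statement and the passage to induced subgraphs. As many edges as vertices force a
  second face, so that every border separates. A fourth edge excludes the lone triangle, whose two
  faces have the same vertex set.\<close>

theorem planar_facial_triangles:
  fixes G :: "'a graph"
  assumes simple: "simple_graph G" and fin: "finite (verts G)" and planar: "planar G"
    and many: "card (verts G) \<le> card (edges G)" "4 \<le> card (edges G)"
  obtains F where
    "\<And>T. T \<in> F \<Longrightarrow> card T = 3 \<and> pairs T \<subseteq> edges G"
    "\<And>e. e \<in> edges G \<Longrightarrow> card {T \<in> F. e \<subseteq> T} \<le> 2"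
    "2 * card (edges G) + 8 \<le> 4 * card (verts G) + card F"
    "\<And>F'. \<lbrakk>F' \<subseteq> F; F' \<noteq> {}; closed_triples F'\<rbrakk> \<Longrightarrow> edges G = \<Union>(pairs ` F')"
proof -
  let ?V = "verts G" and ?E = "edges G"
  obtain p \<gamma> where dr: "plane_drawing G p \<gamma>" using planar by (auto simp: planar_def)
  interpret arc_system "p ` ?V" ?E \<gamma> by (rule plane_drawing_arc_system[OF dr simple fin])
  have two: "card e = 2" "e \<subseteq> ?V" if "e \<in> ?E" for e using simple that by (auto simp: simple_graph_def)
  have inj: "inj_on p ?V" using dr by (simp add: plane_drawing_def)
  have arc_ends: "{pathstart (\<gamma> e), pathfinish (\<gamma> e)} = p ` e" if "e \<in> ?E" for e
    using dr that by (simp add: plane_drawing_def)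
  have off: "p v \<notin> path_image (\<gamma> d)" if "d \<in> ?E" "v \<in> ?V" "v \<notin> d" for d v
  proof -
    have "p v \<notin> p ` d" using inj that two(2)[OF that(1)] by (auto simp: inj_on_def)
    moreover have "p v \<notin> \<gamma> d ` {0<..<1}" using avoid_points[OF that(1)] that(2) by blast
    moreover have "path_image (\<gamma> d) = \<gamma> d ` {0<..<1} \<union> p ` d"
      using path_image_eq_open_arc_Un_ends[of "\<gamma> d"] arc_ends[OF that(1)] by simp
    ultimately show ?thesis by blast
  qed
  \<comment> \<open>At most three edges that do not form a triangle always have a pendant edge to
    peel off, so they do not separate the plane.\<close>
  have forest: "connected (- skel B)"
    if "B \<subseteq> ?E" "card B \<le> 3" "\<nexists>T. card T = 3 \<and> B = pairs T" for B
    using that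
  proof (induction "card B" arbitrary: B)
    case 0
    then have "B = {}" using finite_subset[OF 0(2) finE] by simp
    then show ?case using connected_Compl_skel_empty by simp
  next
    case (Suc k)
    have fB: "finite B" using finite_subset[OF Suc(3) finE] .
    have "B \<noteq> {}" using Suc(2) by auto
    then obtain e v where e: "e \<in> B" "v \<in> e" "\<forall>d\<in>B - {e}. v \<notin> d"
      using few_edges_pendant[OF fB _ Suc(4) _ Suc(5)] two Suc(3) by blast
    have k: "k = card (B - {e})" using Suc(2) e fB by simp
    have "\<nexists>T. card T = 3 \<and> B - {e} = pairs T"
    proof
      assume "\<exists>T. card T = 3 \<and> B - {e} = pairs T"
      then obtain T :: "'a set" where "card T = 3" "B - {e} = pairs T" by blast
      then have "card (B - {e}) = 3" by (simp add: card_pairs_3)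
      then show False using k Suc(2,4) by simp
    qed
    then have con: "connected (- skel (B - {e}))"
      using Suc(1)[OF k] Suc(2-4) k by auto
    have "connected (- skel (insert e (B - {e})))"
    proof (rule connected_Compl_skel_insert_pendant[OF _ _ _ con])
      show "p v = pathstart (\<gamma> e) \<or> p v = pathfinish (\<gamma> e)"
        using arc_ends[of e] e Suc(3) by blast
      show "p v \<notin> path_image (\<gamma> d)" if "d \<in> B - {e}" for d
        using off[of d v] that e Suc(3) two(2)[of e] by blast
    qed (use Suc(3) e in auto)
    then show ?case using e by (simp add: insert_absorb)
  qed
  have "?E \<noteq> {}" using many(2) by auto
  then have "?V \<noteq> {}" using two by fastforce
  then have euler: "card ?E + 2 \<le> card (faces ?E) + card ?V"
    using Euler_inequality[of ?E] card_image[OF inj] by simp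
  then have faces2: "card (faces ?E) \<ge> 2" using many(1) by linarith
  define tri where "tri = {\<Phi> \<in> faces ?E. \<exists>T. card T = 3 \<and> border ?E \<Phi> = pairs T}"
  let ?t = "\<lambda>\<Phi>. \<Union>(border ?E \<Phi>)"
  have big: "card (border ?E \<Phi>) \<ge> 4" if "\<Phi> \<in> faces ?E" "\<Phi> \<notin> tri" for \<Phi>
  proof (rule ccontr)
    assume "\<not> ?thesis"
    moreover have "border ?E \<Phi> \<subseteq> ?E" by (auto simp: border_def)
    ultimately have "connected (- skel (border ?E \<Phi>))" using that by (intro forest) (auto simp: tri_def)
    then show False using border_separates[OF _ that(1) faces2] by blast
  qed
  have three: "card (border ?E \<Phi>) = 3" if "\<Phi> \<in> tri" for \<Phi>
    using that card_pairs_3 unfolding tri_def by auto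
  define F where "F = {T. card T = 3 \<and> (\<exists>\<Phi>\<in>faces ?E. border ?E \<Phi> = pairs T)}"
  have Ft: "T = ?t \<Phi>" if "card T = 3" "border ?E \<Phi> = pairs T" for T \<Phi>
    using Union_pairs[OF that(1)] that(2) by simp
  have finf: "finite (faces ?E)" by (rule finite_faces) simp
  have FE: "F \<subseteq> ?t ` faces ?E" using Ft unfolding F_def by blast
  \<comment> \<open>Every face has at least four border edges, or three and the extra unit of a
    triangular face. Combined with four times Euler's inequality this becomes
    \<open>main\<close>.\<close>
  have "4 * card (faces ?E) = (\<Sum>\<Phi>\<in>faces ?E. 4)" by simp
  also have "\<dots> \<le> (\<Sum>\<Phi>\<in>faces ?E. card (border ?E \<Phi>) + (if \<Phi> \<in> tri then 1 else 0))"
    by (intro sum_mono) (use big three in auto)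
  also have "\<dots> = (\<Sum>\<Phi>\<in>faces ?E. card (border ?E \<Phi>)) + card tri"
    using finf by (simp add: sum.distrib sum.If_cases tri_def Int_def conj_commute)
  also have "\<dots> \<le> 2 * card ?E + card tri" using sum_card_border_le[of ?E] by simp
  finally have count: "4 * card (faces ?E) \<le> 2 * card ?E + card tri" .
  \<comment> \<open>Two faces bordered by the same triangle form a closed family and exhaust the
    edges, which four edges exclude. Triangular faces can therefore be counted by their vertex
    sets.\<close>
  have injt: "inj_on ?t tri"
  proof (rule inj_onI, rule ccontr)
    fix \<Phi> \<Psi> assume a: "\<Phi> \<in> tri" "\<Psi> \<in> tri" "?t \<Phi> = ?t \<Psi>" "\<Phi> \<noteq> \<Psi>"
    then have eq: "border ?E \<Phi> = border ?E \<Psi>" using Ft unfolding tri_def by force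
    have "?E = (\<Union>\<Phi>\<in>{\<Phi>, \<Psi>}. border ?E \<Phi>)"
    proof (rule closed_face_family_exhausts)
      show "{\<Phi>, \<Psi>} \<subseteq> faces ?E" using a by (auto simp: tri_def)
      show "\<exists>\<Psi>'\<in>{\<Phi>, \<Psi>}. \<Psi>' \<noteq> \<Phi>' \<and> e \<in> border ?E \<Psi>'"
        if "\<Phi>' \<in> {\<Phi>, \<Psi>}" "e \<in> border ?E \<Phi>'" for \<Phi>' e
        using that a(4) eq by auto
    qed auto
    then have "?E = border ?E \<Phi>" using eq by simp
    then show False using three[OF a(1)] many(2) by simp
  qed
  have "?t ` tri \<subseteq> F"
  proof (rule image_subsetI)
    fix \<Phi> assume "\<Phi> \<in> tri"
    then obtain T where T: "\<Phi> \<in> faces ?E" "card T = 3" "border ?E \<Phi> = pairs T" unfolding tri_def by blast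
    then have "T \<in> F" unfolding F_def by blast
    then show "?t \<Phi> \<in> F" using Ft[OF T(2,3)] by simp
  qed
  then have "card tri \<le> card F"
    using card_inj_on_le[OF injt] finite_subset[OF FE] finf by blast
  then have main: "2 * card ?E + 8 \<le> 4 * card ?V + card F" using count euler by linarith
  show ?thesis
  proof (rule that[OF _ _ main])
    show "card T = 3 \<and> pairs T \<subseteq> ?E" if "T \<in> F" for T
      using that unfolding F_def by (auto simp: border_def)
    show "card {T \<in> F. e \<subseteq> T} \<le> 2" if e: "e \<in> ?E" for e
    proof -
      have "{T \<in> F. e \<subseteq> T} \<subseteq> ?t ` {\<Phi> \<in> faces ?E. e \<in> border ?E \<Phi>}"
      proof
        fix T assume "T \<in> {T \<in> F. e \<subseteq> T}"
        then obtain \<Phi> where \<Phi>: "\<Phi> \<in> faces ?E" "card T = 3" "border ?E \<Phi> = pairs T" "e \<subseteq> T"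
          unfolding F_def by blast
        moreover have "e \<in> pairs T" using \<Phi>(4) two(1)[OF e] by (simp add: pairs_def)
        ultimately show "T \<in> ?t ` {\<Phi> \<in> faces ?E. e \<in> border ?E \<Phi>}" using Ft[OF \<Phi>(2,3)] by blast
      qed
      then have "card {T \<in> F. e \<subseteq> T} \<le> card {\<Phi> \<in> faces ?E. e \<in> border ?E \<Phi>}"
        using finf by (intro surj_card_le) auto
      then show ?thesis using card_faces_bordering_edge[of ?E e] e by simp
    qed
    fix F' assume F': "F' \<subseteq> F" "F' \<noteq> {}" "closed_triples F'"
    let ?FF = "{\<Phi> \<in> faces ?E. \<exists>T\<in>F'. border ?E \<Phi> = pairs T}"
    have ex: "\<exists>\<Phi>\<in>faces ?E. border ?E \<Phi> = pairs T" if "T \<in> F'" for T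
      using that F'(1) unfolding F_def by blast
    have "?E = (\<Union>\<Phi>\<in>?FF. border ?E \<Phi>)"
    proof (rule closed_face_family_exhausts)
      obtain T where "T \<in> F'" using F'(2) by blast
      then show "?FF \<noteq> {}" using ex by blast
      fix \<Phi> e assume a: "\<Phi> \<in> ?FF" "e \<in> border ?E \<Phi>"
      then obtain T where T: "T \<in> F'" "border ?E \<Phi> = pairs T" by blast
      obtain T' where T': "T' \<in> F'" "T' \<noteq> T" "e \<subseteq> T'" using F'(3) a T unfolding closed_triples_def by blast
      obtain \<Phi>' where \<Phi>': "\<Phi>' \<in> faces ?E" "border ?E \<Phi>' = pairs T'" using ex[OF T'(1)] by blast
      have c3: "card T = 3" "card T' = 3" using T T' F'(1) unfolding F_def by blast+
      have "card e = 2" using a(2) by (intro two) (simp add: border_def)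
      then have "e \<in> border ?E \<Phi>'" using \<Phi>' T' by (simp add: pairs_def)
      moreover have "\<Phi>' \<noteq> \<Phi>" using Ft[OF c3(1) T(2)] Ft[OF c3(2) \<Phi>'(2)] T'(2) by auto
      ultimately show "\<exists>\<Psi>\<in>?FF. \<Psi> \<noteq> \<Phi> \<and> e \<in> border ?E \<Psi>" using \<Phi>' T'(1) by blast
    qed auto
    also have "\<dots> = \<Union>(pairs ` F')"
    proof
      show "(\<Union>\<Phi>\<in>?FF. border ?E \<Phi>) \<subseteq> \<Union>(pairs ` F')" by blast
      show "\<Union>(pairs ` F') \<subseteq> (\<Union>\<Phi>\<in>?FF. border ?E \<Phi>)"
      proof
        fix e assume "e \<in> \<Union>(pairs ` F')"
        then obtain T where T: "T \<in> F'" "e \<in> pairs T" by blast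
        then obtain \<Phi> where "\<Phi> \<in> faces ?E" "border ?E \<Phi> = pairs T" using ex by blast
        with T show "e \<in> (\<Union>\<Phi>\<in>?FF. border ?E \<Phi>)" by blast
      qed
    qed
    finally show "?E = \<Union>(pairs ` F')" .
  qed
qed

section \<open>Intersecting families of triples\<close>

lemma card_le_2D:
  assumes "card A \<le> 2" "finite A" "x \<in> A" "y \<in> A" "z \<in> A"
  shows "x = y \<or> x = z \<or> y = z"
proof (rule ccontr)
  assume "\<not> ?thesis"
  then have "card {x, y, z} = 3" by auto
  moreover have "card {x, y, z} \<le> card A" using assms by (intro card_mono) auto
  ultimately show False using assms(1) by simp
qed

lemma pairwise_intersecting_doubletons:
  assumes "card P = 2" "card Q = 2" "card R = 2" "P \<inter> Q \<noteq> {}" "Q \<inter> R \<noteq> {}" "P \<inter> R \<noteq> {}"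
  shows "(\<exists>x. x \<in> P \<and> x \<in> Q \<and> x \<in> R) \<or>
    (\<exists>x y z. x \<noteq> y \<and> y \<noteq> z \<and> x \<noteq> z \<and> P = {y, z} \<and> Q = {x, z} \<and> R = {x, y})"
proof (cases "\<exists>x. x \<in> P \<and> x \<in> Q \<and> x \<in> R")
  case False
  obtain z where z: "z \<in> P" "z \<in> Q" using assms(4) by blast
  obtain x where x: "x \<in> Q" "x \<in> R" using assms(5) by blast
  obtain y where y: "y \<in> P" "y \<in> R" using assms(6) by blast
  have "x \<noteq> y" "y \<noteq> z" "x \<noteq> z" using False x y z by blast+
  moreover from this have "P = {y, z}" "Q = {x, z}" "R = {x, y}"
    using assms(1-3) x y z by (auto simp: card_2_iff)
  ultimately show ?thesis by blast
qed blast

lemma doubleton_eqI: "\<lbrakk>card P = 2; x \<in> P; y \<in> P; x \<noteq> y\<rbrakk> \<Longrightarrow> P = {x, y}"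
  by (auto simp: card_2_iff)

text \<open>The last hypothesis on \<open>L\<close> and \<open>M\<close> is the trace of planarity: with two further vertices joined
  to \<open>x, y, u, v\<close>, the forbidden configuration spans 13 edges on 6 vertices.\<close>

lemma cross_intersecting_doubletons:
  fixes L M :: "'a set set"
  assumes fin: "finite L" "finite M" and ne: "L \<noteq> {}" "M \<noteq> {}"
    and two: "\<And>P. P \<in> L \<Longrightarrow> card P = 2" "\<And>P. P \<in> M \<Longrightarrow> card P = 2"
    and degL: "\<And>x. card {P \<in> L. x \<in> P} \<le> 2" and degM: "\<And>x. card {P \<in> M. x \<in> P} \<le> 2"
    and cross: "\<And>P Q. \<lbrakk>P \<in> L; Q \<in> M\<rbrakk> \<Longrightarrow> P \<inter> Q \<noteq> {}"
    and no: "\<And>x y u v. \<lbrakk>distinct [x, y, u, v]; {x, y} \<in> L; {u, v} \<in> L; {x, u} \<in> M; {y, v} \<in> M\<rbrakk>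
      \<Longrightarrow> {x, v} \<notin> L \<union> M"
  shows "card L + card M \<le> 5 \<or> (\<exists>T. card T = 3 \<and> L = pairs T \<and> M = pairs T)"
proof -
  \<comment> \<open>A single member of \<open>L\<close> meets all of \<open>M\<close>, and each of
    its two points lies in at most two members of \<open>M\<close>.\<close>
  have four: "card M \<le> 4" if L: "L \<noteq> {}" and two: "\<And>P. P \<in> L \<Longrightarrow> card P = 2"
      and M: "finite M" "\<And>x. card {P \<in> M. x \<in> P} \<le> 2"
      and cross: "\<And>P Q. \<lbrakk>P \<in> L; Q \<in> M\<rbrakk> \<Longrightarrow> P \<inter> Q \<noteq> {}"
    for L M :: "'a set set"
  proof -
    obtain P where P: "P \<in> L" using L by blast
    then obtain x y where xy: "P = {x, y}" using two by (meson card_2_iff)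
    have "M \<subseteq> {P \<in> M. x \<in> P} \<union> {P \<in> M. y \<in> P}" using cross[OF P] xy by auto
    then have "card M \<le> card ({P \<in> M. x \<in> P} \<union> {P \<in> M. y \<in> P})" using M(1) by (intro card_mono) auto
    also have "\<dots> \<le> card {P \<in> M. x \<in> P} + card {P \<in> M. y \<in> P}" by (rule card_Un_le)
    finally show ?thesis using M(2)[of x] M(2)[of y] by linarith
  qed
  have star: "L \<subseteq> insert {s, t} {P \<in> L. v \<in> P}" 
    if "{v, s} \<in> M" "{v, t} \<in> M" "s \<noteq> t" and cross: "\<And>P Q. \<lbrakk>P \<in> L; Q \<in> M\<rbrakk> \<Longrightarrow> P \<inter> Q \<noteq> {}"
      and two: "\<And>P. P \<in> L \<Longrightarrow> card P = 2"
    for L M :: "'a set set" and v s t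
  proof
    fix P assume P: "P \<in> L"
    show "P \<in> insert {s, t} {P \<in> L. v \<in> P}"
    proof (cases "v \<in> P")
      case False
      then have "s \<in> P" "t \<in> P" using cross[OF P that(1)] cross[OF P that(2)] by auto
      then show ?thesis using doubleton_eqI[OF two[OF P]] that(3) by auto
    qed (use P in simp)
  qed
  have L4: "card L \<le> 4" by (rule four[OF ne(2) two(2) fin(1) degL]) (use cross in \<open>auto simp: Int_commute\<close>)
  have M4: "card M \<le> 4" by (rule four[OF ne(1) two(1) fin(2) degM cross])
  let ?V = "\<lambda>L. \<exists>v s t. {v, s} \<in> L \<and> {v, t} \<in> L \<and> s \<noteq> t \<and> v \<noteq> s \<and> v \<noteq> t"
  have le_or: "card L \<le> 1 \<or> 2 \<le> card L" "card M \<le> 1 \<or> 2 \<le> card M" by auto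
  \<comment> \<open>If no two members of \<open>L\<close> share a point, \<open>L\<close> consists
    of two disjoint pairs and \<open>M\<close> lies in the 4-cycle between them. The full 4-cycle is
    excluded by \<open>no\<close>, which leaves at most 2 + 3.\<close>
  have matching: "card L + card M \<le> 5" if n: "\<not> ?V L" and c: "card L \<ge> 2" "finite L" "finite M" "card M \<le> 4"
      and two: "\<And>P. P \<in> L \<Longrightarrow> card P = 2" "\<And>P. P \<in> M \<Longrightarrow> card P = 2"
      and cross: "\<And>P Q. \<lbrakk>P \<in> L; Q \<in> M\<rbrakk> \<Longrightarrow> P \<inter> Q \<noteq> {}" and M: "M \<noteq> {}"
      and no: "\<And>x y u v. \<lbrakk>distinct [x, y, u, v]; {x, y} \<in> L; {u, v} \<in> L; {x, u} \<in> M; {y, v} \<in> M\<rbrakk>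
      \<Longrightarrow> {x, v} \<notin> L \<union> M"
    for L M :: "'a set set"
  proof -
    have dis: "P \<inter> Q = {}" if PQ: "P \<in> L" "Q \<in> L" "P \<noteq> Q" for P Q
    proof (rule ccontr)
      assume "P \<inter> Q \<noteq> {}"
      then obtain v where v: "v \<in> P" "v \<in> Q" by blast
      obtain s where s: "P = {v, s}" "v \<noteq> s" using two(1)[OF PQ(1)] v by (auto simp: card_2_iff)
      obtain t where t: "Q = {v, t}" "v \<noteq> t" using two(1)[OF PQ(2)] v by (auto simp: card_2_iff)
      have "s \<noteq> t" using s t PQ(3) by blast
      then show False using n s t PQ(1,2) by blast
    qed
    obtain P Q where PQ: "P \<in> L" "Q \<in> L" "P \<noteq> Q"
      using c(1,2) by (metis One_nat_def card_le_Suc0_iff_eq not_less_eq_eq numeral_2_eq_2)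
    obtain x y where x: "P = {x, y}" "x \<noteq> y" using two(1)[OF PQ(1)] by (auto simp: card_2_iff)
    obtain u v where u: "Q = {u, v}" "u \<noteq> v" using two(1)[OF PQ(2)] by (auto simp: card_2_iff)
    have ds: "distinct [x, y, u, v]" using dis[OF PQ] x u by auto
    have Msub: "R \<in> {{x, u}, {x, v}, {y, u}, {y, v}}" if R: "R \<in> M" for R
    proof -
      obtain g h where gh: "g \<in> P" "g \<in> R" "h \<in> Q" "h \<in> R" using cross[OF PQ(1) R] cross[OF PQ(2) R] by blast
      moreover from this have "g \<noteq> h" using dis[OF PQ] by blast
      ultimately have "R = {g, h}" using doubleton_eqI[OF two(2)[OF R]] by blast
      then show ?thesis using gh x u by auto
    qed
    have L2: "L \<subseteq> {P, Q}"
    proof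
      fix S assume S: "S \<in> L"
      obtain R where R: "R \<in> M" using M by blast
      show "S \<in> {P, Q}"
      proof (rule ccontr)
        assume "S \<notin> {P, Q}"
        then have "S \<inter> P = {}" "S \<inter> Q = {}" using dis S PQ by auto
        moreover have "R \<subseteq> P \<union> Q" using Msub[OF R] x u by auto
        ultimately show False using cross[OF S R] by blast
      qed
    qed
    have "card L \<le> card {P, Q}" using L2 by (intro card_mono) auto
    then have cL: "card L \<le> 2" using PQ(3) by simp
    have "card M \<le> 3"
    proof (rule ccontr)
      assume "\<not> card M \<le> 3"
      moreover have "card {{x, u}, {x, v}, {y, u}, {y, v}} \<le> 4"
        by (simp add: card_insert_if)
      ultimately have "M = {{x, u}, {x, v}, {y, u}, {y, v}}"
        using Msub by (intro card_seteq) auto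
      then show False using no[OF ds] PQ x u by blast
    qed
    then show ?thesis using cL by linarith
  qed
  consider "card L \<le> 1" | "card M \<le> 1" | "card L \<ge> 2" "\<not> ?V L" | "card M \<ge> 2" "\<not> ?V M" | "?V L" "?V M"
    using le_or by argo
  then show ?thesis
  proof cases
    case 1 then show ?thesis using M4 by linarith
  next
    case 2 then show ?thesis using L4 by linarith
  next
    case 3
    have "card L + card M \<le> 5" by (rule matching[OF 3(2,1) fin M4 two cross ne(2) no])
    then show ?thesis by blast
  next
    case 4
    have "card M + card L \<le> 5"
    proof (rule matching[OF 4(2,1) fin(2,1) L4 two(2,1)])
      show "P \<inter> Q \<noteq> {}" if "P \<in> M" "Q \<in> L" for P Q using cross[OF that(2,1)] by blast
      show "{x, v} \<notin> M \<union> L" if "distinct [x, y, u, v]" "{x, y} \<in> M" "{u, v} \<in> M" "{x, u} \<in> L" "{y, v} \<in> L"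
        for x y u v using no[of x u y v] that by auto
    qed (use ne in auto)
    then show ?thesis by linarith
  next
    case 5
    obtain v s t where v: "{v, s} \<in> M" "{v, t} \<in> M" "s \<noteq> t" "v \<noteq> s" "v \<noteq> t" using 5(2) by blast
    have Ls: "L \<subseteq> insert {s, t} {P \<in> L. v \<in> P}" by (rule star[OF v(1-3) cross two(1)])
    have three: "card A \<le> 3 \<and> (card A = 3 \<longrightarrow> X \<in> A \<and> card {P \<in> A. v \<in> P} = 2)"
      if A: "A \<subseteq> insert X {P \<in> A. v \<in> P}" "card {P \<in> A. v \<in> P} \<le> 2" "finite A"
      for A :: "'a set set" and X v
    proof -
      have "card A \<le> card (insert X {P \<in> A. v \<in> P})" using A by (intro card_mono) auto
      also have "\<dots> \<le> Suc (card {P \<in> A. v \<in> P})" using A(3) by (simp add: card_insert_if)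
      finally have *: "card A \<le> Suc (card {P \<in> A. v \<in> P})" .
      have "X \<in> A" if "card A = 3"
      proof (rule ccontr)
        assume "X \<notin> A"
        then have "card A \<le> card {P \<in> A. v \<in> P}" using A by (intro card_mono) auto
        then show False using A(2) that by linarith
      qed
      then show ?thesis using * A(2) by auto
    qed
    note L3 = three[OF Ls degL fin(1)]
    obtain v' s' t' where v': "{v', s'} \<in> L" "{v', t'} \<in> L" "s' \<noteq> t'" "v' \<noteq> s'" "v' \<noteq> t'" using 5(1) by blast
    have "M \<subseteq> insert {s', t'} {P \<in> M. v' \<in> P}"
      by (rule star[OF v'(1-3) _ two(2)]) (use cross in \<open>auto simp: Int_commute\<close>)
    note M3 = three[OF this degM fin(2)]
    \<comment> \<open>Each family consists of at most two members through a common point and one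
      further pair, so only 3 + 3 is left to discuss.\<close>
    show ?thesis
    proof (cases "card L = 3 \<and> card M = 3")
      case False
      then show ?thesis using L3 M3 by linarith
    next
      case True
      then have st: "{s, t} \<in> L" "card {P \<in> L. v \<in> P} = 2" using L3 by auto
      then obtain P Q where PQ: "{P \<in> L. v \<in> P} = {P, Q}" "P \<noteq> Q" by (auto simp: card_2_iff)
      then have "P \<in> L" "v \<in> P" "Q \<in> L" "v \<in> Q" by auto
      moreover from this obtain g where g: "P = {v, g}" "v \<noteq> g" using two(1)[of P] by (auto simp: card_2_iff)
      moreover obtain h where h: "Q = {v, h}" "v \<noteq> h"
        using two(1)[of Q] \<open>Q \<in> L\<close> \<open>v \<in> Q\<close> by (auto simp: card_2_iff)
      ultimately have vg: "{v, g} \<in> L" "{v, h} \<in> L" "g \<noteq> h" using PQ(2) by auto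
      have "M \<subseteq> insert {g, h} {P \<in> M. v \<in> P}"
        by (rule star[OF vg _ two(2)]) (use cross in \<open>auto simp: Int_commute\<close>)
      from three[OF this degM fin(2)] True have gh: "{g, h} \<in> M" by blast
      \<comment> \<open>Now \<open>L\<close> is \<open>vg, vh, st\<close> and \<open>M\<close> is
        \<open>vs, vt, gh\<close>, where \<open>st\<close> and \<open>gh\<close> meet in
        \<open>c\<close>. Either the remaining points \<open>d\<close> and \<open>f\<close> agree
        and both families are the triangle on \<open>v, c, f\<close>, or the 4-cycle
        \<open>c, f, v, d\<close> with chord \<open>vc\<close> contradicts
        \<open>no\<close>.\<close>
      obtain c where c: "c \<in> {s, t}" "c \<in> {g, h}" using cross[OF st(1) gh] by blast
      obtain f where f: "{s, t} = {c, f}" "c \<noteq> f" using c(1) v(3) by auto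
      obtain d where d: "{g, h} = {c, d}" "c \<noteq> d" using c(2) vg(3) by auto
      have L: "{c, f} \<in> L" "{v, c} \<in> L" "{v, d} \<in> L" and M: "{c, d} \<in> M" "{v, c} \<in> M" "{v, f} \<in> M"
        and vv: "v \<noteq> c" "v \<noteq> d" "v \<noteq> f"
      proof -
        have cf: "c = s \<and> f = t \<or> c = t \<and> f = s" using f(1) unfolding doubleton_eq_iff by blast
        have cd: "c = g \<and> d = h \<or> c = h \<and> d = g" using d(1) unfolding doubleton_eq_iff by blast
        show "{c, f} \<in> L" "{c, d} \<in> M" using st(1) gh f(1) d(1) by simp_all
        show "{v, c} \<in> L" "{v, d} \<in> L" "v \<noteq> c" "v \<noteq> d" using cd vg g(2) h(2) by auto
        show "{v, c} \<in> M" "{v, f} \<in> M" "v \<noteq> f" using cf v by auto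
      qed
      have "d = f"
      proof (rule ccontr)
        assume "d \<noteq> f"
        then have "distinct [c, f, d, v]" using f d vv by auto
        from no[OF this] L M show False by (auto simp: insert_commute)
      qed
      have "{{v, c}, {v, f}, {c, f}} = L"
        using L True vv f fin \<open>d = f\<close> by (intro card_seteq) (auto simp: doubleton_eq_iff)
      moreover have "{{v, c}, {v, f}, {c, f}} = M"
        using M True vv f fin \<open>d = f\<close> by (intro card_seteq) (auto simp: doubleton_eq_iff)
      moreover have "pairs {v, c, f} = {{v, c}, {v, f}, {c, f}}" using vv f by (intro pairs_3) auto
      moreover have "card {v, c, f} = 3" using vv f by auto
      ultimately show ?thesis by metis
    qed
  qed
qed

section \<open>Intersecting triangles without a common vertex\<close>

lemma pairs_insert:
  assumes "x \<notin> S"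
  shows "pairs (insert x S) = (\<lambda>y. {x, y}) ` S \<union> pairs S"
proof
  show "pairs (insert x S) \<subseteq> (\<lambda>y. {x, y}) ` S \<union> pairs S"
  proof
    fix e assume "e \<in> pairs (insert x S)"
    then have e: "e \<subseteq> insert x S" "card e = 2" by (auto simp: pairs_def)
    show "e \<in> (\<lambda>y. {x, y}) ` S \<union> pairs S"
    proof (cases "x \<in> e")
      case True
      then obtain y where "e = {x, y}" "x \<noteq> y" using e(2) by (auto simp: card_2_iff)
      then show ?thesis using e by auto
    qed (use e in \<open>auto simp: pairs_def\<close>)
  qed
qed (use assms in \<open>auto simp: pairs_def card_2_iff\<close>)

lemma pairs_empty: "pairs {} = {}"
  by (auto simp: pairs_def)

text \<open>The bounds 9 and 12 are \<open>3 k - 6\<close> for \<open>k = 5, 6\<close>. Besides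
  them, only \<open>deg\<close> remembers that the triangles are faces.\<close>

locale triangle_family =
  fixes F :: "'a set set" and E :: "'a set set"
  assumes finF: "finite F" and neF: "F \<noteq> {}"
    and card3: "T \<in> F \<Longrightarrow> card T = 3" and tri: "T \<in> F \<Longrightarrow> pairs T \<subseteq> E"
    and deg: "x \<noteq> y \<Longrightarrow> card {T \<in> F. x \<in> T \<and> y \<in> T} \<le> 2"
    and meet: "\<lbrakk>S \<in> F; T \<in> F\<rbrakk> \<Longrightarrow> S \<inter> T \<noteq> {}"
    and five: "card S = 5 \<Longrightarrow> card (pairs S \<inter> E) \<le> 9"
    and six: "card S = 6 \<Longrightarrow> card (pairs S \<inter> E) \<le> 12"
    and nonstar: "\<exists>T\<in>F. x \<notin> T"
begin

lemma edge: "\<lbrakk>T \<in> F; x \<in> T; y \<in> T; x \<noteq> y\<rbrakk> \<Longrightarrow> {x, y} \<in> E"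
  using tri[of T] by (auto simp: pairs_def)

lemma not_K5:
  assumes "card S = 5" "pairs S \<subseteq> E"
  shows False
proof -
  have "finite S" using assms(1) by (intro card_ge_0_finite) simp
  then have "card (pairs S) = 10" using card_pairs[of S] assms(1) by (simp add: numeral_eq_Suc)
  moreover have "pairs S \<inter> E = pairs S" using assms(2) by blast
  ultimately show False using five[OF assms(1)] by simp
qed

text \<open>Two missing pairs leave 13 of 15 edges, one above the bound. Most contradictions below
  exhibit six vertices and name the two pairs that may be missing.\<close>

lemma not_K6_minus_two:
  assumes "card S = 6" "pairs S - {d, d'} \<subseteq> E"
  shows False
proof -
  have fin: "finite S" using assms(1) by (intro card_ge_0_finite) simp
  then have "card (pairs S) = 15" using card_pairs[of S] assms(1) by (simp add: numeral_eq_Suc)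
  then have "15 - card {d, d'} \<le> card (pairs S - {d, d'})"
    using diff_card_le_card_Diff[of "{d, d'}" "pairs S"] by simp
  moreover have "card {d, d'} \<le> 2" by (simp add: card_insert_if)
  moreover have "card (pairs S - {d, d'}) \<le> card (pairs S \<inter> E)"
    using assms(2) finite_pairs[OF fin] by (intro card_mono) auto
  ultimately show False using six[OF assms(1)] by linarith
qed

text \<open>The vertices \<open>a, b, c, x\<close> are pairwise adjacent. A member \<open>S\<close>
  through \<open>b\<close> that avoids \<open>a\<close> and \<open>x\<close> must contain
  \<open>ya\<close>. An edge from \<open>c\<close> to \<open>ya\<close> would make five vertices
  complete, so \<open>S\<close> avoids \<open>c\<close> and must contain \<open>yc\<close>. Then at
  most \<open>{a, yc}\<close> and \<open>{c, ya}\<close> are missing on six vertices.\<close>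

lemma common_vertex_case:
  assumes ds: "distinct [a, b, c, x]" "ya \<notin> {a, b, c, x}" "yc \<notin> {a, b, c, x}"
    and T: "{a, b, c} \<in> F" "{a, x, ya} \<in> F" "{c, x, yc} \<in> F" "{b, x} \<in> E"
    and S: "S \<in> F" "a \<notin> S" "x \<notin> S" "b \<in> S"
  shows False
proof -
  have ya: "ya \<in> S" using meet[OF S(1) T(2)] S by auto
  have e: "{a, b} \<in> E" "{a, c} \<in> E" "{b, c} \<in> E" "{a, x} \<in> E" "{a, ya} \<in> E" "{x, ya} \<in> E"
      "{c, x} \<in> E" "{c, yc} \<in> E" "{x, yc} \<in> E" "{b, ya} \<in> E"
    using edge[OF T(1)] edge[OF T(2)] edge[OF T(3)] edge[OF S(1)] ya S(4) ds by auto
  have K5: False if "{c, ya} \<in> E"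
  proof (rule not_K5)
    show "card {a, b, c, x, ya} = 5" using ds by auto
    have "distinct [a, b, c, x, ya]" using ds by auto
    then show "pairs {a, b, c, x, ya} \<subseteq> E"
      using e T(4) that by (simp add: pairs_insert pairs_empty)
  qed
  have "c \<notin> S" using K5 edge[OF S(1) _ ya, of c] ds by auto
  then have yc: "yc \<in> S" using meet[OF S(1) T(3)] S by auto
  have "yc \<noteq> ya" using K5 e by auto
  then have e': "{ya, yc} \<in> E" "{b, yc} \<in> E" using edge[OF S(1)] ya yc S(4) ds by auto
  show False
  proof (rule not_K6_minus_two)
    show "card {a, b, c, x, ya, yc} = 6" using ds \<open>yc \<noteq> ya\<close> by auto
    have "distinct [a, b, c, x, ya, yc]" using ds \<open>yc \<noteq> ya\<close> by auto
    then show "pairs {a, b, c, x, ya, yc} - {{a, yc}, {c, ya}} \<subseteq> E"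
      using e e' T(4) by (simp add: pairs_insert pairs_empty Diff_subset_conv)
  qed
qed

text \<open>Otherwise each vertex of a member \<open>{a, b, c}\<close> lies in a member that meets
  it nowhere else. The three remaining pairs \<open>P, Q, R\<close> intersect pairwise, so they
  share a point or form a triangle. A shared point falls under \<open>common_vertex_case\<close>; a
  triangle yields an octahedron.\<close>

lemma two_cover:
  obtains a b where "a \<noteq> b" "\<And>T. T \<in> F \<Longrightarrow> a \<in> T \<or> b \<in> T"
proof -
  have "\<exists>a b. a \<noteq> b \<and> (\<forall>T\<in>F. a \<in> T \<or> b \<in> T)"
  proof (rule ccontr)
    assume "\<not> ?thesis"
    then have miss: "\<exists>S\<in>F. a \<notin> S \<and> b \<notin> S" if "a \<noteq> b" for a b using that by blast
    obtain T where T: "T \<in> F" using neF by blast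
    then obtain a b c where abc: "T = {a, b, c}" "a \<noteq> b" "b \<noteq> c" "a \<noteq> c"
      using card3 by (meson card_3_iff)
    have "\<exists>P. card P = 2 \<and> P \<inter> T = {} \<and> insert x P \<in> F" if x: "T = {x, y, z}" "distinct [x, y, z]" for x y z
    proof -
      obtain S where S: "S \<in> F" "y \<notin> S" "z \<notin> S" using miss[of y z] x(2) by auto
      then have "x \<in> S" using meet[OF T S(1)] x by auto
      then have "card (S - {x}) = 2" "insert x (S - {x}) = S"
        using card3[OF S(1)] by (auto simp: insert_absorb)
      moreover have "(S - {x}) \<inter> T = {}" using S x by auto
      ultimately show ?thesis using S(1) by metis
    qed
    note ex = this
    obtain P where P: "card P = 2" "P \<inter> T = {}" "insert a P \<in> F" using ex[of a b c] abc by auto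
    have "T = {b, a, c}" "T = {c, a, b}" using abc by auto
    then obtain Q R where Q: "card Q = 2" "Q \<inter> T = {}" "insert b Q \<in> F"
      and R: "card R = 2" "R \<inter> T = {}" "insert c R \<in> F"
      using ex[of b a c] ex[of c a b] abc by auto
    have "P \<inter> Q \<noteq> {}" "Q \<inter> R \<noteq> {}" "P \<inter> R \<noteq> {}"
      using meet[OF P(3) Q(3)] meet[OF Q(3) R(3)] meet[OF P(3) R(3)] P(2) Q(2) R(2) abc by auto
    from pairwise_intersecting_doubletons[OF P(1) Q(1) R(1) this]
    show False
    proof (elim disjE exE conjE)
      fix x assume x: "x \<in> P" "x \<in> Q" "x \<in> R"
      obtain ya where ya: "P = {x, ya}" "x \<noteq> ya" using x(1) P(1) by (auto simp: card_2_iff)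
      obtain yb where yb: "Q = {x, yb}" "x \<noteq> yb" using x(2) Q(1) by (auto simp: card_2_iff)
      obtain yc where yc: "R = {x, yc}" "x \<noteq> yc" using x(3) R(1) by (auto simp: card_2_iff)
      have ds: "distinct [a, b, c, x]" "ya \<notin> {a, b, c, x}" "yb \<notin> {a, b, c, x}" "yc \<notin> {a, b, c, x}"
        using abc P(2) Q(2) R(2) ya yb yc by auto
      have TT: "{a, b, c} \<in> F" "{a, c, b} \<in> F" using T abc by (auto simp: insert_commute)
      have F3: "{a, x, ya} \<in> F" "{b, x, yb} \<in> F" "{c, x, yc} \<in> F" using P Q R ya yb yc by auto
      have ee: "{b, x} \<in> E" "{c, x} \<in> E" using edge[OF F3(2)] edge[OF F3(3)] ds by auto
      obtain S where S: "S \<in> F" "a \<notin> S" "x \<notin> S" using miss[of a x] ds by auto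
      then have "b \<in> S \<or> c \<in> S" using meet[OF T S(1)] abc by auto
      then show False
      proof
        assume "b \<in> S"
        show False by (rule common_vertex_case[OF ds(1,2,4) TT(1) F3(1,3) ee(1) S \<open>b \<in> S\<close>])
      next
        assume "c \<in> S"
        have "distinct [a, c, b, x]" "ya \<notin> {a, c, b, x}" "yb \<notin> {a, c, b, x}" using ds by auto
        from common_vertex_case[OF this TT(2) F3(1,2) ee(2) S \<open>c \<in> S\<close>] show False .
      qed
    next
      fix x y z assume xyz: "x \<noteq> y" "y \<noteq> z" "x \<noteq> z" "P = {y, z}" "Q = {x, z}" "R = {x, y}"
      have out: "x \<notin> {a, b, c}" "y \<notin> {a, b, c}" "z \<notin> {a, b, c}" using P(2) Q(2) R(2) xyz abc by auto
      have F4: "{a, y, z} \<in> F" "{b, x, z} \<in> F" "{c, x, y} \<in> F" "{a, b, c} \<in> F" using P Q R T xyz abc by auto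
      have e: "{a, b} \<in> E" "{a, c} \<in> E" "{b, c} \<in> E" "{a, y} \<in> E" "{a, z} \<in> E" "{y, z} \<in> E"
        "{b, x} \<in> E" "{b, z} \<in> E" "{x, z} \<in> E" "{c, x} \<in> E" "{c, y} \<in> E" "{x, y} \<in> E"
        using edge[OF F4(1)] edge[OF F4(2)] edge[OF F4(3)] edge[OF F4(4)] xyz out abc by auto
      have six: "card {a, b, c, x, y, z} = 6" using abc xyz out by auto
      have d6: "distinct [a, b, c, x, y, z]" using abc xyz out by auto
      \<comment> \<open>The octahedron has 12 edges, so its antipodal pairs \<open>b, y\<close> and
        \<open>c, z\<close> are not adjacent. A member that avoids the third antipodal pair
        \<open>a, x\<close> then cannot meet all four known triangles.\<close>
      have "{b, y} \<notin> E"
      proof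
        assume "{b, y} \<in> E"
        then have "pairs {a, b, c, x, y, z} - {{a, x}, {c, z}} \<subseteq> E"
          using e d6 by (simp add: pairs_insert pairs_empty Diff_subset_conv)
        then show False using not_K6_minus_two[OF six] by blast
      qed
      moreover have "{c, z} \<notin> E"
      proof
        assume "{c, z} \<in> E"
        then have "pairs {a, b, c, x, y, z} - {{a, x}, {b, y}} \<subseteq> E"
          using e d6 by (simp add: pairs_insert pairs_empty Diff_subset_conv)
        then show False using not_K6_minus_two[OF six] by blast
      qed
      ultimately have non: "\<not> (b \<in> S \<and> y \<in> S)" "\<not> (c \<in> S \<and> z \<in> S)" if "S \<in> F" for S
        using edge[OF that] out by blast+
      obtain S where S: "S \<in> F" "a \<notin> S" "x \<notin> S" using miss[of a x] out by auto
      show False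
        using meet[OF S(1) F4(1)] meet[OF S(1) F4(2)] meet[OF S(1) F4(3)] meet[OF S(1) F4(4)] S non[OF S(1)]
        by auto
    qed
  qed
  then show ?thesis using that by blast
qed

end

section \<open>The links of two covering vertices\<close>

context triangle_family
begin

text \<open>The part of the vertex link of \<open>a\<close> that avoids \<open>b\<close>. When every
  member contains \<open>a\<close> or \<open>b\<close>, the family splits into at most two members
  through both and the two links, which cross-intersect.\<close>

definition link :: "'a \<Rightarrow> 'a \<Rightarrow> 'a set set" where
  "link a b = (\<lambda>T. T - {a}) ` {T \<in> F. a \<in> T \<and> b \<notin> T}"

lemma linkD:
  assumes "P \<in> link a b"
  shows "card P = 2" "a \<notin> P" "b \<notin> P" "insert a P \<in> F"
proof -
  obtain T where T: "T \<in> F" "a \<in> T" "b \<notin> T" "P = T - {a}" using assms by (auto simp: link_def)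
  then show "card P = 2" "a \<notin> P" "b \<notin> P" "insert a P \<in> F"
    using card3[OF T(1)] by (auto simp: insert_absorb)
qed

lemma finite_link: "finite (link a b)"
  unfolding link_def using finF by simp

lemma card_link: "card (link a b) = card {T \<in> F. a \<in> T \<and> b \<notin> T}"
  unfolding link_def by (intro card_image inj_onI) auto

text \<open>A member through \<open>a\<close>, \<open>x\<close> and \<open>b\<close> uses up degree
  of the pair \<open>a, x\<close> without appearing in the link. The set \<open>A\<close> accounts
  for such members: none in \<open>link_degree\<close>, one in \<open>link_degree_1\<close>.\<close>

lemma link_degree_aux:
  assumes "x \<noteq> a" "A \<subseteq> {T \<in> F. a \<in> T \<and> x \<in> T \<and> b \<in> T}"
  shows "card {P \<in> link a b. x \<in> P} + card A \<le> 2"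
proof -
  let ?S = "{P \<in> link a b. x \<in> P}"
  have fin: "finite ?S" "finite A" using finite_link finF finite_subset[OF assms(2)] by auto
  have "inj_on (insert a) ?S" using linkD(2) by (intro inj_onI) (metis (no_types, lifting) insert_ident mem_Collect_eq)
  then have "card ?S = card (insert a ` ?S)" by (simp add: card_image)
  moreover have "insert a ` ?S \<inter> A = {}"
  proof -
    have False if "P \<in> link a b" "insert a P \<in> A" for P
    proof -
      have "b \<in> insert a P" "b \<notin> P" using that assms(2) linkD(3) by auto
      then have "b = a" by simp
      then show False using that(1) by (auto simp: link_def)
    qed
    then show ?thesis by auto
  qed
  ultimately have "card ?S + card A = card (insert a ` ?S \<union> A)" using fin by (simp add: card_Un_disjoint)
  also have "\<dots> \<le> card {T \<in> F. a \<in> T \<and> x \<in> T}"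
    using assms(2) linkD(4) finF by (intro card_mono) auto
  also have "\<dots> \<le> 2" using deg[of a x] assms(1) by simp
  finally show ?thesis .
qed

lemma link_degree: "card {P \<in> link a b. x \<in> P} \<le> 2"
proof (cases "x = a")
  case True
  then have "{P \<in> link a b. x \<in> P} = {}" using linkD(2) by blast
  then show ?thesis by (metis card.empty zero_le)
next
  case False
  then show ?thesis using link_degree_aux[of x a "{}" b] by simp
qed

lemma link_degree_1:
  assumes "{a, b, z} \<in> F" "z \<noteq> a"
  shows "card {P \<in> link a b. z \<in> P} \<le> 1"
  using link_degree_aux[of z a "{{a, b, z}}" b] assms by simp

lemma link_cross:
  assumes "P \<in> link a b" "Q \<in> link b a"
  shows "P \<inter> Q \<noteq> {}"
proof -
  have "a \<noteq> b" using assms(1) by (auto simp: link_def)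
  then show ?thesis
    using meet[OF linkD(4)[OF assms(1)] linkD(4)[OF assms(2)]] linkD(2,3)[OF assms(1)] linkD(2,3)[OF assms(2)]
    by auto
qed

lemma link_edge: "\<lbrakk>{x, y} \<in> link a b; x \<noteq> y\<rbrakk> \<Longrightarrow> {a, x} \<in> E \<and> {a, y} \<in> E \<and> {x, y} \<in> E"
  using edge[OF linkD(4)[of "{x, y}" a b]] linkD(2)[of "{x, y}" a b] by auto

lemma links_planar:
  assumes ds: "distinct [x, y, u, v]" and L: "{x, y} \<in> link a b" "{u, v} \<in> link a b"
    and M: "{x, u} \<in> link b a" "{y, v} \<in> link b a"
  shows "{x, v} \<notin> link a b \<union> link b a"
proof
  assume "{x, v} \<in> link a b \<union> link b a"
  then have xv: "{x, v} \<in> E" using link_edge ds by auto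
  have e: "{a, x} \<in> E" "{a, y} \<in> E" "{a, u} \<in> E" "{a, v} \<in> E" "{b, x} \<in> E" "{b, y} \<in> E" "{b, u} \<in> E" "{b, v} \<in> E"
    "{x, y} \<in> E" "{u, v} \<in> E" "{x, u} \<in> E" "{y, v} \<in> E"
    using link_edge[OF L(1)] link_edge[OF L(2)] link_edge[OF M(1)] link_edge[OF M(2)] ds by auto
  have "a \<noteq> b" using L(1) by (auto simp: link_def)
  then have d6: "distinct [a, b, x, y, u, v]"
    using ds linkD(2,3)[OF L(1)] linkD(2,3)[OF L(2)] by auto
  then have "pairs {a, b, x, y, u, v} - {{a, b}, {y, u}} \<subseteq> E"
    using e xv by (simp add: pairs_insert pairs_empty Diff_subset_conv)
  moreover have "card {a, b, x, y, u, v} = 6" using d6 by simp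
  ultimately show False using not_K6_minus_two by blast
qed

text \<open>The two members through \<open>a\<close> and \<open>b\<close> leave \<open>z\<close> and
  \<open>z'\<close> degree at most one in \<open>link a b\<close>, so three pairs there form a path
  \<open>z, s, t, z'\<close> with \<open>{s, t} = {w, w'}\<close>. A pair that meets all edges of
  this path is \<open>{s, t}\<close>, \<open>{z', s}\<close> or \<open>{z, t}\<close>, and two of
  these in the other link complete 13 edges on the six vertices.\<close>

lemma six_vertices_aux:
  assumes z: "{a, b, z} \<in> F" "{a, b, z'} \<in> F" and ds: "distinct [a, b, z, z', w, w']"
    and U: "\<Union>F \<subseteq> {a, b, z, z', w, w'}"
    and L: "3 \<le> card (link a b)" and sum: "5 \<le> card (link a b) + card (link b a)"
  shows False
proof -
  let ?L = "link a b" and ?M = "link b a"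
  have sub: "P \<subseteq> {z, z', w, w'}" if "P \<in> link a b \<or> P \<in> link b a" for P
  proof -
    have "a \<notin> P" "b \<notin> P" using that linkD(2,3) by blast+
    moreover have "P \<subseteq> \<Union>F" using that linkD(4) by blast
    ultimately show ?thesis using U by blast
  qed
  let ?Z = "{P \<in> ?L. z \<in> P}" and ?Z' = "{P \<in> ?L. z' \<in> P}"
  have Z1: "card ?Z \<le> 1" "card ?Z' \<le> 1" using link_degree_1 z ds by auto
  have "?L \<subseteq> ?Z \<union> ?Z' \<union> (?L \<inter> {{w, w'}})"
  proof
    fix P assume P: "P \<in> ?L"
    show "P \<in> ?Z \<union> ?Z' \<union> (?L \<inter> {{w, w'}})"
    proof (cases "z \<in> P \<or> z' \<in> P")
      case False
      then have "P \<subseteq> {w, w'}" using sub P by blast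
      moreover have "card {w, w'} = 2" using ds by simp
      ultimately have "P = {w, w'}" using linkD(1)[OF P] by (intro card_seteq) auto
      then show ?thesis using P by simp
    qed (use P in blast)
  qed
  then have "card ?L \<le> card (?Z \<union> ?Z' \<union> (?L \<inter> {{w, w'}}))"
    using finite_link by (intro card_mono) auto
  also have "\<dots> \<le> card (?Z \<union> ?Z') + card (?L \<inter> {{w, w'}})" by (rule card_Un_le)
  finally have le: "card ?L \<le> card (?Z \<union> ?Z') + card (?L \<inter> {{w, w'}})" .
  have ZZ: "card (?Z \<union> ?Z') \<le> card ?Z + card ?Z'" by (rule card_Un_le)
  have ww1: "card (?L \<inter> {{w, w'}}) \<le> 1" using card_mono[of "{{w, w'}}" "?L \<inter> {{w, w'}}"] by simp
  have "card (?L \<inter> {{w, w'}}) \<noteq> 0" using le ZZ Z1 L by linarith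
  then have "?L \<inter> {{w, w'}} \<noteq> {}" by (metis card.empty)
  then have ww: "{w, w'} \<in> ?L" by blast
  have "card ?Z = 1" "card ?Z' = 1" using le ZZ Z1 L ww1 by linarith+
  then obtain P Q where P: "?Z = {P}" and Q: "?Z' = {Q}" using card_1_singletonE by metis
  have "P \<noteq> Q"
  proof
    assume "P = Q"
    then have "card (?Z \<union> ?Z') = 1" using P Q by simp
    then show False using le L ww1 by linarith
  qed
  have PL: "P \<in> ?L" "z \<in> P" "z' \<notin> P" and QL: "Q \<in> ?L" "z' \<in> Q" "z \<notin> Q"
    using P Q \<open>P \<noteq> Q\<close> by blast+
  obtain s where s: "P = {z, s}" "z \<noteq> s" using linkD(1)[OF PL(1)] PL(2) by (auto simp: card_2_iff)
  obtain t where t: "Q = {z', t}" "z' \<noteq> t" using linkD(1)[OF QL(1)] QL(2) by (auto simp: card_2_iff)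
  have sw: "s \<in> {w, w'}" "t \<in> {w, w'}" using sub[of P] sub[of Q] PL QL s t by auto
  have "s \<noteq> t"
  proof
    assume "s = t"
    have "P = Q \<or> P = {w, w'} \<or> Q = {w, w'}"
      by (rule card_le_2D[OF link_degree[of a b s]]) (use finite_link PL QL ww s t sw \<open>s = t\<close> in auto)
    then show False using \<open>P \<noteq> Q\<close> PL QL ds by auto
  qed
  then have st: "{s, t} = {w, w'}" using sw by auto
  then have stL: "{s, t} \<in> ?L" using ww by simp
  have ds': "distinct [a, b, z, z', s, t]" using ds sw \<open>s \<noteq> t\<close> by auto
  have M3: "R = {s, t} \<or> R = {z', s} \<or> R = {z, t}" if R: "R \<in> ?M" for R
  proof -
    have "R \<inter> {z, s} \<noteq> {}" "R \<inter> {z', t} \<noteq> {}" "R \<inter> {s, t} \<noteq> {}"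
      using link_cross[OF PL(1) R] link_cross[OF QL(1) R] link_cross[OF stL R] s t by auto
    then have "s \<in> R \<and> t \<in> R \<or> z' \<in> R \<and> s \<in> R \<or> z \<in> R \<and> t \<in> R" by auto
    then show ?thesis using doubleton_eqI[OF linkD(1)[OF R]] ds' by auto
  qed
  have "card ?L \<le> 3" using le ZZ Z1 ww1 by linarith
  then have M2: "2 \<le> card ?M" using sum by linarith
  have sub1: False if "?M \<subseteq> {R}" for R using card_mono[OF _ that] M2 by simp
  \<comment> \<open>Any two of the three candidates for \<open>?M\<close> cover both
    \<open>s\<close> and \<open>t\<close>.\<close>
  have bs: "{b, s} \<in> E" "{b, t} \<in> E"
  proof -
    have "{s, t} \<in> ?M \<or> {z', s} \<in> ?M" using sub1[of "{z, t}"] M3 by blast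
    then show "{b, s} \<in> E" using link_edge ds' by fastforce
    have "{s, t} \<in> ?M \<or> {z, t} \<in> ?M" using sub1[of "{z', s}"] M3 by blast
    then show "{b, t} \<in> E" using link_edge ds' by fastforce
  qed
  have e: "{a, b} \<in> E" "{a, z} \<in> E" "{a, z'} \<in> E" "{a, s} \<in> E" "{a, t} \<in> E" "{b, z} \<in> E" "{b, z'} \<in> E"
    "{z, s} \<in> E" "{z', t} \<in> E" "{s, t} \<in> E"
    using edge[OF z(1)] edge[OF z(2)] link_edge[of z s a b] link_edge[of z' t a b] link_edge[OF stL] PL QL s t ds'
    by auto
  have c6: "card {a, b, z, z', s, t} = 6" using ds' by simp
  have "{z', s} \<in> ?M \<or> {z, t} \<in> ?M" using sub1[of "{s, t}"] M3 by blast
  then have "{z', s} \<in> E \<or> {z, t} \<in> E" using link_edge ds' by fastforce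
  then show False
  proof
    assume "{z', s} \<in> E"
    then have "pairs {a, b, z, z', s, t} - {{z, z'}, {z, t}} \<subseteq> E"
      using e bs ds' by (simp add: pairs_insert pairs_empty Diff_subset_conv)
    then show False using not_K6_minus_two[OF c6] by blast
  next
    assume "{z, t} \<in> E"
    then have "pairs {a, b, z, z', s, t} - {{z, z'}, {z', s}} \<subseteq> E"
      using e bs ds' by (simp add: pairs_insert pairs_empty Diff_subset_conv)
    then show False using not_K6_minus_two[OF c6] by blast
  qed
qed

text \<open>Seven is 2 members through both \<open>a\<close> and \<open>b\<close> plus 5 in the
  links. If both links are the same triangle they have 6 members together, but then \<open>a\<close>
  and \<open>b\<close> are not adjacent, since that edge would make five vertices complete; so no
  member contains both. On six vertices, 7 members would lead to
  \<open>six_vertices_aux\<close>.\<close>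

lemma card_nonstar: "card F \<le> 7" "card (\<Union>F) = 6 \<Longrightarrow> card F \<le> 6"
proof -
  obtain a b where ab: "a \<noteq> b" "\<And>T. T \<in> F \<Longrightarrow> a \<in> T \<or> b \<in> T" using two_cover by blast
  let ?L = "link a b" and ?M = "link b a"
  define N where "N = {T \<in> F. a \<in> T \<and> b \<in> T}"
  have N2: "card N \<le> 2" unfolding N_def by (rule deg[OF ab(1)])
  have split: "F = N \<union> ({T \<in> F. a \<in> T \<and> b \<notin> T} \<union> {T \<in> F. b \<in> T \<and> a \<notin> T})"
    using ab(2) unfolding N_def by blast
  have "card F = card N + card ({T \<in> F. a \<in> T \<and> b \<notin> T} \<union> {T \<in> F. b \<in> T \<and> a \<notin> T})"
    using finF by (subst split, intro card_Un_disjoint) (auto simp: N_def)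
  also have "card ({T \<in> F. a \<in> T \<and> b \<notin> T} \<union> {T \<in> F. b \<in> T \<and> a \<notin> T}) = card ?L + card ?M"
    unfolding card_link using finF by (intro card_Un_disjoint) auto
  finally have cF: "card F = card N + (card ?L + card ?M)" .
  have "?L \<noteq> {}" using nonstar[of b] ab(2) by (auto simp: link_def)
  moreover have "?M \<noteq> {}" using nonstar[of a] ab(2) by (auto simp: link_def)
  ultimately have "card ?L + card ?M \<le> 5 \<or> (\<exists>T. card T = 3 \<and> ?L = pairs T \<and> ?M = pairs T)"
    by (rule cross_intersecting_doubletons[OF finite_link finite_link])
      (fact linkD(1) link_degree link_cross links_planar | (erule linkD(1)) | (erule (1) link_cross)
        | (erule (4) links_planar))+
  then have *: "card ?L + card ?M \<le> 5 \<or> card F = 6"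
  proof
    assume "\<exists>T. card T = 3 \<and> ?L = pairs T \<and> ?M = pairs T"
    then obtain T where T: "card T = 3" "?L = pairs T" "?M = pairs T" by blast
    obtain x y z where xyz: "T = {x, y, z}" "x \<noteq> y" "y \<noteq> z" "x \<noteq> z" using T(1) by (meson card_3_iff)
    have p: "pairs T = {{x, y}, {x, z}, {y, z}}" unfolding xyz(1) by (rule pairs_3[OF xyz(2-4)])
    have L: "{x, y} \<in> ?L" "{x, z} \<in> ?L" "{y, z} \<in> ?L" and M: "{x, y} \<in> ?M" "{x, z} \<in> ?M" "{y, z} \<in> ?M"
      unfolding T p by auto
    have e: "{a, x} \<in> E" "{a, y} \<in> E" "{a, z} \<in> E" "{b, x} \<in> E" "{b, y} \<in> E" "{b, z} \<in> E"
      "{x, y} \<in> E" "{x, z} \<in> E" "{y, z} \<in> E"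
      using link_edge[OF L(1)] link_edge[OF L(2)] link_edge[OF L(3)] link_edge[OF M(1)] link_edge[OF M(2)] xyz
      by auto
    have ds: "distinct [a, b, x, y, z]"
      using linkD(2,3)[OF L(1)] linkD(2,3)[OF L(2)] xyz ab(1) by auto
    have "N = {}"
    proof (rule ccontr)
      assume "N \<noteq> {}"
      then have "{a, b} \<in> E" using edge ab(1) by (auto simp: N_def)
      then have "pairs {a, b, x, y, z} \<subseteq> E" using e ds by (simp add: pairs_insert pairs_empty)
      moreover have "card {a, b, x, y, z} = 5" using ds by simp
      ultimately show False using not_K5 by blast
    qed
    then show ?thesis using cF T card_pairs_3[OF T(1)] by simp
  qed simp
  then show "card F \<le> 7" using cF N2 by linarith
  assume U: "card (\<Union>F) = 6"
  show "card F \<le> 6"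
  proof (rule ccontr)
    assume "\<not> card F \<le> 6"
    then have N: "card N = 2" and s5: "5 \<le> card ?L + card ?M" using cF N2 * by linarith+
    obtain S S' where S: "N = {S, S'}" "S \<noteq> S'" using N by (auto simp: card_2_iff)
    then have SF: "S \<in> F" "a \<in> S" "b \<in> S" "S' \<in> F" "a \<in> S'" "b \<in> S'" unfolding N_def by blast+
    have third: "\<exists>z. X = {a, b, z} \<and> z \<noteq> a \<and> z \<noteq> b" if "X \<in> F" "a \<in> X" "b \<in> X" for X
    proof -
      have "card (X - {a, b}) = 1" using card3[OF that(1)] that ab(1) by (simp add: card_Diff_subset)
      then obtain z where "X - {a, b} = {z}" by (auto simp: card_1_singleton_iff)
      then show ?thesis using that by blast
    qed
    obtain z where z: "S = {a, b, z}" "z \<noteq> a" "z \<noteq> b" using third SF by blast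
    obtain z' where z': "S' = {a, b, z'}" "z' \<noteq> a" "z' \<noteq> b" using third SF by blast
    have "z \<noteq> z'" using z z' S by blast
    have "{a, b, z, z'} \<subseteq> \<Union>F" using SF z z' by blast
    moreover have "card {a, b, z, z'} = 4" using z z' \<open>z \<noteq> z'\<close> ab(1) by simp
    ultimately have "card (\<Union>F - {a, b, z, z'}) = 2" using U by (simp add: card_Diff_subset)
    then obtain w w' where w: "\<Union>F - {a, b, z, z'} = {w, w'}" "w \<noteq> w'" by (auto simp: card_2_iff)
    then have UF: "\<Union>F \<subseteq> {a, b, z, z', w, w'}" by blast
    have "w \<notin> {a, b, z, z'}" "w' \<notin> {a, b, z, z'}" using w(1) by blast+
    then have ds: "distinct [a, b, z, z', w, w']" using w(2) z z' \<open>z \<noteq> z'\<close> ab(1) by auto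
    have F2: "{a, b, z} \<in> F" "{a, b, z'} \<in> F" using SF z z' by auto
    have "3 \<le> card ?L \<or> 3 \<le> card ?M" using s5 by linarith
    then show False
    proof
      assume "3 \<le> card ?L"
      from six_vertices_aux[OF F2 ds UF this s5] show False .
    next
      assume M: "3 \<le> card ?M"
      show False
      proof (rule six_vertices_aux[of b a z z' w w'])
        show "{b, a, z} \<in> F" "{b, a, z'} \<in> F" using F2 by (simp_all add: insert_commute)
        show "distinct [b, a, z, z', w, w']" using ds by auto
        show "\<Union>F \<subseteq> {b, a, z, z', w, w'}" using UF by blast
      qed (use M s5 in auto)
    qed
  qed
qed

end

section \<open>Joined triangles and edge counts\<close>

lemma lessThan_3: "{..<3::nat} = {0, 1, 2}"
  by auto

lemma verts_cycle_cycle_3_3: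
  "verts (cycle_cycle 3 3) = {Inl 0, Inl 1, Inl 2, Inr 0, Inr 1, Inr 2}"
  by (simp add: cycle_cycle_def cycle_graph_def lessThan_3 insert_commute)

lemma edges_cycle_cycle_3_3:
  "edges (cycle_cycle 3 3) = {{Inl 0, Inl 1}, {Inl 1, Inl 2}, {Inl 2, Inl 0},
     {Inr 0, Inr 1}, {Inr 1, Inr 2}, {Inr 2, Inr 0}, {Inl 0, Inr 0}}"
proof -
  have "edges (cycle_graph 3) = (\<lambda>i. {i, (i + 1) mod 3}) ` {..<3}"
    by (auto simp: cycle_graph_def)
  then have "edges (cycle_graph 3) = {{0, 1}, {1, 2}, {2, 0}}" unfolding lessThan_3 by (simp add: numeral_2_eq_2)
  then show ?thesis unfolding cycle_cycle_def by (intro subset_antisym; simp)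
qed

text \<open>A label-free form of the forbidden graph: any edge between the two triangles serves,
  since a triangle can be numbered from any of its vertices.\<close>

definition joined_triangles :: "'a graph \<Rightarrow> 'a set \<Rightarrow> 'a set \<Rightarrow> bool" where
  "joined_triangles G S T \<longleftrightarrow> card S = 3 \<and> card T = 3 \<and> pairs S \<subseteq> edges G \<and> pairs T \<subseteq> edges G \<and>
     S \<inter> T = {} \<and> (\<exists>x\<in>S. \<exists>y\<in>T. {x, y} \<in> edges G)"

lemma contains_copy_imp_joined_triangles:
  assumes "contains_copy G (cycle_cycle 3 3)"
  shows "\<exists>S T. joined_triangles G S T"
proof -
  let ?H = "cycle_cycle 3 3"
  obtain G' f where G': "subgraph G' G" and f: "bij_betw f (verts G') (verts ?H)"
    and fe: "\<forall>u\<in>verts G'. \<forall>v\<in>verts G'. {u, v} \<in> edges G' \<longleftrightarrow> {f u, f v} \<in> edges ?H"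
    using assms unfolding contains_copy_def graph_iso_def by blast
  define g where "g = inv_into (verts G') f"
  have g: "bij_betw g (verts ?H) (verts G')" unfolding g_def by (rule bij_betw_inv_into[OF f])
  have gV: "g w \<in> verts G'" if "w \<in> verts ?H" for w using bij_betwE[OF g] that by blast
  have fg: "f (g w) = w" if "w \<in> verts ?H" for w
    unfolding g_def using bij_betw_inv_into_right[OF f that] .
  have ge: "{g u, g v} \<in> edges G" if "u \<in> verts ?H" "v \<in> verts ?H" "{u, v} \<in> edges ?H" for u v
    using fe gV fg that G' unfolding subgraph_def by (metis subsetD)
  have gne: "g u \<noteq> g v" if "u \<in> verts ?H" "v \<in> verts ?H" "u \<noteq> v" for u v using fg that by metis
  note H = verts_cycle_cycle_3_3 edges_cycle_cycle_3_3
  let ?S = "{g (Inl 0), g (Inl 1), g (Inl 2)}" and ?T = "{g (Inr 0), g (Inr 1), g (Inr 2)}"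
  have nS: "g (Inl 0) \<noteq> g (Inl 1)" "g (Inl 1) \<noteq> g (Inl 2)" "g (Inl 0) \<noteq> g (Inl 2)"
    and nT: "g (Inr 0) \<noteq> g (Inr 1)" "g (Inr 1) \<noteq> g (Inr 2)" "g (Inr 0) \<noteq> g (Inr 2)"
    by (rule gne; simp add: H)+
  have "card ?S = 3" "card ?T = 3" using nS nT by simp_all
  moreover have "pairs ?S \<subseteq> edges G"
    unfolding pairs_3[OF nS] using ge[of "Inl 0" "Inl 1"] ge[of "Inl 0" "Inl 2"] ge[of "Inl 1" "Inl 2"]
    by (simp add: H insert_commute)
  moreover have "pairs ?T \<subseteq> edges G"
    unfolding pairs_3[OF nT] using ge[of "Inr 0" "Inr 1"] ge[of "Inr 0" "Inr 2"] ge[of "Inr 1" "Inr 2"]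
    by (simp add: H insert_commute)
  moreover have "{g (Inl 0), g (Inr 0)} \<in> edges G" by (rule ge) (simp_all add: H)
  moreover have "?S \<inter> ?T = {}" using gne by (simp add: H)
  ultimately show ?thesis unfolding joined_triangles_def by blast
qed

lemma joined_triangles_imp_contains_copy:
  assumes simple: "simple_graph G" and J: "joined_triangles G S T"
  shows "contains_copy G (cycle_cycle 3 3)"
proof -
  obtain x y where xy: "x \<in> S" "y \<in> T" "{x, y} \<in> edges G" using J unfolding joined_triangles_def by blast
  have c: "card S = 3" "card T = 3" "pairs S \<subseteq> edges G" "pairs T \<subseteq> edges G" "S \<inter> T = {}"
    using J by (auto simp: joined_triangles_def)
  have ex: "\<exists>y z. A = {x, y, z} \<and> x \<noteq> y \<and> y \<noteq> z \<and> x \<noteq> z" if "card A = 3" "x \<in> A" for A and x :: 'a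
  proof -
    have "card (A - {x}) = 2" using that by simp
    then obtain y z where "A - {x} = {y, z}" "y \<noteq> z" by (auto simp: card_2_iff)
    then show ?thesis using that(2) by blast
  qed
  obtain x1 x2 where S: "S = {x, x1, x2}" "x \<noteq> x1" "x1 \<noteq> x2" "x \<noteq> x2" using ex[OF c(1) xy(1)] by blast
  obtain y1 y2 where T: "T = {y, y1, y2}" "y \<noteq> y1" "y1 \<noteq> y2" "y \<noteq> y2" using ex[OF c(2) xy(2)] by blast
  have ds: "distinct [x, x1, x2, y, y1, y2]" using S T c(5) by auto
  then have ds': "distinct [y2, y1, y, x2, x1, x]" by auto
  define G' where "G' = \<lparr>verts = S \<union> T, edges = pairs S \<union> pairs T \<union> {{x, y}}\<rparr>"
  have EG: "edges G' = {{x, x1}, {x, x2}, {x1, x2}, {y, y1}, {y, y2}, {y1, y2}, {x, y}}"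
    unfolding G'_def using S(1) T(1) pairs_3[OF S(2-4)] pairs_3[OF T(2-4)] by auto
  have VG: "verts G' = {x, x1, x2, y, y1, y2}" using S(1) T(1) unfolding G'_def by auto
  have sub: "edges G' \<subseteq> edges G" unfolding G'_def using c xy by auto
  have "\<Union>(edges G') = verts G'" unfolding EG VG by auto
  moreover have "\<Union>(edges G) \<subseteq> verts G" using simple by (auto simp: simple_graph_def)
  ultimately have "verts G' \<subseteq> verts G" using sub by blast
  moreover have "simple_graph G'"
    unfolding simple_graph_def EG VG using ds by auto
  ultimately have "subgraph G' G" using sub by (simp add: subgraph_def)
  moreover have "graph_iso G' (cycle_cycle 3 3)"
  proof -
    define f :: "'a \<Rightarrow> nat + nat" where "f = (\<lambda>u. if u = x then Inl 0 else if u = x1 then Inl 1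
      else if u = x2 then Inl 2 else if u = y then Inr 0 else if u = y1 then Inr 1 else Inr 2)"
    have f: "f x = Inl 0" "f x1 = Inl 1" "f x2 = Inl 2" "f y = Inr 0" "f y1 = Inr 1" "f y2 = Inr 2"
      using ds by (auto simp: f_def)
    have "bij_betw f (verts G') (verts (cycle_cycle 3 3))"
      unfolding bij_betw_def
    proof
      show "inj_on f (verts G')" unfolding VG inj_on_def using f by simp
      show "f ` verts G' = verts (cycle_cycle 3 3)" unfolding VG verts_cycle_cycle_3_3 using f by simp
    qed
    moreover have "\<forall>u\<in>verts G'. \<forall>v\<in>verts G'. {u, v} \<in> edges G' \<longleftrightarrow> {f u, f v} \<in> edges (cycle_cycle 3 3)"
      unfolding VG EG edges_cycle_cycle_3_3 using f ds ds' by (simp add: doubleton_eq_iff)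
    ultimately show ?thesis unfolding graph_iso_def by blast
  qed
  ultimately show ?thesis unfolding contains_copy_def by blast
qed

section \<open>Induced subgraphs, double counting and edge bounds\<close>

definition induce :: "'a graph \<Rightarrow> 'a set \<Rightarrow> 'a graph" where
  "induce G S = \<lparr>verts = S, edges = pairs S \<inter> edges G\<rparr>"

lemma verts_induce [simp]: "verts (induce G S) = S"
  and edges_induce [simp]: "edges (induce G S) = pairs S \<inter> edges G"
  by (simp_all add: induce_def)

lemma simple_graph_induce: "simple_graph (induce G S)"
  by (auto simp: simple_graph_def pairs_def)

lemma planar_induce:
  assumes "planar G" "S \<subseteq> verts G"
  shows "planar (induce G S)"
proof -
  obtain p \<gamma> where d: "plane_drawing G p \<gamma>" using assms(1) by (auto simp: planar_def)
  have "plane_drawing (induce G S) p \<gamma>"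
    unfolding plane_drawing_def
  proof (intro conjI ballI impI)
    show "inj_on p (verts (induce G S))"
      using d assms(2) by (auto simp: plane_drawing_def intro: inj_on_subset)
    have "p ` verts (induce G S) \<subseteq> p ` verts G" using assms(2) by auto
    then show "\<gamma> e ` {0<..<1} \<inter> p ` verts (induce G S) = {}" if "e \<in> edges (induce G S)" for e
      using d that unfolding plane_drawing_def by fastforce
  qed (use d in \<open>auto simp: plane_drawing_def\<close>)
  then show ?thesis by (auto simp: planar_def)
qed

lemma joined_triangles_induce: "joined_triangles (induce G S) A B \<Longrightarrow> joined_triangles G A B"
  by (auto simp: joined_triangles_def)

lemma triple_double_count:
  assumes "finite E" "finite F" and tri: "\<And>T. T \<in> F \<Longrightarrow> card T = 3 \<and> pairs T \<subseteq> E"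
  shows "3 * card F = (\<Sum>e\<in>E. card {T \<in> F. e \<in> pairs T})"
proof -
  have "3 * card F = (\<Sum>T\<in>F. card (pairs T))" using tri by (simp add: card_pairs_3)
  also have "\<dots> = (\<Sum>T\<in>F. \<Sum>e\<in>E. if e \<in> pairs T then 1 else 0)"
  proof (rule sum.cong[OF refl])
    fix T assume "T \<in> F"
    then have "E \<inter> {e. e \<in> pairs T} = pairs T" using tri by blast
    then show "card (pairs T) = (\<Sum>e\<in>E. if e \<in> pairs T then 1 else 0)"
      using assms(1) by (simp add: sum.If_cases)
  qed
  also have "\<dots> = (\<Sum>e\<in>E. \<Sum>T\<in>F. if e \<in> pairs T then 1 else 0)" by (rule sum.swap)
  also have "\<dots> = (\<Sum>e\<in>E. card {T \<in> F. e \<in> pairs T})"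
    using assms(2) by (simp add: sum.If_cases Int_def)
  finally show ?thesis .
qed

text \<open>The numbers of members through the edges sum to \<open>3 * card F\<close>; reaching
  \<open>2 * card E\<close> forces every summand to be 2.\<close>

lemma card_triples_le:
  assumes "finite E" "finite F" and "\<And>T. T \<in> F \<Longrightarrow> card T = 3 \<and> pairs T \<subseteq> E"
    and deg: "\<And>e. e \<in> E \<Longrightarrow> card {T \<in> F. e \<in> pairs T} \<le> 2"
  shows "3 * card F \<le> 2 * card E"
    and "\<lbrakk>2 * card E \<le> 3 * card F; e \<in> E\<rbrakk> \<Longrightarrow> card {T \<in> F. e \<in> pairs T} = 2"
proof -
  note eq = triple_double_count[OF assms(1-3)]
  have "(\<Sum>e\<in>E. card {T \<in> F. e \<in> pairs T}) \<le> (\<Sum>e\<in>E. 2)" by (intro sum_mono deg)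
  then show "3 * card F \<le> 2 * card E" using eq by simp
  assume a: "2 * card E \<le> 3 * card F" "e \<in> E"
  show "card {T \<in> F. e \<in> pairs T} = 2"
  proof (rule ccontr)
    assume "card {T \<in> F. e \<in> pairs T} \<noteq> 2"
    then have "card {T \<in> F. e \<in> pairs T} < 2" using deg[OF a(2)] by simp
    then have "(\<Sum>e\<in>E. card {T \<in> F. e \<in> pairs T}) < (\<Sum>e\<in>E. 2)"
      using a(2) deg assms(1) by (intro sum_strict_mono_ex1) auto
    then show False using a(1) eq by simp
  qed
qed

lemma finite_triangles:
  assumes "simple_graph G" "finite (verts G)"
    and F: "\<And>T. T \<in> F \<Longrightarrow> card T = 3 \<and> pairs T \<subseteq> edges G"
  shows "finite F" "\<Union>F \<subseteq> verts G"
proof -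
  have "\<Union>(edges G) \<subseteq> verts G" using assms(1) by (auto simp: simple_graph_def)
  moreover have "T \<subseteq> \<Union>(edges G)" if "T \<in> F" for T
    using F[OF that] Union_pairs[of T] by blast
  ultimately show U: "\<Union>F \<subseteq> verts G" by blast
  then have "F \<subseteq> Pow (verts G)" by blast
  then show "finite F" using assms(2) finite_subset by blast
qed

text \<open>Inserting \<open>3 f3 <= 2 e\<close> into \<open>2 e + 8 <= 4 n + f3\<close> gives
  \<open>4 e <= 12 n - 24\<close>. A graph with fewer edges than vertices, or with at most three
  edges, obeys the bound anyway.\<close>

lemma planar_edge_bound:
  assumes simple: "simple_graph G" and fin: "finite (verts G)" and planar: "planar G"
    and n: "3 \<le> card (verts G)"
  shows "card (edges G) + 6 \<le> 3 * card (verts G)"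
proof (cases "card (verts G) \<le> card (edges G) \<and> 4 \<le> card (edges G)")
  case False
  then show ?thesis using n by linarith
next
  case True
  have finE: "finite (edges G)" by (rule finite_edges[OF simple fin])
  obtain F where F: "\<And>T. T \<in> F \<Longrightarrow> card T = 3 \<and> pairs T \<subseteq> edges G"
    "\<And>e. e \<in> edges G \<Longrightarrow> card {T \<in> F. e \<subseteq> T} \<le> 2"
    "2 * card (edges G) + 8 \<le> 4 * card (verts G) + card F"
    by (rule planar_facial_triangles[OF simple fin planar]) (use True that in auto)
  have "finite F" using finite_triangles[OF simple fin F(1)] by blast
  have "3 * card F \<le> 2 * card (edges G)"
  proof (rule card_triples_le(1)[OF finE \<open>finite F\<close> F(1)])
    fix e assume e: "e \<in> edges G"
    then have "{T \<in> F. e \<in> pairs T} = {T \<in> F. e \<subseteq> T}" using simple by (auto simp: pairs_def simple_graph_def)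
    then show "card {T \<in> F. e \<in> pairs T} \<le> 2" using F(2)[OF e] by simp
  qed
  then show ?thesis using F(3) by linarith
qed

text \<open>The set \<open>S\<close> may leave the graph, because \<open>triangle_family\<close>
  asks for its bounds on all sets of size 5 and 6. Points outside the graph span no edges.\<close>

lemma planar_induced_bound:
  assumes simple: "simple_graph G" and fin: "finite (verts G)" and planar: "planar G"
    and n: "3 \<le> card S"
  shows "card (pairs S \<inter> edges G) + 6 \<le> 3 * card S"
proof -
  let ?S = "S \<inter> verts G"
  have finS: "finite S" using n by (intro card_ge_0_finite) simp
  have eq: "pairs S \<inter> edges G = pairs ?S \<inter> edges G"
    using simple by (auto simp: pairs_def simple_graph_def)
  have le: "card ?S \<le> card S" using finS by (intro card_mono) auto
  show ?thesis
  proof (cases "3 \<le> card ?S")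
    case True
    have "card (edges (induce G ?S)) + 6 \<le> 3 * card (verts (induce G ?S))"
      by (rule planar_edge_bound) (use fin planar True in \<open>auto intro: simple_graph_induce planar_induce\<close>)
    then show ?thesis unfolding eq using le by simp
  next
    case False
    have "card (pairs ?S \<inter> edges G) \<le> card (pairs ?S)" using finS finite_pairs[of ?S] by (intro card_mono) auto
    also have "\<dots> = card ?S choose 2" using finS by (intro card_pairs) auto
    also have "\<dots> \<le> 1"
    proof -
      have "card ?S = 0 \<or> card ?S = 1 \<or> card ?S = 2" using False by linarith
      then show ?thesis by (elim disjE) (simp_all add: numeral_2_eq_2)
    qed
    finally show ?thesis unfolding eq using n by simp
  qed
qed

text \<open>Count the incidences of members with vertices other than \<open>x\<close>: two per
  member, at most two per vertex. The strict inequality comes from \<open>x\<close> itself.\<close>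

lemma star_triple_family:
  assumes fin: "finite C" and c3: "\<And>T. T \<in> C \<Longrightarrow> card T = 3" and x: "\<And>T. T \<in> C \<Longrightarrow> x \<in> T" and "C \<noteq> {}"
    and deg: "\<And>y. y \<noteq> x \<Longrightarrow> card {T \<in> C. x \<in> T \<and> y \<in> T} \<le> 2"
  shows "card C < card (\<Union>C)"
proof -
  have finU: "finite (\<Union>C)" using fin c3 by (intro finite_Union) (auto intro: card_ge_0_finite)
  let ?U = "\<Union>C - {x}"
  have "2 * card C = (\<Sum>T\<in>C. card (T - {x}))" using c3 x by simp
  also have "\<dots> = (\<Sum>T\<in>C. \<Sum>y\<in>?U. if y \<in> T then 1 else 0)"
  proof (rule sum.cong[OF refl])
    fix T assume "T \<in> C"
    then have "?U \<inter> {y. y \<in> T} = T - {x}" by blast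
    then show "card (T - {x}) = (\<Sum>y\<in>?U. if y \<in> T then 1 else 0)" using finU by (simp add: sum.If_cases)
  qed
  also have "\<dots> = (\<Sum>y\<in>?U. \<Sum>T\<in>C. if y \<in> T then 1 else 0)" by (rule sum.swap)
  also have "\<dots> = (\<Sum>y\<in>?U. card {T \<in> C. x \<in> T \<and> y \<in> T})"
  proof (rule sum.cong[OF refl])
    fix y
    have "C \<inter> {T. y \<in> T} = {T \<in> C. x \<in> T \<and> y \<in> T}" using x by blast
    then show "(\<Sum>T\<in>C. if y \<in> T then 1 else 0) = card {T \<in> C. x \<in> T \<and> y \<in> T}"
      using fin by (simp add: sum.If_cases)
  qed
  also have "\<dots> \<le> (\<Sum>y\<in>?U. 2)" using deg by (intro sum_mono) auto
  finally have "card C \<le> card ?U" by simp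
  also have "\<dots> < card (\<Union>C)" using finU x \<open>C \<noteq> {}\<close> by (intro psubset_card_mono) auto
  finally show ?thesis .
qed

section \<open>The upper bound\<close>

lemma triangle_family_of_planar:
  assumes G: "simple_graph G" "finite (verts G)" "planar G"
    and F: "\<And>T. T \<in> F \<Longrightarrow> card T = 3 \<and> pairs T \<subseteq> edges G"
      "\<And>e. e \<in> edges G \<Longrightarrow> card {T \<in> F. e \<subseteq> T} \<le> 2" "finite F"
    and C: "C \<subseteq> F" "C \<noteq> {}" "\<And>S T. \<lbrakk>S \<in> C; T \<in> C\<rbrakk> \<Longrightarrow> S \<inter> T \<noteq> {}"
  shows "x \<noteq> y \<Longrightarrow> card {T \<in> C. x \<in> T \<and> y \<in> T} \<le> 2"
    and "\<forall>x. \<exists>T\<in>C. x \<notin> T \<Longrightarrow> triangle_family C (edges G)"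
proof -
  have fC: "finite C" using F(3) C(1) finite_subset by blast
  have deg: "card {T \<in> C. x \<in> T \<and> y \<in> T} \<le> 2" if "x \<noteq> y" for x y
  proof (cases "{x, y} \<in> edges G")
    case True
    have "card {T \<in> C. x \<in> T \<and> y \<in> T} \<le> card {T \<in> F. {x, y} \<subseteq> T}"
      using C(1) F(3) by (intro card_mono) auto
    then show ?thesis using F(2)[OF True] by linarith
  next
    case False
    have "{x, y} \<in> pairs T" if "x \<in> T" "y \<in> T" for T using that \<open>x \<noteq> y\<close> by (simp add: pairs_def)
    then have "{T \<in> C. x \<in> T \<and> y \<in> T} = {}" using False F(1) C(1) by blast
    then show ?thesis by (metis card.empty zero_le)
  qed
  then show "x \<noteq> y \<Longrightarrow> card {T \<in> C. x \<in> T \<and> y \<in> T} \<le> 2" .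
  assume ns: "\<forall>x. \<exists>T\<in>C. x \<notin> T"
  show "triangle_family C (edges G)"
  proof
    show "card (pairs S \<inter> edges G) \<le> 9" if "card S = 5" for S :: "'a set"
      using planar_induced_bound[OF G, of S] that by simp
    show "card (pairs S \<inter> edges G) \<le> 12" if "card S = 6" for S :: "'a set"
      using planar_induced_bound[OF G, of S] that by simp
    show "S \<inter> T \<noteq> {}" if "S \<in> C" "T \<in> C" for S T using C(3) that .
    show "card T = 3" "pairs T \<subseteq> edges G" if "T \<in> C" for T using F(1) C(1) that by blast+
    show "\<exists>T\<in>C. x \<notin> T" for x using ns by blast
  qed (fact fC C(2) deg)+
qed

text \<open>Twelve edges force 8 facial triangles. Two disjoint ones would use up all vertices with
  no edge between them, hence only six edges. So all intersect, but a family with a common vertex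
  has at most 5 members and one without at most 7.\<close>

lemma planar_six_vertices:
  assumes G: "simple_graph G" "finite (verts G)" "planar G" and n: "card (verts G) = 6"
    and free: "\<not> contains_copy G (cycle_cycle 3 3)"
  shows "card (edges G) \<le> 11"
proof (rule ccontr)
  assume "\<not> card (edges G) \<le> 11"
  then have e: "card (edges G) \<ge> 12" by simp
  have finE: "finite (edges G)" by (rule finite_edges[OF G(1,2)])
  obtain F where F: "\<And>T. T \<in> F \<Longrightarrow> card T = 3 \<and> pairs T \<subseteq> edges G"
    "\<And>e. e \<in> edges G \<Longrightarrow> card {T \<in> F. e \<subseteq> T} \<le> 2"
    "2 * card (edges G) + 8 \<le> 4 * card (verts G) + card F"
    by (rule planar_facial_triangles[OF G]) (use e n that in auto)
  have finF: "finite F" and FV: "\<Union>F \<subseteq> verts G" using finite_triangles[OF G(1,2) F(1)] by blast+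
  have F8: "card F \<ge> 8" using F(3) e n by linarith
  have meet: "S \<inter> T \<noteq> {}" if ST: "S \<in> F" "T \<in> F" for S T
  proof
    assume dis: "S \<inter> T = {}"
    have fin: "finite S" "finite T" using F(1) ST by (auto intro: card_ge_0_finite)
    have "S \<union> T \<subseteq> verts G" using FV ST by blast
    moreover have "card (S \<union> T) = 6" using card_Un_disjoint[OF fin dis] F(1) ST by simp
    ultimately have V: "S \<union> T = verts G" using G(2) n by (intro card_seteq) auto
    have "\<not> joined_triangles G S T" using joined_triangles_imp_contains_copy[OF G(1)] free by blast
    then have no: "\<And>x y. \<lbrakk>x \<in> S; y \<in> T\<rbrakk> \<Longrightarrow> {x, y} \<notin> edges G"
      using F(1) ST dis unfolding joined_triangles_def by blast
    have "edges G \<subseteq> pairs S \<union> pairs T"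
    proof
      fix e assume e: "e \<in> edges G"
      then obtain x y where xy: "e = {x, y}" "x \<noteq> y" "x \<in> S \<union> T" "y \<in> S \<union> T"
        using G(1) V by (auto simp: simple_graph_def card_2_iff)
      then have "e \<subseteq> S \<or> e \<subseteq> T" using no[of x y] no[of y x] e by (auto simp: insert_commute)
      moreover have "card e = 2" using xy by simp
      ultimately show "e \<in> pairs S \<union> pairs T" by (auto simp: pairs_def)
    qed
    then have "card (edges G) \<le> card (pairs S \<union> pairs T)" using fin finite_pairs by (intro card_mono) auto
    also have "\<dots> \<le> 3 + 3" using card_Un_le[of "pairs S" "pairs T"] card_pairs_3 F(1) ST by metis
    finally show False using e by simp
  qed
  have "F \<noteq> {}" using F8 by auto
  have fam1: "card {T \<in> F. x \<in> T \<and> y \<in> T} \<le> 2" if "x \<noteq> y" for x y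
    by (rule triangle_family_of_planar(1)[where F = F]) (fact G F finF order_refl \<open>F \<noteq> {}\<close> meet that)+
  have fam2: "triangle_family F (edges G)" if "\<forall>x. \<exists>T\<in>F. x \<notin> T"
    by (rule triangle_family_of_planar(2)[where F = F]) (fact G F finF order_refl \<open>F \<noteq> {}\<close> meet that)+
  show False
  proof (cases "\<forall>x. \<exists>T\<in>F. x \<notin> T")
    case True
    then show False using triangle_family.card_nonstar(1)[OF fam2] F8 by simp
  next
    case False
    then obtain x where x: "\<And>T. T \<in> F \<Longrightarrow> x \<in> T" by blast
    have "card F < card (\<Union>F)"
      by (rule star_triple_family[OF finF _ x \<open>F \<noteq> {}\<close>]) (use F(1) fam1 in auto)
    also have "\<dots> \<le> card (verts G)" using FV G(2) by (rule card_mono[rotated])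
    finally show False using F8 n by simp
  qed
qed

lemma intersecting_equiv:
  assumes simple: "simple_graph G" and free: "\<not> contains_copy G (cycle_cycle 3 3)"
    and F: "\<And>T. T \<in> F \<Longrightarrow> card T = 3 \<and> pairs T \<subseteq> edges G"
  shows "equiv F {(S, T). S \<in> F \<and> T \<in> F \<and> S \<inter> T \<noteq> {}}"
proof (rule equivI)
  show "{(S, T). S \<in> F \<and> T \<in> F \<and> S \<inter> T \<noteq> {}} \<subseteq> F \<times> F" by auto
  show "refl_on F {(S, T). S \<in> F \<and> T \<in> F \<and> S \<inter> T \<noteq> {}}"
    using F by (force simp: refl_on_def)
  show "sym {(S, T). S \<in> F \<and> T \<in> F \<and> S \<inter> T \<noteq> {}}" by (auto simp: sym_def)
  show "trans {(S, T). S \<in> F \<and> T \<in> F \<and> S \<inter> T \<noteq> {}}"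
  proof (rule transI, clarsimp)
    fix S T U assume a: "S \<in> F" "T \<in> F" "U \<in> F" "S \<inter> T \<noteq> {}" "T \<inter> U \<noteq> {}" "S \<inter> U = {}"
    then obtain x y where xy: "x \<in> S" "x \<in> T" "y \<in> T" "y \<in> U" by blast
    then have "x \<noteq> y" using a(6) by blast
    then have "{x, y} \<in> pairs T" using xy by (simp add: pairs_def)
    then have "{x, y} \<in> edges G" using F[OF a(2)] by blast
    then have "joined_triangles G S U" using F a xy unfolding joined_triangles_def by blast
    then show False using joined_triangles_imp_contains_copy[OF simple] free by blast
  qed
qed

text \<open>A class without common vertex is treated by the number of vertices it covers: the
  binomial coefficient suffices up to four, \<open>card_nonstar\<close> from six on. On five
  vertices, 6 members and at most 9 edges put every edge on two members; the class is then closed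
  and exhausts the graph, which has at least 10 edges.\<close>

lemma card_class_le:
  assumes G: "simple_graph G" "finite (verts G)" "planar G" and many: "10 \<le> card (edges G)"
    and F: "\<And>T. T \<in> F \<Longrightarrow> card T = 3 \<and> pairs T \<subseteq> edges G"
      "\<And>e. e \<in> edges G \<Longrightarrow> card {T \<in> F. e \<subseteq> T} \<le> 2" "finite F"
    and closed: "\<And>F'. \<lbrakk>F' \<subseteq> F; F' \<noteq> {}; closed_triples F'\<rbrakk> \<Longrightarrow> edges G = \<Union>(pairs ` F')"
    and C: "C \<subseteq> F" "C \<noteq> {}" "\<And>S T. \<lbrakk>S \<in> C; T \<in> C\<rbrakk> \<Longrightarrow> S \<inter> T \<noteq> {}"
  shows "card C \<le> card (\<Union>C)" "card C < card (\<Union>C) \<or> card C \<le> 7"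
proof -
  have fam1: "card {T \<in> C. x \<in> T \<and> y \<in> T} \<le> 2" if "x \<noteq> y" for x y
    by (rule triangle_family_of_planar(1)[where F = F]) (fact G F C that)+
  have fam2: "triangle_family C (edges G)" if "\<forall>x. \<exists>T\<in>C. x \<notin> T"
    by (rule triangle_family_of_planar(2)[where F = F]) (fact G F C that)+
  have fC: "finite C" using F(3) C(1) finite_subset by blast
  have c3: "card T = 3" if "T \<in> C" for T using F(1) C(1) that by blast
  let ?U = "\<Union>C"
  have finU: "finite ?U" using fC c3 by (intro finite_Union) (auto intro: card_ge_0_finite)
  have "card C \<le> card ?U \<and> (card C < card ?U \<or> card C \<le> 7)"
  proof (cases "\<forall>x. \<exists>T\<in>C. x \<notin> T")
    case False
    then obtain x where x: "\<And>T. T \<in> C \<Longrightarrow> x \<in> T" by blast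
    have "card C < card (\<Union>C)"
      by (rule star_triple_family[OF fC c3 x C(2)]) (use fam1 in auto)
    then show ?thesis by simp
  next
    case True
    interpret triangle_family C "edges G" by (rule fam2[OF True])
    have small: "card C \<le> card ?U choose 3"
    proof -
      have "C \<subseteq> {T. T \<subseteq> ?U \<and> card T = 3}" using c3 by blast
      then have "card C \<le> card {T. T \<subseteq> ?U \<and> card T = 3}" using finU by (intro card_mono) auto
      then show ?thesis using n_subsets[OF finU, of 3] by simp
    qed
    have "card C \<le> card ?U"
    proof -
      consider "card ?U \<le> 2" | "card ?U = 3" | "card ?U = 4" | "card ?U = 5" | "card ?U = 6" | "7 \<le> card ?U"
        by linarith
      then show ?thesis
      proof cases
        case 1 then show ?thesis using small by (simp add: binomial_eq_0)
      next
        case 2 then show ?thesis using small by simp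
      next
        case 3 then show ?thesis using small by (simp add: numeral_eq_Suc)
      next
        case 5 then show ?thesis using card_nonstar(2) by simp
      next
        case 6 then show ?thesis using card_nonstar(1) by simp
      next
        case 4
        let ?E = "pairs ?U \<inter> edges G"
        have E9: "card ?E \<le> 9" using five[OF 4] .
        have finE: "finite ?E" using finite_pairs[OF finU] by simp
        have t: "card T = 3 \<and> pairs T \<subseteq> ?E" if "T \<in> C" for T
          using c3 tri that unfolding pairs_def by blast
        have d: "card {T \<in> C. e \<in> pairs T} \<le> 2" if "e \<in> ?E" for e
        proof -
          have "card {T \<in> C. e \<in> pairs T} \<le> card {T \<in> F. e \<subseteq> T}"
            using C(1) F(3) by (intro card_mono) (auto simp: pairs_def)
          then show ?thesis using F(2)[of e] that by simp
        qed
        have ctl: "card {T \<in> C. e \<in> pairs T} = 2" if "2 * card ?E \<le> 3 * card C" "e \<in> ?E" for e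
          by (rule card_triples_le(2)[where E = ?E]) (fact finE fC t d that)+
        show ?thesis
        proof (rule ccontr)
          assume "\<not> card C \<le> card ?U"
          then have le: "2 * card ?E \<le> 3 * card C" using 4 E9 by linarith
          have "edges G = \<Union>(pairs ` C)"
          proof (rule closed[OF C(1,2)], unfold closed_triples_def, intro ballI)
            fix T e assume Te: "T \<in> C" "e \<in> pairs T"
            then have "card {T \<in> C. e \<in> pairs T} = 2" using ctl[OF le] t by blast
            then obtain A B where AB: "{T \<in> C. e \<in> pairs T} = {A, B}" "A \<noteq> B" by (auto simp: card_2_iff)
            then have "A \<in> {T \<in> C. e \<in> pairs T}" "B \<in> {T \<in> C. e \<in> pairs T}" by simp_all
            then show "\<exists>T'\<in>C. T' \<noteq> T \<and> e \<subseteq> T'" using AB(2) unfolding pairs_def by blast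
          qed
          then have "edges G \<subseteq> ?E" using t by blast
          then have "card (edges G) \<le> 9" using card_mono[OF finE] E9 by (meson order_trans)
          then show False using many by simp
        qed
      qed
    qed
    then show ?thesis using card_nonstar(1) by simp
  qed
  then show "card C \<le> card (\<Union>C)" "card C < card (\<Union>C) \<or> card C \<le> 7" by blast+
qed

text \<open>Distinct classes cover disjoint vertex sets, so their bounds add up to
  \<open>card F <= card (\<Union>F)\<close>. If several classes covered every vertex, connectivity
  would give an edge leaving one of them, and its ends would lie in disjoint members, which is a
  forbidden copy. A single class has the sharper bound of \<open>card_class_le\<close>.\<close>

lemma card_facial_triangles_le:
  assumes G: "simple_graph G" "finite (verts G)" "planar G" and many: "10 \<le> card (edges G)"
    and free: "\<not> contains_copy G (cycle_cycle 3 3)"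
    and conn: "\<And>A. \<lbrakk>A \<subseteq> verts G; A \<noteq> {}; A \<noteq> verts G\<rbrakk> \<Longrightarrow> \<exists>x\<in>A. \<exists>y\<in>verts G - A. {x, y} \<in> edges G"
    and F: "\<And>T. T \<in> F \<Longrightarrow> card T = 3 \<and> pairs T \<subseteq> edges G"
      "\<And>e. e \<in> edges G \<Longrightarrow> card {T \<in> F. e \<subseteq> T} \<le> 2"
    and closed: "\<And>F'. \<lbrakk>F' \<subseteq> F; F' \<noteq> {}; closed_triples F'\<rbrakk> \<Longrightarrow> edges G = \<Union>(pairs ` F')"
  shows "card F < card (verts G) \<or> card F \<le> 7"
proof (cases "F = {}")
  case False
  have finF: "finite F" and FV: "\<Union>F \<subseteq> verts G" using finite_triangles[OF G(1,2) F(1)] by blast+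
  define R where "R = {(S, T). S \<in> F \<and> T \<in> F \<and> S \<inter> T \<noteq> {}}"
  have eq: "equiv F R" unfolding R_def by (rule intersecting_equiv[OF G(1) free F(1)])
  have CF: "C \<subseteq> F" "C \<noteq> {}" if "C \<in> F // R" for C
    using that eq in_quotient_imp_subset in_quotient_imp_non_empty by blast+
  have same: "S \<inter> T \<noteq> {}" if "C \<in> F // R" "S \<in> C" "T \<in> C" for C S T
    using quotient_eq_iff[OF eq that(1,1,2,3)] unfolding R_def by blast
  have diff: "S \<inter> T = {}" if "C \<in> F // R" "C' \<in> F // R" "C \<noteq> C'" "S \<in> C" "T \<in> C'" for C C' S T
    using quotient_eq_iff[OF eq that(1,2,4,5)] that CF unfolding R_def by blast
  have cls: "card C \<le> card (\<Union>C)" "card C < card (\<Union>C) \<or> card C \<le> 7" if C: "C \<in> F // R" for C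
    by (rule card_class_le[where F = F and G = G]; fact G many F finF closed CF[OF C] same[OF C])+
  have finU: "finite (\<Union>F)" by (rule finite_subset[OF FV G(2)])
  have finQ: "finite (F // R)" by (rule finite_quotient[OF finF]) (auto simp: R_def)
  show ?thesis
  proof (cases "\<exists>C. F // R = {C}")
    case True
    then obtain C where C: "F // R = {C}" by blast
    then have "F = C" using Union_quotient[OF eq] by simp
    then have "card F < card (\<Union>F) \<or> card F \<le> 7" using cls(2)[of C] C by simp
    moreover have "card (\<Union>F) \<le> card (verts G)" using FV G(2) by (rule card_mono[rotated])
    ultimately show ?thesis by linarith
  next
    case multi: False
    have "\<Union>F \<noteq> verts G"
    proof
      assume V: "\<Union>F = verts G"
      obtain T where T: "T \<in> F" using False by blast
      then obtain C where C: "C \<in> F // R" "T \<in> C" using Union_quotient[OF eq] by blast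
      then obtain C' where C': "C' \<in> F // R" "C' \<noteq> C" using multi by blast
      have "T \<noteq> {}" using F(1)[OF T] by auto
      then have "\<Union>C \<noteq> {}" using C(2) by blast
      moreover have "\<Union>C \<subseteq> verts G" using CF(1)[OF C(1)] FV by blast
      moreover have "\<Union>C \<noteq> verts G"
      proof -
        obtain T' where T': "T' \<in> C'" using CF(2)[OF C'(1)] by blast
        then have "T' \<in> F" using CF(1)[OF C'(1)] by blast
        then have "T' \<noteq> {}" "T' \<subseteq> verts G" using F(1)[of T'] FV by auto
        moreover have "T' \<inter> \<Union>C = {}" using diff[OF C'(1) C(1) C'(2) T'] by blast
        ultimately show ?thesis by blast
      qed
      ultimately obtain x y where xy: "x \<in> \<Union>C" "y \<in> verts G - \<Union>C" "{x, y} \<in> edges G"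
        using conn[of "\<Union>C"] by blast
      obtain A where A: "A \<in> C" "x \<in> A" using xy(1) by blast
      obtain B where B: "B \<in> F" "y \<in> B" using xy(2) V by blast
      obtain D where D: "D \<in> F // R" "B \<in> D" using B(1) Union_quotient[OF eq] by blast
      have "D \<noteq> C" using D(2) B(2) xy(2) by blast
      then have "A \<inter> B = {}" using diff[OF C(1) D(1) _ A(1) D(2)] by blast
      moreover have "A \<in> F" using A(1) CF(1)[OF C(1)] by blast
      ultimately have "joined_triangles G A B"
        using F(1) B A xy(3) unfolding joined_triangles_def by blast
      then show False using joined_triangles_imp_contains_copy[OF G(1)] free by blast
    qed
    have "card F = card (\<Union>(F // R))" using Union_quotient[OF eq] by simp
    also have "\<dots> = (\<Sum>C\<in>F // R. card C)"
    proof (rule card_Union_disjoint)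
      show "pairwise disjnt (F // R)"
        unfolding pairwise_def disjnt_def using quotient_disj[OF eq] by blast
      show "finite C" if "C \<in> F // R" for C by (rule finite_subset[OF CF(1)[OF that] finF])
    qed
    also have "\<dots> \<le> (\<Sum>C\<in>F // R. card (\<Union>C))" using cls(1) by (intro sum_mono)
    also have "\<dots> = card (\<Union>C\<in>F // R. \<Union>C)"
    proof (rule card_UN_disjoint[symmetric])
      show "finite (F // R)" by fact
      show "\<forall>C\<in>F // R. finite (\<Union>C)" using CF(1) finU by (meson Union_mono finite_subset)
      show "\<forall>C\<in>F // R. \<forall>D\<in>F // R. C \<noteq> D \<longrightarrow> \<Union>C \<inter> \<Union>D = {}" using diff by blast
    qed
    also have "(\<Union>C\<in>F // R. \<Union>C) = \<Union>F" using Union_quotient[OF eq] by blast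
    also have "card (\<Union>F) < card (verts G)"
      using FV \<open>\<Union>F \<noteq> verts G\<close> G(2) by (intro psubset_card_mono) auto
    finally show ?thesis by simp
  qed
qed simp

text \<open>The weaker bound serves disconnected graphs: two parts with slack 5 each give slack 10,
  more than the required 9. From three to six vertices it follows from
  \<open>3 n - 6\<close>.\<close>

lemma C3_C3_free_upper_bound:
  assumes "simple_graph G" "finite (verts G)" "planar G" "\<not> contains_copy G (cycle_cycle 3 3)"
  shows "(1 \<le> card (verts G) \<longrightarrow> 2 * card (edges G) + 5 \<le> 5 * card (verts G)) \<and>
    (7 \<le> card (verts G) \<longrightarrow> 2 * card (edges G) + 9 \<le> 5 * card (verts G))"
  using assms
proof (induction "card (verts G)" arbitrary: G rule: less_induct)
  case less
  note G = less.prems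
  let ?V = "verts G" and ?E = "edges G"
  have finE: "finite ?E" by (rule finite_edges[OF G(1,2)])
  \<comment> \<open>With at most 13 edges the bound is immediate, as
    \<open>2 * 13 + 9 = 5 * 7\<close>; likewise with fewer edges than vertices.\<close>
  have big: "2 * card ?E + 9 \<le> 5 * card ?V" if n7: "7 \<le> card ?V"
  proof (cases "card ?V \<le> card ?E \<and> 14 \<le> card ?E")
    case False
    then show ?thesis using n7 by linarith
  next
    case True
    then have c2: "card ?V \<le> card ?E" "4 \<le> card ?E" and c10: "10 \<le> card ?E" by auto
    show ?thesis
    proof (cases "\<exists>A \<subseteq> ?V. A \<noteq> {} \<and> A \<noteq> ?V \<and> (\<forall>x\<in>A. \<forall>y\<in>?V - A. {x, y} \<notin> ?E)")
      case True
      then obtain A where A: "A \<subseteq> ?V" "A \<noteq> {}" "A \<noteq> ?V" "\<And>x y. \<lbrakk>x \<in> A; y \<in> ?V - A\<rbrakk> \<Longrightarrow> {x, y} \<notin> ?E"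
        by blast
      let ?B = "?V - A"
      have part: "2 * card (pairs S \<inter> ?E) + 5 \<le> 5 * card S" if S: "S \<subseteq> ?V" "S \<noteq> {}" "S \<noteq> ?V" for S
      proof -
        have fS: "finite S" using S(1) G(2) finite_subset by blast
        have "card (verts (induce G S)) < card ?V" using S G(2) by (auto intro!: psubset_card_mono)
        moreover have "\<not> contains_copy (induce G S) (cycle_cycle 3 3)"
          using contains_copy_imp_joined_triangles joined_triangles_induce
            joined_triangles_imp_contains_copy[OF G(1)] G(4) by blast
        ultimately have "1 \<le> card S \<longrightarrow> 2 * card (pairs S \<inter> ?E) + 5 \<le> 5 * card S"
          using less.hyps[of "induce G S"] simple_graph_induce[of G S] planar_induce[OF G(3) S(1)] fS by simp
        moreover have "card S \<noteq> 0" using fS S(2) by simp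
        ultimately show ?thesis by simp
      qed
      have "?E \<subseteq> (pairs A \<inter> ?E) \<union> (pairs ?B \<inter> ?E)"
      proof
        fix e assume e: "e \<in> ?E"
        then obtain x y where xy: "e = {x, y}" "x \<noteq> y" "x \<in> ?V" "y \<in> ?V"
          using G(1) by (auto simp: simple_graph_def card_2_iff)
        then have "e \<subseteq> A \<or> e \<subseteq> ?B" using A(4)[of x y] A(4)[of y x] e by (auto simp: insert_commute)
        moreover have "card e = 2" using xy by simp
        ultimately show "e \<in> (pairs A \<inter> ?E) \<union> (pairs ?B \<inter> ?E)" using e by (auto simp: pairs_def)
      qed
      then have "card ?E \<le> card ((pairs A \<inter> ?E) \<union> (pairs ?B \<inter> ?E))" using finE by (intro card_mono) auto
      also have "\<dots> \<le> card (pairs A \<inter> ?E) + card (pairs ?B \<inter> ?E)" by (rule card_Un_le)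
      finally have "card ?E \<le> card (pairs A \<inter> ?E) + card (pairs ?B \<inter> ?E)" .
      moreover have "2 * card (pairs A \<inter> ?E) + 5 \<le> 5 * card A" by (rule part[OF A(1-3)])
      moreover have "2 * card (pairs ?B \<inter> ?E) + 5 \<le> 5 * card ?B" by (rule part) (use A in auto)
      moreover have "card ?B = card ?V - card A" "card A \<le> card ?V"
        using A(1) G(2) by (auto simp: card_Diff_subset finite_subset card_mono)
      ultimately show ?thesis by linarith
    next
      case False
      then have conn: "\<exists>x\<in>A. \<exists>y\<in>?V - A. {x, y} \<in> ?E" if "A \<subseteq> ?V" "A \<noteq> {}" "A \<noteq> ?V" for A
        using that by blast
      obtain F where F: "\<And>T. T \<in> F \<Longrightarrow> card T = 3 \<and> pairs T \<subseteq> ?E"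
        "\<And>e. e \<in> ?E \<Longrightarrow> card {T \<in> F. e \<subseteq> T} \<le> 2"
        "2 * card ?E + 8 \<le> 4 * card ?V + card F"
        "\<And>F'. \<lbrakk>F' \<subseteq> F; F' \<noteq> {}; closed_triples F'\<rbrakk> \<Longrightarrow> ?E = \<Union>(pairs ` F')"
        by (rule planar_facial_triangles[OF G(1-3) c2]) (rule that)
      have "card F < card ?V \<or> card F \<le> 7"
        by (rule card_facial_triangles_le[OF G(1-3) c10 G(4)]) (fact conn F)+
      then show ?thesis
      proof
        assume "card F \<le> 7"
        \<comment> \<open>On 7 vertices, 7 triangles give \<open>2 * card ?E <= 27\<close>, and
          parity supplies the missing unit. From 8 vertices on, 7 is already less than
          \<open>card ?V\<close>.\<close>
        then have "card ?E \<le> 13" if "card ?V = 7" using F(3) that by linarith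
        then show ?thesis using F(3) n7 \<open>card F \<le> 7\<close> by (cases "card ?V = 7") linarith+
      qed (use F(3) in linarith)
    qed
  qed
  have "2 * card ?E + 5 \<le> 5 * card ?V" if n1: "1 \<le> card ?V"
  proof (cases "3 \<le> card ?V")
    case True
    then show ?thesis using planar_edge_bound[OF G(1-3)] big by (cases "7 \<le> card ?V") linarith+
  next
    case False
    have "?E \<subseteq> pairs ?V" using G(1) by (auto simp: simple_graph_def pairs_def)
    then have "card ?E \<le> card ?V choose 2"
      using card_mono[OF finite_pairs[OF G(2)]] card_pairs[OF G(2)] by simp
    moreover have "card ?V = 1 \<or> card ?V = 2" using False n1 by linarith
    moreover have "(1::nat) choose 2 = 0" "(2::nat) choose 2 = 1" by (simp_all add: binomial_eq_0)
    ultimately have "card ?V = 1 \<and> card ?E = 0 \<or> card ?V = 2 \<and> card ?E \<le> 1" by (metis le_zero_eq)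
    then show ?thesis by linarith
  qed
  with big show ?case by blast
qed

section \<open>Extremal graphs\<close>

lemma linepath_image_open:
  fixes a b :: complex
  assumes "a \<noteq> b"
  shows "linepath a b ` {0<..<1} = open_segment a b"
  using assms by (simp add: open_segment_image_interval linepath_def)

text \<open>With the smaller vertex first, each edge is a single pair \<open>(u, v)\<close> and its
  segment has a fixed direction. Adjacent edges share only end points, so all conditions concern
  open segments.\<close>

lemma planar_straight_line:
  fixes G :: "nat graph" and p :: "nat \<Rightarrow> complex"
  assumes simple: "simple_graph G" and inj: "inj_on p (verts G)"
    and pts: "\<And>u v w. \<lbrakk>u < v; {u, v} \<in> edges G; w \<in> verts G\<rbrakk> \<Longrightarrow> p w \<notin> open_segment (p u) (p v)"
    and cross: "\<And>u v u' v'. \<lbrakk>u < v; {u, v} \<in> edges G; u' < v'; {u', v'} \<in> edges G; (u, v) \<noteq> (u', v')\<rbrakk>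
      \<Longrightarrow> open_segment (p u) (p v) \<inter> open_segment (p u') (p v') = {}"
  shows "planar G"
proof -
  define \<gamma> where "\<gamma> = (\<lambda>e. linepath (p (Min e)) (p (Max e)))"
  have ex: "\<exists>u v. e = {u, v} \<and> u < v \<and> u \<in> verts G \<and> v \<in> verts G \<and> p u \<noteq> p v \<and> \<gamma> e = linepath (p u) (p v)"
    if "e \<in> edges G" for e
  proof -
    have "card e = 2" "e \<subseteq> verts G" using simple that by (auto simp: simple_graph_def)
    then obtain x y where "e = {x, y}" "x \<noteq> y" by (auto simp: card_2_iff)
    then obtain u v where uv: "e = {u, v}" "u < v" by (metis insert_commute linorder_less_linear)
    then have "p u \<noteq> p v" using inj \<open>e \<subseteq> verts G\<close> by (auto simp: inj_on_def)
    moreover have "\<gamma> e = linepath (p u) (p v)" using uv by (simp add: \<gamma>_def)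
    ultimately show ?thesis using uv \<open>e \<subseteq> verts G\<close> by blast
  qed
  have "plane_drawing G p \<gamma>"
    unfolding plane_drawing_def
  proof (intro conjI ballI impI)
    show "inj_on p (verts G)" by (rule inj)
    fix e assume e: "e \<in> edges G"
    obtain u v where uv: "e = {u, v}" "u < v" "p u \<noteq> p v" "\<gamma> e = linepath (p u) (p v)" using ex[OF e] by blast
    have img: "\<gamma> e ` {0<..<1} = open_segment (p u) (p v)" unfolding uv(4) by (rule linepath_image_open[OF uv(3)])
    show "arc (\<gamma> e)" using uv by simp
    show "{pathstart (\<gamma> e), pathfinish (\<gamma> e)} = p ` e" using uv by simp
    show V: "\<gamma> e ` {0<..<1} \<inter> p ` verts G = {}" unfolding img using pts uv e by blast
    fix e' assume e': "e' \<in> edges G" "e \<noteq> e'"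
    obtain x y where xy: "e' = {x, y}" "x < y" "x \<in> verts G" "y \<in> verts G" "\<gamma> e' = linepath (p x) (p y)"
      using ex[OF e'(1)] by blast
    have "path_image (\<gamma> e') = open_segment (p x) (p y) \<union> {p x, p y}"
      unfolding xy(5) path_image_linepath closed_segment_eq_open by simp
    moreover have "open_segment (p u) (p v) \<inter> open_segment (p x) (p y) = {}"
      by (rule cross) (use uv xy e e' in auto)
    ultimately show "\<gamma> e ` {0<..<1} \<inter> path_image (\<gamma> e') = {}" using V xy(3,4) unfolding img by blast
  qed
  then show ?thesis by (auto simp: planar_def)
qed

lemma in_open_segmentD:
  fixes a b z :: complex
  assumes "z \<in> open_segment a b"
  shows "\<exists>t. 0 < t \<and> t < 1 \<and> Re z = (1 - t) * Re a + t * Re b \<and> Im z = (1 - t) * Im a + t * Im b"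
  using assms by (auto simp: in_segment)

text \<open>The vertices \<open>0, 1\<close> are joined to each other and to the path \<open>2-3-4\<close>, which gives \<open>K\<^sub>5\<close> minus an
  edge; vertex \<open>5\<close> is joined to \<open>0, 1\<close> only.\<close>

definition small_graph :: "nat \<Rightarrow> nat graph" where
  "small_graph n = \<lparr>verts = {..<n}, edges = pairs {..<n} - {{2, 4}, {2, 5}, {3, 5}, {4, 5}}\<rparr>"

text \<open>The path 2-3-4 is stacked above the segment between 0 and 1, and vertex 5 hangs below
  it. Distinct nonzero heights give the segments from 0, and those from 1, distinct slopes.\<close>

definition height :: "nat \<Rightarrow> real" where
  "height v = (if v = 5 then -1 else real v - 1)"

definition small_point :: "nat \<Rightarrow> complex" where
  "small_point v = (if v = 0 then Complex (-1) 0 else if v = 1 then Complex 1 0 else Complex 0 (height v))"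

lemma height_inj: "\<lbrakk>height v = height w; 2 \<le> v; v < 6; 2 \<le> w; w < 6\<rbrakk> \<Longrightarrow> v = w"
  by (auto simp: height_def split: if_splits)

lemma height_nonzero: "2 \<le> v \<Longrightarrow> height v \<noteq> 0"
  by (auto simp: height_def)

text \<open>Coordinates tell the edges apart: segments from 0 upwards or downwards have negative
  real part, those from 1 positive real part, the path lies on the axis, and the edge between 0 and
  1 has height 0. Within a kind, slope or height identifies the edge.\<close>

lemma small_edge_point:
  assumes "u < v" "{u, v} \<in> edges (small_graph 6)" "z \<in> open_segment (small_point u) (small_point v)"
  shows "u = 0 \<and> v = 1 \<and> Im z = 0 \<and> \<bar>Re z\<bar> < 1 \<or>
    (u = 0 \<and> 2 \<le> v \<and> v < 6 \<and> (\<exists>t. 0 < t \<and> t < 1 \<and> Re z = t - 1 \<and> Im z = t * height v)) \<or>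
    (u = 1 \<and> 2 \<le> v \<and> v < 6 \<and> (\<exists>t. 0 < t \<and> t < 1 \<and> Re z = 1 - t \<and> Im z = t * height v)) \<or>
    ((u = 2 \<and> v = 3 \<or> u = 3 \<and> v = 4) \<and> Re z = 0 \<and> real u - 1 < Im z \<and> Im z < real u)"
proof -
  obtain t where t: "0 < t" "t < 1"
    and z: "Re z = (1 - t) * Re (small_point u) + t * Re (small_point v)"
      "Im z = (1 - t) * Im (small_point u) + t * Im (small_point v)"
    using in_open_segmentD[OF assms(3)] by blast
  have v: "v < 6" "{u, v} \<notin> {{2, 4}, {2, 5}, {3, 5}, {4, 5}}"
    using assms(2) by (auto simp: small_graph_def pairs_def)
  consider "u = 0" "v = 1" | "u = 0" "2 \<le> v" | "u = 1" "2 \<le> v" | "2 \<le> u" using assms(1) by linarith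
  then show ?thesis
  proof cases
    case 1
    then show ?thesis using z t by (auto simp: small_point_def)
  next
    case 2
    then have "\<exists>t. 0 < t \<and> t < 1 \<and> Re z = t - 1 \<and> Im z = t * height v"
      using z t by (intro exI[of _ t]) (simp add: small_point_def)
    then show ?thesis using 2 v(1) by simp
  next
    case 3
    then have "\<exists>t. 0 < t \<and> t < 1 \<and> Re z = 1 - t \<and> Im z = t * height v"
      using z t by (intro exI[of _ t]) (simp add: small_point_def)
    then show ?thesis using 3 v(1) by simp
  next
    case 4
    then have "u = 2 \<and> v = 3 \<or> u = 3 \<and> v = 4"
    proof -
      have "u \<in> {2, 3, 4}" "v \<in> {3, 4, 5}" using 4 v(1) assms(1) by auto
      then show ?thesis using v(2) assms(1) by auto
    qed
    then show ?thesis using z t by (elim disjE conjE) (auto simp: small_point_def height_def algebra_simps)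
  qed
qed

lemma planar_small_graph_6: "planar (small_graph 6)"
proof (rule planar_straight_line[of _ small_point])
  show "simple_graph (small_graph 6)" by (auto simp: simple_graph_def small_graph_def pairs_def)
  show "inj_on small_point (verts (small_graph 6))"
  proof (rule inj_onI)
    fix v w assume a: "v \<in> verts (small_graph 6)" "w \<in> verts (small_graph 6)" "small_point v = small_point w"
    then have "v < 6" "w < 6" by (simp_all add: small_graph_def)
    then show "v = w" using a(3) height_inj[of v w] by (auto simp: small_point_def split: if_splits)
  qed
  show "small_point w \<notin> open_segment (small_point u) (small_point v)"
    if "u < v" "{u, v} \<in> edges (small_graph 6)" "w \<in> verts (small_graph 6)" for u v w
  proof
    assume "small_point w \<in> open_segment (small_point u) (small_point v)"
    note P = small_edge_point[OF that(1,2) this]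
    consider "w = 0" | "w = 1" | "2 \<le> w" by linarith
    then show False
    proof cases
      case 1 then show ?thesis using P by (auto simp: small_point_def)
    next
      case 2 then show ?thesis using P by (auto simp: small_point_def)
    next
      case 3
      then have "Re (small_point w) = 0" "Im (small_point w) = height w" "height w \<noteq> 0"
        using height_nonzero by (auto simp: small_point_def)
      then show ?thesis using P by (auto simp: height_def split: if_splits)
    qed
  qed
  show "open_segment (small_point u) (small_point v) \<inter> open_segment (small_point u') (small_point v') = {}"
    if a: "u < v" "{u, v} \<in> edges (small_graph 6)" "u' < v'" "{u', v'} \<in> edges (small_graph 6)" "(u, v) \<noteq> (u', v')"
    for u v u' v'
  proof (rule ccontr)
    assume "\<not> ?thesis"
    then obtain z where z: "z \<in> open_segment (small_point u) (small_point v)"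
      "z \<in> open_segment (small_point u') (small_point v')" by blast
    have "height v \<noteq> 0 \<or> v < 2" "height v' \<noteq> 0 \<or> v' < 2" using height_nonzero by (meson not_less)+
    then show False
      using small_edge_point[OF a(1,2) z(1)] small_edge_point[OF a(3,4) z(2)] a(5) height_inj[of v v']
      by (elim disjE exE conjE) simp_all
  qed
qed

lemma small_graph_eq_induce: "n \<le> 6 \<Longrightarrow> small_graph n = induce (small_graph 6) {..<n}"
  unfolding small_graph_def induce_def by (auto simp: pairs_def)

lemma planar_small_graph:
  assumes "n \<le> 6"
  shows "planar (small_graph n)"
proof -
  have "{..<n} \<subseteq> verts (small_graph 6)" using assms by (auto simp: small_graph_def)
  then have "planar (induce (small_graph 6) {..<n})" by (rule planar_induce[OF planar_small_graph_6])
  then show ?thesis unfolding small_graph_eq_induce[OF assms, symmetric] .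
qed

lemma card_small_graph:
  "card (edges (small_graph 3)) = 3" "card (edges (small_graph 4)) = 6"
  "card (edges (small_graph 5)) = 9" "card (edges (small_graph 6)) = 11"
proof -
  let ?X = "{{2, 4}, {2, 5}, {3, 5}, {4, 5}} :: nat set set"
  have c: "card (edges (small_graph n)) = (n choose 2) - card (pairs {..<n} \<inter> ?X)" for n
    using card_Diff_subset_Int[of "pairs {..<n}" ?X] card_pairs[of "{..<n}"] by (simp add: small_graph_def)
  have "pairs {..<3} \<inter> ?X = {}" "pairs {..<4} \<inter> ?X = {}" "pairs {..<5} \<inter> ?X = {{2, 4}}" "pairs {..<6} \<inter> ?X = ?X"
    by (auto simp: pairs_def)
  then have 1: "card (pairs {..<3} \<inter> ?X) = 0" "card (pairs {..<4} \<inter> ?X) = 0" "card (pairs {..<5} \<inter> ?X) = 1"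
    "card (pairs {..<6} \<inter> ?X) = 4"
    by (simp_all add: doubleton_eq_iff)
  have 2: "(3::nat) choose 2 = 3" "(4::nat) choose 2 = 6" "(5::nat) choose 2 = 10" "(6::nat) choose 2 = 15"
    by (simp_all add: numeral_eq_Suc)
  show "card (edges (small_graph 3)) = 3" "card (edges (small_graph 4)) = 6"
    "card (edges (small_graph 5)) = 9" "card (edges (small_graph 6)) = 11"
    unfolding c 1 2 by simp_all
qed

text \<open>Without 0 and 1 only the edges 23 and 34 remain, so every triangle contains 0 or 1. Two
  disjoint triangles contain exactly one of them each; the other two vertices form 23 or 34, so both
  triangles contain 3.\<close>

lemma small_graph_free: "\<not> contains_copy (small_graph 6) (cycle_cycle 3 3)"
proof
  assume "contains_copy (small_graph 6) (cycle_cycle 3 3)"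
  then obtain S T where J: "joined_triangles (small_graph 6) S T"
    using contains_copy_imp_joined_triangles by blast
  have ax: "e = {2, 3} \<or> e = {3, 4}" if "e \<in> edges (small_graph 6)" "0 \<notin> e" "1 \<notin> e" for e
  proof -
    have e: "card e = 2" "e \<subseteq> {..<6}" "e \<notin> {{2, 4}, {2, 5}, {3, 5}, {4, 5}}"
      using that(1) by (auto simp: small_graph_def pairs_def)
    have "e \<subseteq> {2, 3, 4, 5}"
    proof
      fix x assume x: "x \<in> e"
      have "x \<noteq> 0" "x \<noteq> 1" using x that(2,3) by metis+
      moreover have "x < 6" using subsetD[OF e(2) x] by simp
      ultimately show "x \<in> {2, 3, 4, 5}" by auto
    qed
    then have "e \<in> pairs {2, 3, 4, 5}" using e(1) by (simp add: pairs_def)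
    then have "e = {3, 4} \<or> e = {2, 3}" using e(3) by (simp add: pairs_insert pairs_empty)
    then show ?thesis by argo
  qed
  have 1: "0 \<in> A \<or> 1 \<in> A" if "card A = 3" "pairs A \<subseteq> edges (small_graph 6)" for A
  proof (rule ccontr)
    assume "\<not> ?thesis"
    then have "pairs A \<subseteq> {{2, 3}, {3, 4}}" using ax that(2) unfolding pairs_def by blast
    then have "card (pairs A) \<le> card {{2, 3}, {3, 4 :: nat}}" by (intro card_mono) auto
    then show False using card_pairs_3[OF that(1)] by (simp add: doubleton_eq_iff)
  qed
  have 3: "3 \<in> A" if A: "card A = 3" "pairs A \<subseteq> edges (small_graph 6)" "{0, 1} \<inter> A = {x}" for A x
  proof -
    have "x \<in> A" using A(3) by blast
    then have "A - {x} \<in> pairs A" using A(1) by (auto simp: pairs_def)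
    moreover have "0 \<notin> A - {x}" "1 \<notin> A - {x}" using A(3) by blast+
    ultimately have "A - {x} = {2, 3} \<or> A - {x} = {3, 4}" using ax A(2) by blast
    then show ?thesis by blast
  qed
  have c: "card S = 3" "pairs S \<subseteq> edges (small_graph 6)" "card T = 3" "pairs T \<subseteq> edges (small_graph 6)" "S \<inter> T = {}"
    using J by (auto simp: joined_triangles_def)
  have "{0, 1} \<inter> S = {0} \<and> {0, 1} \<inter> T = {1} \<or> {0, 1} \<inter> S = {1} \<and> {0, 1} \<inter> T = {0}"
    using 1[OF c(1,2)] 1[OF c(3,4)] c(5) by blast
  then have "3 \<in> S" "3 \<in> T" using 3 c(1-4) by metis+
  then show False using c(5) by blast
qed

section \<open>The cone over a ladder\<close>

text \<open>Vertex 0 is the apex, the odd and the positive even vertices are the rails, and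
  \<open>{2 * k + 1, 2 * k + 2}\<close> are the rungs. For even \<open>n\<close> the last odd vertex
  has no rung, hence the rounding in \<open>(n - 1) div 2\<close>.\<close>

definition ladder_cone :: "nat \<Rightarrow> nat graph" where
  "ladder_cone n = \<lparr>verts = {..<n}, edges = (\<lambda>k. {0, k + 1}) ` {..<n - 1} \<union>
     ((\<lambda>k. {k + 1, k + 3}) ` {..<n - 3} \<union> (\<lambda>k. {2 * k + 1, 2 * k + 2}) ` {..<(n - 1) div 2})\<rparr>"

lemma ladder_cone_edge:
  assumes "u < v" "{u, v} \<in> edges (ladder_cone n)"
  shows "v < n" "u = 0 \<or> v = u + 2 \<or> odd u \<and> v = u + 1"
proof -
  have eq: "u = x \<and> v = y" if "{u, v} = {x, y}" "x < y" for x y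
    using that assms(1) by (auto simp: doubleton_eq_iff)
  consider k where "k < n - 1" "{u, v} = {0, k + 1}" | k where "k < n - 3" "{u, v} = {k + 1, k + 3}"
    | k where "k < (n - 1) div 2" "{u, v} = {2 * k + 1, 2 * k + 2}"
    using assms(2) unfolding ladder_cone_def by force
  then have "v < n \<and> (u = 0 \<or> v = u + 2 \<or> odd u \<and> v = u + 1)"
  proof cases
    case (1 k) then show ?thesis using eq[OF 1(2)] by simp
  next
    case (2 k) then show ?thesis using eq[OF 2(2)] by simp
  next
    case (3 k) then show ?thesis using eq[OF 3(2)] by auto
  qed
  then show "v < n" "u = 0 \<or> v = u + 2 \<or> odd u \<and> v = u + 1" by blast+
qed

lemma simple_ladder_cone: "simple_graph (ladder_cone n)"
  unfolding simple_graph_def ladder_cone_def by auto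

lemma card_ladder_cone:
  assumes "3 \<le> n"
  shows "card (edges (ladder_cone n)) = 2 * n - 4 + (n - 1) div 2"
proof -
  let ?A = "(\<lambda>k. {0, k + 1}) ` {..<n - 1}" and ?B = "(\<lambda>k. {k + 1, k + 3}) ` {..<n - 3}"
    and ?C = "(\<lambda>k. {2 * k + 1, 2 * k + 2}) ` {..<(n - 1) div 2}"
  have "card ?A = n - 1" by (subst card_image) (auto simp: inj_on_def doubleton_eq_iff)
  moreover have "card ?B = n - 3" by (subst card_image) (auto simp: inj_on_def doubleton_eq_iff)
  moreover have "card ?C = (n - 1) div 2" by (subst card_image) (auto simp: inj_on_def doubleton_eq_iff)
  moreover have "?B \<inter> ?C = {}"
  proof -
    have "{k + 1, k + 3} \<noteq> {2 * j + 1, 2 * j + 2}" for k j :: nat by (auto simp: doubleton_eq_iff)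
    then show ?thesis by blast
  qed
  moreover have "?A \<inter> (?B \<union> ?C) = {}"
  proof -
    have "{0, i + 1} \<noteq> {k + 1, k + 3}" "{0, i + 1} \<noteq> {2 * j + 1, 2 * j + 2}" for i j k :: nat
      by (simp_all add: doubleton_eq_iff)
    note ne = this
    have "?A \<inter> ?B = {}" using ne(1) by (auto simp only: disjoint_iff image_iff)
    moreover have "?A \<inter> ?C = {}" using ne(2) by (auto simp only: disjoint_iff image_iff)
    ultimately show ?thesis by (simp only: Int_Un_distrib Un_empty)
  qed
  ultimately have "card (edges (ladder_cone n)) = (n - 1) + ((n - 3) + (n - 1) div 2)"
    unfolding ladder_cone_def by (simp add: card_Un_disjoint)
  then show ?thesis using assms by simp
qed

text \<open>A triangle off the apex has vertices \<open>x < y < z\<close> at differences 1 or 2, so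
  \<open>z - x\<close> is 2 and the other differences are 1. These would be rungs starting at the
  consecutive vertices \<open>x\<close> and \<open>y\<close>, but rungs start at odd
  vertices.\<close>

lemma ladder_cone_free: "\<not> contains_copy (ladder_cone n) (cycle_cycle 3 3)"
proof
  assume "contains_copy (ladder_cone n) (cycle_cycle 3 3)"
  then obtain S T where J: "joined_triangles (ladder_cone n) S T"
    using contains_copy_imp_joined_triangles by blast
  have "0 \<in> A" if A: "card A = 3" "pairs A \<subseteq> edges (ladder_cone n)" for A
  proof (rule ccontr)
    assume 0: "0 \<notin> A"
    have fin: "finite A" using A(1) by (intro card_ge_0_finite) simp
    obtain x y z where xyz: "x \<in> A" "y \<in> A" "z \<in> A" "x < y" "y < z"
    proof -
      obtain l where l: "set l = A" "sorted_wrt (<) l" "length l = 3"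
        using fin A(1) by (metis length_sorted_list_of_set set_sorted_list_of_set strict_sorted_list_of_set)
      then obtain x y z where "l = [x, y, z]" by (auto simp: numeral_3_eq_3 length_Suc_conv)
      then have "set [x, y, z] = A" "sorted_wrt (<) [x, y, z]" using l by blast+
      then show ?thesis using that by auto
    qed
    have e: "{x, y} \<in> edges (ladder_cone n)" "{y, z} \<in> edges (ladder_cone n)" "{x, z} \<in> edges (ladder_cone n)"
      using A(2) xyz by (auto simp: pairs_def)
    have "x \<noteq> 0" "y \<noteq> 0" using 0 xyz by metis+
    then show False
      using ladder_cone_edge(2)[OF _ e(1)] ladder_cone_edge(2)[OF _ e(2)] ladder_cone_edge(2)[OF _ e(3)] xyz(4,5)
      by (auto, presburger)
  qed
  then show False using J unfolding joined_triangles_def by blast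
qed

definition ladder_index :: "nat \<Rightarrow> real" where
  "ladder_index v = real ((v + 1) div 2)"

definition ladder_side :: "nat \<Rightarrow> real" where
  "ladder_side v = (if odd v then -1 else 1)"

text \<open>The rails run down the two rays \<open>Im z = - |Re z|\<close> through integer depths,
  below the apex. No rail vertex hides another from the apex, since \<open>Im z + |Re z|\<close>
  falls linearly from 1 to 0 along a spoke.\<close>

definition ladder_point :: "nat \<Rightarrow> complex" where
  "ladder_point v = (if v = 0 then Complex 0 1 else Complex (ladder_side v * ladder_index v) (- ladder_index v))"

lemma ladder_index_pos: "v \<noteq> 0 \<Longrightarrow> ladder_index v \<ge> 1"
  by (cases v) (auto simp: ladder_index_def)

lemma ladder_side_cases: "ladder_side v = 1 \<or> ladder_side v = -1"
  by (simp add: ladder_side_def)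

lemma ladder_inj: "\<lbrakk>ladder_side v = ladder_side w; ladder_index v = ladder_index w; v \<noteq> 0; w \<noteq> 0\<rbrakk> \<Longrightarrow> v = w"
  unfolding ladder_side_def ladder_index_def by (auto split: if_splits) presburger+

text \<open>A rail edge runs between consecutive integer depths, so the floor of the depth recovers
  the index of its upper end.\<close>

lemma ladder_index_frac:
  assumes "ladder_index v + t = ladder_index w + t'" "0 \<le> t" "t < 1" "0 \<le> t'" "t' < 1"
  shows "ladder_index v = ladder_index w"
proof -
  have "\<lfloor>ladder_index v + t\<rfloor> = int ((v + 1) div 2)" "\<lfloor>ladder_index w + t'\<rfloor> = int ((w + 1) div 2)"
    unfolding ladder_index_def using assms(2-5) by (auto intro!: floor_unique)
  then have "int ((v + 1) div 2) = int ((w + 1) div 2)" using assms(1) by metis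
  then show ?thesis unfolding ladder_index_def by (metis of_nat_eq_iff)
qed

text \<open>With \<open>h z = Im z + \<bar>Re z\<bar>\<close>, the three kinds of edges lie in \<open>h > 0\<close>, \<open>h = 0\<close> and \<open>h < 0\<close>.\<close>

lemma ladder_edge_point:
  assumes "u < v" "{u, v} \<in> edges (ladder_cone n)" "z \<in> open_segment (ladder_point u) (ladder_point v)"
  shows "(u = 0 \<and> (\<exists>t. 0 < t \<and> t < 1 \<and> Re z = t * (ladder_side v * ladder_index v) \<and> Im z + \<bar>Re z\<bar> = 1 - t)) \<or>
    (u \<noteq> 0 \<and> v = u + 2 \<and> Im z + \<bar>Re z\<bar> = 0 \<and>
      (\<exists>t. 0 < t \<and> t < 1 \<and> Re z = ladder_side u * (ladder_index u + t))) \<or>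
    (odd u \<and> v = u + 1 \<and> Im z = - ladder_index u \<and> Im z + \<bar>Re z\<bar> < 0)"
proof -
  obtain t where t: "0 < t" "t < 1"
    and z: "Re z = (1 - t) * Re (ladder_point u) + t * Re (ladder_point v)"
      "Im z = (1 - t) * Im (ladder_point u) + t * Im (ladder_point v)"
    using in_open_segmentD[OF assms(3)] by blast
  have v0: "v \<noteq> 0" using assms(1) by simp
  consider "u = 0" | "u \<noteq> 0" "v = u + 2" | "u \<noteq> 0" "odd u" "v = u + 1"
    using ladder_cone_edge(2)[OF assms(1,2)] by blast
  then show ?thesis
  proof cases
    case 1
    then have r: "Re z = t * (ladder_side v * ladder_index v)" "Im z = 1 - t - t * ladder_index v"
      using z v0 by (simp_all add: ladder_point_def)
    moreover have "\<bar>Re z\<bar> = t * ladder_index v"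
      using r(1) ladder_side_cases[of v] ladder_index_pos[OF v0] t by (auto simp: abs_mult)
    ultimately show ?thesis using 1 t by auto
  next
    case 2
    have s: "ladder_side v = ladder_side u" "ladder_index v = ladder_index u + 1"
      using 2 by (auto simp: ladder_side_def ladder_index_def)
    then have r: "Re z = ladder_side u * (ladder_index u + t)" "Im z = - (ladder_index u + t)"
      using z v0 2 by (simp_all add: ladder_point_def algebra_simps)
    moreover have "\<bar>Re z\<bar> = ladder_index u + t"
      using r(1) ladder_side_cases[of u] ladder_index_pos[OF 2(1)] t by auto
    ultimately show ?thesis using 2 t by auto
  next
    case 3
    have s: "ladder_side u = -1" "ladder_side v = 1" "ladder_index v = ladder_index u"
      using 3 by (auto simp: ladder_side_def ladder_index_def)
    then have r: "Re z = (2 * t - 1) * ladder_index u" "Im z = - ladder_index u"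
      using z v0 3 by (simp_all add: ladder_point_def algebra_simps)
    have "\<bar>Re z\<bar> = \<bar>2 * t - 1\<bar> * ladder_index u"
      using r(1) ladder_index_pos[OF 3(1)] by (simp add: abs_mult)
    also have "\<dots> < 1 * ladder_index u"
      using t ladder_index_pos[OF 3(1)] by (intro mult_strict_right_mono) auto
    finally show ?thesis using 3 r by simp
  qed
qed

lemma ladder_side_index_inj:
  assumes "ladder_side v * x = ladder_side w * y" "x > 0" "y > 0"
  shows "ladder_side v = ladder_side w" "x = y"
  using assms ladder_side_cases[of v] ladder_side_cases[of w] by auto

lemma planar_ladder_cone: "planar (ladder_cone n)"
proof (rule planar_straight_line[of _ ladder_point])
  show "simple_graph (ladder_cone n)" by (rule simple_ladder_cone)
  have h: "Im (ladder_point w) + \<bar>Re (ladder_point w)\<bar> = (if w = 0 then 1 else 0)" for w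
    using ladder_side_cases[of w] ladder_index_pos[of w] by (auto simp: ladder_point_def)
  show "inj_on ladder_point (verts (ladder_cone n))"
  proof (rule inj_onI)
    fix v w assume eq: "ladder_point v = ladder_point w"
    have "(if v = 0 then 1 else 0 :: real) = (if w = 0 then 1 else 0)" using h[of v] h[of w] unfolding eq by metis
    then have zero: "v = 0 \<longleftrightarrow> w = 0" by (simp split: if_splits)
    show "v = w"
    proof (cases "v = 0")
      case False
      then have "ladder_side v * ladder_index v = ladder_side w * ladder_index w"
        using arg_cong[OF eq, of Re] zero by (simp add: ladder_point_def)
      moreover have "0 < ladder_index v" "0 < ladder_index w"
        using ladder_index_pos[of v] ladder_index_pos[of w] False zero by linarith+
      ultimately show ?thesis
        using ladder_side_index_inj[of v "ladder_index v" w "ladder_index w"] ladder_inj[of v w] False zero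
        by blast
    qed (use zero in simp)
  qed
  show "ladder_point w \<notin> open_segment (ladder_point u) (ladder_point v)"
    if a: "u < v" "{u, v} \<in> edges (ladder_cone n)" "w \<in> verts (ladder_cone n)" for u v w
  proof
    assume "ladder_point w \<in> open_segment (ladder_point u) (ladder_point v)"
    from ladder_edge_point[OF a(1,2) this] show False
    proof (elim disjE conjE exE)
      fix t assume t: "u \<noteq> 0" "0 < t" "t < 1" "Re (ladder_point w) = ladder_side u * (ladder_index u + t)"
        "Im (ladder_point w) + \<bar>Re (ladder_point w)\<bar> = 0"
      have w: "w \<noteq> 0" using h[of w] t(5) by (metis zero_neq_one)
      then have "ladder_side w * ladder_index w = ladder_side u * (ladder_index u + t)"
        using t(4) by (simp add: ladder_point_def)
      then have "ladder_index w = ladder_index u + t"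
        using ladder_side_index_inj(2) ladder_index_pos[OF w] ladder_index_pos[OF t(1)] t(2) by force
      then show False using ladder_index_frac[of w 0 u t] t by simp
    qed (use h[of w] in \<open>auto split: if_splits\<close>)
  qed
  show "open_segment (ladder_point u) (ladder_point v) \<inter> open_segment (ladder_point u') (ladder_point v') = {}"
    if a: "u < v" "{u, v} \<in> edges (ladder_cone n)" "u' < v'" "{u', v'} \<in> edges (ladder_cone n)" "(u, v) \<noteq> (u', v')"
    for u v u' v'
  proof (rule ccontr)
    assume "\<not> ?thesis"
    then obtain z where z: "z \<in> open_segment (ladder_point u) (ladder_point v)"
      "z \<in> open_segment (ladder_point u') (ladder_point v')" by blast
    have v0: "v \<noteq> 0" "v' \<noteq> 0" using a by auto
    define H where "H = Im z + \<bar>Re z\<bar>"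
    note A = ladder_edge_point[OF a(1,2) z(1), folded H_def]
    note A' = ladder_edge_point[OF a(3,4) z(2), folded H_def]
    consider (spokes) "0 < H" | (sides) "H = 0" | (rungs) "H < 0" by linarith
    then show False
    proof cases
      case spokes
      obtain t where t: "u = 0" "0 < t" "Re z = t * (ladder_side v * ladder_index v)" "H = 1 - t"
        using A spokes by (metis less_irrefl less_asym)
      obtain t' where t': "u' = 0" "0 < t'" "Re z = t' * (ladder_side v' * ladder_index v')" "H = 1 - t'"
        using A' spokes by (metis less_irrefl less_asym)
      \<comment> \<open>The value of \<open>H\<close> fixes the parameter on the spoke, and then the
        real part fixes its outer end.\<close>
      have "t = t'" using t(4) t'(4) by linarith
      then have "ladder_side v * ladder_index v = ladder_side v' * ladder_index v'" using t t' by simp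
      moreover have "0 < ladder_index v" "0 < ladder_index v'"
        using ladder_index_pos[of v] ladder_index_pos[of v'] v0 by linarith+
      ultimately have "v = v'"
        using ladder_side_index_inj[of v "ladder_index v" v' "ladder_index v'"] ladder_inj[of v v'] v0 by blast
      then show False using a(5) t t' by simp
    next
      case sides
      obtain t where t: "u \<noteq> 0" "v = u + 2" "0 < t" "t < 1" "Re z = ladder_side u * (ladder_index u + t)"
        using A sides by (metis less_irrefl diff_gt_0_iff_gt)
      obtain t' where t': "u' \<noteq> 0" "v' = u' + 2" "0 < t'" "t' < 1"
          "Re z = ladder_side u' * (ladder_index u' + t')"
        using A' sides by (metis less_irrefl diff_gt_0_iff_gt)
      have eq: "ladder_side u * (ladder_index u + t) = ladder_side u' * (ladder_index u' + t')"
        using t(5) t'(5) by simp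
      have pos: "0 < ladder_index u + t" "0 < ladder_index u' + t'"
        using ladder_index_pos[of u] ladder_index_pos[of u'] t t' by linarith+
      have "ladder_index u = ladder_index u'"
        by (rule ladder_index_frac[OF ladder_side_index_inj(2)[OF eq pos]]) (use t t' in auto)
      then have "u = u'" using ladder_inj[OF ladder_side_index_inj(1)[OF eq pos]] t t' by blast
      then show False using a(5) t t' by simp
    next
      case rungs
      have r: "odd u \<and> v = u + 1 \<and> Im z = - ladder_index u"
        using A rungs by (metis less_irrefl less_asym diff_gt_0_iff_gt)
      have r': "odd u' \<and> v' = u' + 1 \<and> Im z = - ladder_index u'"
        using A' rungs by (metis less_irrefl less_asym diff_gt_0_iff_gt)
      have "ladder_side u = ladder_side u'" using r r' by (simp add: ladder_side_def)
      moreover have "ladder_index u = ladder_index u'" using r r' by simp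
      moreover have "u \<noteq> 0" "u' \<noteq> 0" using r r' by (metis even_zero)+
      ultimately have "u = u'" by (rule ladder_inj)
      then show False using a(5) r r' by simp
    qed
  qed
qed

section \<open>Assembling the three ranges of \<open>n\<close>\<close>

lemma ex_planar_eqI:
  fixes G :: "nat graph"
  assumes G: "simple_graph G" "finite (verts G)" "card (verts G) = n" "planar G" "\<not> contains_copy G H"
    and upper: "\<And>G' :: nat graph. \<lbrakk>simple_graph G'; finite (verts G'); card (verts G') = n; planar G';
      \<not> contains_copy G' H\<rbrakk> \<Longrightarrow> card (edges G') \<le> card (edges G)"
  shows "ex_planar n H = card (edges G)"
  unfolding ex_planar_def
proof (rule Max_eqI)
  let ?S = "{card (edges G) | G :: nat graph. simple_graph G \<and> finite (verts G) \<and> card (verts G) = n \<and>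
     planar G \<and> \<not> contains_copy G H}"
  show le: "m \<le> card (edges G)" if "m \<in> ?S" for m using that upper by auto
  then show "finite ?S" by (intro finite_subset[of ?S "{..card (edges G)}"]) auto
  show "card (edges G) \<in> ?S" using G by blast
qed

lemma small_graph_extremal:
  assumes "n \<le> 6"
  shows "simple_graph (small_graph n)" "finite (verts (small_graph n))" "card (verts (small_graph n)) = n"
    "planar (small_graph n)" "\<not> contains_copy (small_graph n) (cycle_cycle 3 3)"
proof -
  show simple: "simple_graph (small_graph n)" for n
    by (auto simp: simple_graph_def small_graph_def pairs_def)
  show "finite (verts (small_graph n))" "card (verts (small_graph n)) = n" by (simp_all add: small_graph_def)
  show "planar (small_graph n)" by (rule planar_small_graph[OF assms])
  show "\<not> contains_copy (small_graph n) (cycle_cycle 3 3)"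
  proof
    assume "contains_copy (small_graph n) (cycle_cycle 3 3)"
    then obtain S T where "joined_triangles (small_graph n) S T"
      using contains_copy_imp_joined_triangles by blast
    then have "joined_triangles (small_graph 6) S T"
      unfolding small_graph_eq_induce[OF assms] by (rule joined_triangles_induce)
    then show False using joined_triangles_imp_contains_copy[OF simple] small_graph_free by blast
  qed
qed

theorem theorem1:
  fixes n :: nat
  assumes "n \<ge> 3"
  shows "int (ex_planar n (cycle_cycle 3 3)) =
    (if n \<le> 5 then 3 * int n - 6
     else if n = 6 then 3 * int n - 7
     else \<lceil>5 * real n / 2\<rceil> - 5)"
proof -
  consider "n \<le> 5" | "n = 6" | "7 \<le> n" by linarith
  then show ?thesis
  proof cases
    case 1
    then have n: "n = 3 \<or> n = 4 \<or> n = 5" using assms by linarith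
    then have c: "card (edges (small_graph n)) = 3 * n - 6" using card_small_graph by auto
    have "ex_planar n (cycle_cycle 3 3) = card (edges (small_graph n))"
    proof (rule ex_planar_eqI)
      fix G :: "nat graph"
      assume "simple_graph G" "finite (verts G)" "card (verts G) = n" "planar G"
      then show "card (edges G) \<le> card (edges (small_graph n))"
        using planar_edge_bound[of G] c assms by simp
    qed (use small_graph_extremal 1 in auto)
    then show ?thesis using 1 assms c by auto
  next
    case 2
    have "ex_planar n (cycle_cycle 3 3) = card (edges (small_graph 6))"
    proof (rule ex_planar_eqI)
      fix G :: "nat graph"
      assume "simple_graph G" "finite (verts G)" "card (verts G) = n" "planar G"
        "\<not> contains_copy G (cycle_cycle 3 3)"
      then show "card (edges G) \<le> card (edges (small_graph 6))"
        using planar_six_vertices[of G] card_small_graph 2 by simp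
    qed (use small_graph_extremal[of 6] 2 in auto)
    then show ?thesis using 2 card_small_graph by simp
  next
    case 3
    note c = card_ladder_cone[OF assms]
    have "ex_planar n (cycle_cycle 3 3) = card (edges (ladder_cone n))"
    proof (rule ex_planar_eqI)
      fix G :: "nat graph"
      assume "simple_graph G" "finite (verts G)" "card (verts G) = n" "planar G"
        "\<not> contains_copy G (cycle_cycle 3 3)"
      then have "2 * card (edges G) + 9 \<le> 5 * n" using C3_C3_free_upper_bound[of G] 3 by simp
      \<comment> \<open>The edge count \<open>2 * n - 4 + (n - 1) div 2\<close> is the integer part
        of \<open>(5 * n - 9) / 2\<close>.\<close>
      then show "card (edges G) \<le> card (edges (ladder_cone n))" unfolding c using 3 by presburger
    qed (use simple_ladder_cone planar_ladder_cone ladder_cone_free in \<open>auto simp: ladder_cone_def\<close>)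
    then have ex: "ex_planar n (cycle_cycle 3 3) = 2 * n - 4 + (n - 1) div 2" using c by simp
    have "\<lceil>5 * real n / 2\<rceil> - 5 = int (2 * n - 4 + (n - 1) div 2)"
    proof (cases "even n")
      case True
      then obtain m where m: "n = 2 * m" by (rule evenE)
      have "5 * real n / 2 = of_int (5 * int m)" using m by simp
      then have "\<lceil>5 * real n / 2\<rceil> = 5 * int m" by (metis ceiling_of_int)
      moreover have "(n - 1) div 2 = m - 1" using m by presburger
      ultimately show ?thesis using m 3 by simp
    next
      case False
      then obtain m where m: "n = 2 * m + 1" by (rule oddE)
      have "\<lceil>5 * real n / 2\<rceil> = 5 * int m + 3" using m by (intro ceiling_unique) (simp_all add: field_simps)
      moreover have "(n - 1) div 2 = m" using m by simp
      ultimately show ?thesis using m 3 by simp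
    qed
    then show ?thesis using ex 3 by simp
  qed
qed

end
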